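(* Let $G$ be a connected split graph with at least one edge, with a fixed partition $V(G)=C\sqcup I$ where $C$ induces a clique and $I$ is an independent set. Let $\Delta_I=\max\{|N_G(c)\cap I| : c\in C\}$. Then $$\deg h_{R/J(G)}(t)=\operatorname{reg}(R/J(G))=\Delta_I+|C|-2.$$
   Context: $\Bbbk$ is a field and $R=\Bbbk[x_v : v\in V(G)]$ with the standard grading. The cover ideal is $J(G)=\bigl(\prod_{v\in W}x_v : W \text{ a minimal vertex cover of } G\bigr)=\bigcap_{\{u,v\}\in E(G)}(x_u,x_v)$. $\operatorname{reg}$ is Castelnuovo–Mumford regularity: $\operatorname{reg}(R/J)=\max\{j-i:\beta_{i,j}(R/J)\ne0\}$. For a standard graded $\Bbbk$-algebra $A$ with Hilbert series $H_A(t)$, the $h$-polynomial $h_A(t)\in\mathbb{Z}[t]$ is the unique polynomial with $H_A(t)=h_A(t)/(1-t)^{\dim A}$. A split graph is a graph whose vertex set admits a partition $C\sqcup I$ with $C$ inducing a clique and $I$ inducing an independent set; $N_G(c)$ is the set of neighbors of $c$. *)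

theory Defs
  imports
    "HOL-Library.Poly_Mapping"
    "HOL-Library.Extended_Nat"
    "HOL-Computational_Algebra.Polynomial_FPS"
    "HOL-Algebra.Algebraic_Closure_Type"
    "HOL-Algebra.Embedded_Algebras"
    "Jordan_Normal_Form.Matrix"
    "Graph_Theory.Graph_Theory"
begin

section \<open>Graphs\<close>

text \<open>A finite simple graph is a \<open>pair_graph\<close>: the arc set is symmetric and irreflexive,
  and an undirected edge is a pair of opposite arcs.\<close>

definition clique :: "'v pair_pre_digraph \<Rightarrow> 'v set \<Rightarrow> bool" where
  "clique G C \<longleftrightarrow> C \<subseteq> pverts G \<and> (\<forall>u\<in>C. \<forall>v\<in>C. u \<noteq> v \<longrightarrow> (u, v) \<in> parcs G)"

definition independent_set :: "'v pair_pre_digraph \<Rightarrow> 'v set \<Rightarrow> bool" where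
  "independent_set G I \<longleftrightarrow> I \<subseteq> pverts G \<and> (\<forall>u\<in>I. \<forall>v\<in>I. (u, v) \<notin> parcs G)"

definition neighbors :: "'v pair_pre_digraph \<Rightarrow> 'v \<Rightarrow> 'v set" where
  "neighbors G c = {v. (c, v) \<in> parcs G}"

definition split_partition :: "'v pair_pre_digraph \<Rightarrow> 'v set \<Rightarrow> 'v set \<Rightarrow> bool" where
  "split_partition G C I \<longleftrightarrow>
     C \<union> I = pverts G \<and> C \<inter> I = {} \<and> clique G C \<and> independent_set G I"

definition vertex_cover :: "'v pair_pre_digraph \<Rightarrow> 'v set \<Rightarrow> bool" where
  "vertex_cover G W \<longleftrightarrow> W \<subseteq> pverts G \<and> (\<forall>(u, v)\<in>parcs G. u \<in> W \<or> v \<in> W)"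

definition minimal_vertex_cover :: "'v pair_pre_digraph \<Rightarrow> 'v set \<Rightarrow> bool" where
  "minimal_vertex_cover G W \<longleftrightarrow>
     vertex_cover G W \<and> (\<forall>W'. W' \<subset> W \<longrightarrow> \<not> vertex_cover G W')"


section \<open>The polynomial ring\<close>

text \<open>The polynomial ring over \<open>'k\<close> whose variables are all elements of the finite type \<open>'v\<close>.
  It is the coordinate ring attached to a graph \<open>G\<close> precisely when \<open>pverts G = UNIV\<close>.\<close>

type_synonym ('v, 'k) mpoly = "('v \<Rightarrow>\<^sub>0 nat) \<Rightarrow>\<^sub>0 'k"

abbreviation poly_ring :: "('v::finite, 'k::field) mpoly ring" where
  "poly_ring \<equiv> ring_of_type_algebra"

definition Var :: "'v \<Rightarrow> ('v, 'k::field) mpoly" where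
  "Var v = Poly_Mapping.single (Poly_Mapping.single v 1) 1"

definition Const :: "'k::field \<Rightarrow> ('v, 'k) mpoly" where
  "Const c = Poly_Mapping.single 0 c"

definition total_degree :: "('v::finite \<Rightarrow>\<^sub>0 nat) \<Rightarrow> nat" where
  "total_degree m = (\<Sum>v\<in>UNIV. Poly_Mapping.lookup m v)"

text \<open>The component of degree \<open>d\<close>, which is zero for negative \<open>d\<close>.\<close>

definition graded_part :: "int \<Rightarrow> ('v::finite, 'k::field) mpoly set" where
  "graded_part d = {f. \<forall>m\<in>Poly_Mapping.keys f. int (total_degree m) = d}"

definition irrelevant_ideal :: "('v::finite, 'k::field) mpoly set" where
  "irrelevant_ideal = Idl\<^bsub>poly_ring\<^esub> (range Var)"

definition cover_ideal :: "'v::finite pair_pre_digraph \<Rightarrow> ('v, 'k::field) mpoly set" where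
  "cover_ideal G = Idl\<^bsub>poly_ring\<^esub> {(\<Prod>v\<in>W. Var v) | W. minimal_vertex_cover G W}"


section \<open>The \<open>h\<close>-polynomial\<close>

text \<open>The Krull dimension: supremum of the lengths \<open>n\<close> of strict chains \<open>P 0 \<subset> \<dots> \<subset> P n\<close>
  of prime ideals (with value \<open>0\<close> for the zero ring).\<close>

definition krull_dim :: "('a, 'b) ring_scheme \<Rightarrow> enat" where
  "krull_dim A = Sup {enat n | n. \<exists>P :: nat \<Rightarrow> 'a set.
     (\<forall>i\<le>n. primeideal (P i) A) \<and> (\<forall>i<n. P i \<subset> P (Suc i))}"

text \<open>In the remainder, \<open>J\<close> is a homogeneous ideal of the polynomial ring \<open>R\<close>. The Hilbert series
  of \<open>A = R/J\<close> collects the dimensions of the images of the graded components of \<open>R\<close> over the image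
  of \<open>'k\<close> in \<open>A\<close>.\<close>

definition hilbert_series :: "('v::finite, 'k::field) mpoly set \<Rightarrow> int fps" where
  "hilbert_series J = Abs_fps (\<lambda>d. int (ring.dim (poly_ring Quot J)
     ((\<lambda>f. J +>\<^bsub>poly_ring\<^esub> f) ` range Const)
     ((\<lambda>f. J +>\<^bsub>poly_ring\<^esub> f) ` graded_part (int d))))"

definition h_polynomial :: "('v::finite, 'k::field) mpoly set \<Rightarrow> int poly" where
  "h_polynomial J = (THE h.
     hilbert_series J * (1 - fps_X) ^ the_enat (krull_dim (poly_ring Quot J)) = fps_of_poly h)"


section \<open>Minimal graded free resolutions, Betti numbers and regularity\<close>

text \<open>A graded free resolution
  \<open>\<dots> \<rightarrow> F 2 \<rightarrow> F 1 \<rightarrow> F 0 \<rightarrow> R/J \<rightarrow> 0\<close>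
  by finitely generated modules. The list \<open>a i\<close> consists of the degrees of the basis of \<open>F i\<close>, i.e.
  \<open>F i\<close> is the direct sum of the \<open>R(-j)\<close> for \<open>j\<close> in \<open>a i\<close>; the matrix \<open>\<phi> i\<close> is the
  differential \<open>F (Suc i) \<rightarrow> F i\<close>; and \<open>\<epsilon>\<close> lists homogeneous representatives in \<open>R\<close> of the images
  of the basis of \<open>F 0\<close> under the augmentation \<open>F 0 \<rightarrow> R/J\<close>. All maps are homogeneous of
  degree 0.\<close>

definition graded_free_resolution ::
  "('v::finite, 'k::field) mpoly set \<Rightarrow> ('v, 'k) mpoly vec \<Rightarrow> (nat \<Rightarrow> ('v, 'k) mpoly mat) \<Rightarrow>
   (nat \<Rightarrow> int list) \<Rightarrow> bool" where
  "graded_free_resolution J \<epsilon> \<phi> a \<longleftrightarrow>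
     \<epsilon> \<in> carrier_vec (length (a 0)) \<and>
     (\<forall>k<length (a 0). \<epsilon> $ k \<in> graded_part (a 0 ! k)) \<and>
     (\<forall>i. \<phi> i \<in> carrier_mat (length (a i)) (length (a (Suc i))) \<and>
        (\<forall>l<length (a i). \<forall>k<length (a (Suc i)).
           \<phi> i $$ (l, k) \<in> graded_part (a (Suc i) ! k - a i ! l))) \<and>
     (\<forall>f. \<exists>v\<in>carrier_vec (length (a 0)). f - \<epsilon> \<bullet> v \<in> J) \<and>
     {v \<in> carrier_vec (length (a 0)). \<epsilon> \<bullet> v \<in> J} =
       (*\<^sub>v) (\<phi> 0) ` carrier_vec (length (a 1)) \<and>
     (\<forall>i. {v \<in> carrier_vec (length (a (Suc i))). \<phi> i *\<^sub>v v = 0\<^sub>v (length (a i))} =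
       (*\<^sub>v) (\<phi> (Suc i)) ` carrier_vec (length (a (Suc (Suc i)))))"

definition minimal_graded_free_resolution ::
  "('v::finite, 'k::field) mpoly set \<Rightarrow> ('v, 'k) mpoly vec \<Rightarrow> (nat \<Rightarrow> ('v, 'k) mpoly mat) \<Rightarrow>
   (nat \<Rightarrow> int list) \<Rightarrow> bool" where
  "minimal_graded_free_resolution J \<epsilon> \<phi> a \<longleftrightarrow>
     graded_free_resolution J \<epsilon> \<phi> a \<and> (\<forall>i. elements_mat (\<phi> i) \<subseteq> irrelevant_ideal)"

text \<open>\<open>\<beta>\<^sub>i\<^sub>,\<^sub>j(R/J)\<close> is the number of summands \<open>R(-j)\<close> of \<open>F i\<close> in a minimal graded free
  resolution; it does not depend on the choice of the resolution.\<close>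

definition graded_betti :: "('v::finite, 'k::field) mpoly set \<Rightarrow> nat \<Rightarrow> int \<Rightarrow> nat" where
  "graded_betti J i j = (THE n. \<exists>\<epsilon> \<phi> a.
     minimal_graded_free_resolution J \<epsilon> \<phi> a \<and> n = count_list (a i) j)"

definition regularity :: "('v::finite, 'k::field) mpoly set \<Rightarrow> int" where
  "regularity J = Max {j - int i | i j. graded_betti J i j \<noteq> 0}"

end

theory Submission
  imports Defs
begin

text \<open>
The ideal is small enough to have an explicit resolution. Assume first that every clique vertex \<open>c\<close> has a
neighbour in \<open>I\<close>, and write \<open>N c\<close> for the set of these neighbours and \<open>\<Delta>\<close> for the largest
\<open>card (N c)\<close>. The minimal vertex covers are \<open>C\<close>
and, for each \<open>c \<in> C\<close>, the set \<open>(C - {c}) \<union> N c\<close> of all neighbours of \<open>c\<close>. So \<open>J\<close> is generated by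
\<open>card C + 1\<close> squarefree monomials, with one evident relation per clique vertex: the variable \<open>c\<close> times
the generator of \<open>c\<close> is the monomial of \<open>N c\<close> times the generator of \<open>C\<close>. These relations are a basis
of all relations, and none of them has a unit coefficient, so they give a minimal resolution of
length 2 (\<open>hilbert_burch_minimal\<close>). Reading off the degrees gives the regularity. If some
\<open>c0 \<in> C\<close> has no neighbour in \<open>I\<close>, then \<open>c0\<close> can be moved from \<open>C\<close> to \<open>I\<close>; this decreases \<open>card C\<close>
by one, increases \<open>\<Delta>\<close> by one, and leads back to the first case (\<open>split_move_vertex\<close>).

Two general facts link this to the definitions. Betti numbers can be computed from any minimal
resolution (\<open>graded_betti_eq\<close>): two resolutions are compared by maps lifting the identity, whose
composite is homotopic to the identity, and minimality makes the composite equal to the identity on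
constant terms. For the \<open>h\<close>-polynomial one needs the Hilbert series and the Krull dimension. The Hilbert series
counts the monomials whose support is not a vertex cover; sorting the remaining ones by their missing clique
vertex gives the numerator \<open>1 - t^r - (1 - t) * (\<Sum>c\<in>C. t^(r - 1 + card (N c)))\<close> over \<open>(1 - t)^n\<close>,
where \<open>r = card C\<close>. The dimension is \<open>n - 2\<close> (\<open>krull_dim_J\<close>): chains of primes in the polynomial ring
are bounded by a counting argument (\<open>prime_chain_length\<close>), and monomial primes provide a chain of the
required length. After cancelling \<open>(1 - t)^2\<close> the numerator has degree \<open>r + \<Delta> - 2\<close>.
\<close>

section \<open>Ideals of the polynomial ring\<close>

lemma poly_ring_simps:
  "carrier poly_ring = UNIV" "x \<otimes>\<^bsub>poly_ring\<^esub> y = x * y" "\<one>\<^bsub>poly_ring\<^esub> = 1"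
  "\<zero>\<^bsub>poly_ring\<^esub> = 0" "x \<oplus>\<^bsub>poly_ring\<^esub> y = x + y"
  by (simp_all add: ring_of_type_algebra_def)

lemma poly_ring_cring: "cring (poly_ring :: ('v::finite, 'k::field) mpoly ring)"
  by (rule cring_from_type_algebra)

lemma poly_ring_a_inv: "\<ominus>\<^bsub>poly_ring\<^esub> (x :: ('v::finite, 'k::field) mpoly) = - x"
proof -
  interpret cring "poly_ring :: ('v, 'k) mpoly ring" by (rule poly_ring_cring)
  show ?thesis
    by (rule sum_zero_eq_neg[symmetric]) (simp_all add: poly_ring_simps)
qed

text \<open>From here on ideals are handled through the operations of the type: the carrier is the whole type,
so all carrier conditions vanish.\<close>

lemma ideal_poly_ring_iff:
  "ideal I (poly_ring :: ('v::finite, 'k::field) mpoly ring) \<longleftrightarrow>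
     0 \<in> I \<and> (\<forall>f\<in>I. \<forall>g\<in>I. f + g \<in> I) \<and> (\<forall>f\<in>I. \<forall>g. g * f \<in> I)"
  (is "?L \<longleftrightarrow> ?R")
proof
  assume ?L
  then interpret ideal I "poly_ring :: ('v, 'k) mpoly ring" .
  note closed = additive_subgroup.zero_closed[OF is_additive_subgroup]
    additive_subgroup.a_closed[OF is_additive_subgroup] I_l_closed
  show ?R using closed[unfolded poly_ring_simps] by simp
next
  assume R: ?R
  interpret cring "poly_ring :: ('v, 'k) mpoly ring" by (rule poly_ring_cring)
  have neg: "- f \<in> I" if "f \<in> I" for f
    using R that by (metis mult_minus_left mult_1)
  show ?L
  proof (rule idealI)
    show "subgroup I (add_monoid poly_ring)"
      using R neg
      by (intro add.subgroupI) (auto simp: poly_ring_simps poly_ring_a_inv simp flip: a_inv_def)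
  qed (use R in \<open>auto simp: poly_ring_simps mult.commute ring_axioms\<close>)
qed

lemma ideal_diff_closed:
  fixes f :: "('v::finite, 'k::field) mpoly"
  assumes "ideal I poly_ring" "f \<in> I" "g \<in> I" shows "f - g \<in> I"
proof -
  have "f + (- 1) * g \<in> I" using assms ideal_poly_ring_iff[of I] by blast
  then show ?thesis by simp
qed

lemma ideal_sum_closed:
  fixes f :: "'a \<Rightarrow> ('v::finite, 'k::field) mpoly"
  assumes I: "ideal I poly_ring" and f: "\<And>x. x \<in> A \<Longrightarrow> f x \<in> I"
  shows "sum f A \<in> I"
  using f
proof (induction A rule: infinite_finite_induct)
  case (insert x F)
  then show ?case using I by (simp add: ideal_poly_ring_iff)
qed (use I in \<open>simp_all add: ideal_poly_ring_iff\<close>)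

lemma primeideal_poly_ring_iff:
  "primeideal I (poly_ring :: ('v::finite, 'k::field) mpoly ring) \<longleftrightarrow>
     ideal I poly_ring \<and> 1 \<notin> I \<and> (\<forall>f g. f * g \<in> I \<longrightarrow> f \<in> I \<or> g \<in> I)"
  (is "?L \<longleftrightarrow> ?R")
proof
  assume ?L
  then interpret primeideal I "poly_ring :: ('v, 'k) mpoly ring" .
  have "1 \<notin> I" using one_imp_carrier I_notcarr by (auto simp: poly_ring_simps)
  then show ?R using I_prime is_ideal by (auto simp: poly_ring_simps)
next
  assume R: ?R
  show ?L
    by (rule primeidealI) (use R in \<open>auto simp: poly_ring_simps poly_ring_cring\<close>)
qed

lemma poly_mapping_sum_single:
  fixes f :: "'a \<Rightarrow>\<^sub>0 'b::comm_monoid_add"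
  shows "f = (\<Sum>m\<in>Poly_Mapping.keys f. Poly_Mapping.single m (Poly_Mapping.lookup f m))"
proof (rule poly_mapping_eqI)
  fix k
  show "Poly_Mapping.lookup f k =
    Poly_Mapping.lookup (\<Sum>m\<in>Poly_Mapping.keys f. Poly_Mapping.single m (Poly_Mapping.lookup f m)) k"
    by (simp add: lookup_sum lookup_single when_def in_keys_iff)
qed

text \<open>The cover ideal is a monomial ideal, that is, of the form \<open>supported_on S\<close> for a set \<open>S\<close> of exponent
vectors that is closed under adding arbitrary vectors. Membership is then a condition on the
individual monomials of a polynomial.\<close>

definition supported_on :: "('v \<Rightarrow>\<^sub>0 nat) set \<Rightarrow> ('v, 'k::field) mpoly set" where
  "supported_on S = {f. Poly_Mapping.keys f \<subseteq> S}"

lemma supported_on_0 [simp]: "0 \<in> supported_on S"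
  by (simp add: supported_on_def)

lemma supported_on_add: "f \<in> supported_on S \<Longrightarrow> g \<in> supported_on S \<Longrightarrow> f + g \<in> supported_on S"
  using keys_add[of f g] by (auto simp: supported_on_def)

lemma supported_on_diff: "f \<in> supported_on S \<Longrightarrow> g \<in> supported_on S \<Longrightarrow> f - g \<in> supported_on S"
  using keys_diff[of f g] unfolding supported_on_def by blast

lemma supported_on_sum: "(\<And>x. x \<in> A \<Longrightarrow> f x \<in> supported_on S) \<Longrightarrow> sum f A \<in> supported_on S"
  by (induction A rule: infinite_finite_induct) (auto intro: supported_on_add)

lemma supported_on_mult:
  assumes "f \<in> supported_on S" "g \<in> supported_on T" "\<And>s t. s \<in> S \<Longrightarrow> t \<in> T \<Longrightarrow> s + t \<in> U"
  shows "f * g \<in> supported_on U"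
  using keys_mult[of f g] assms unfolding supported_on_def by blast

lemma supported_on_ideal:
  assumes "\<And>m b. m \<in> S \<Longrightarrow> m + b \<in> S"
  shows "ideal (supported_on S :: ('v::finite, 'k::field) mpoly set) poly_ring"
proof -
  have "g * f \<in> supported_on S" if "f \<in> supported_on S" for f g :: "('v, 'k) mpoly"
    using supported_on_mult[of f S g UNIV S] that assms
    by (auto simp: supported_on_def mult.commute)
  then show ?thesis by (auto simp: ideal_poly_ring_iff supported_on_add)
qed

lemma single_in_supported_on_iff [simp]:
  "Poly_Mapping.single m c \<in> supported_on S \<longleftrightarrow> c = 0 \<or> m \<in> S"
  by (auto simp: supported_on_def)

text \<open>The right-hand side is an ideal containing the generators; conversely each term of one of its
elements is a multiple of a generator.\<close>

lemma genideal_monomials: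
  "Idl\<^bsub>poly_ring\<^esub> ((\<lambda>m. Poly_Mapping.single m 1) ` A) =
     (supported_on {a + b | a b. a \<in> A} :: ('v::finite, 'k::field) mpoly set)"
  (is "Idl\<^bsub>_\<^esub> ?G = ?S")
proof
  interpret cring "poly_ring :: ('v, 'k) mpoly ring" by (rule poly_ring_cring)
  have "ideal ?S poly_ring"
    by (rule supported_on_ideal) (auto, metis add.assoc)
  moreover have "?G \<subseteq> ?S"
  proof
    fix x assume "x \<in> ?G"
    then obtain m where m: "m \<in> A" "x = Poly_Mapping.single m 1" by blast
    then have "m + 0 \<in> {a + b | a b. a \<in> A}" by blast
    then show "x \<in> ?S" using m by simp
  qed
  ultimately show "Idl\<^bsub>poly_ring\<^esub> ?G \<subseteq> ?S" by (rule genideal_minimal)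
  have I: "ideal (Idl\<^bsub>poly_ring\<^esub> ?G) poly_ring"
    by (rule genideal_ideal) (simp add: poly_ring_simps)
  show "?S \<subseteq> Idl\<^bsub>poly_ring\<^esub> ?G"
  proof
    fix f assume f: "f \<in> ?S"
    have "Poly_Mapping.single m c \<in> Idl\<^bsub>poly_ring\<^esub> ?G"
      if upper: "m \<in> {a + b | a b. a \<in> A}" for m and c :: 'k
    proof -
      obtain a b where m: "m = a + b" "a \<in> A" using upper by blast
      have "Poly_Mapping.single a 1 \<in> Idl\<^bsub>poly_ring\<^esub> ?G"
        using genideal_self[of ?G] m by (auto simp: poly_ring_simps)
      then have "Poly_Mapping.single b c * Poly_Mapping.single a 1 \<in> Idl\<^bsub>poly_ring\<^esub> ?G"
        using I unfolding ideal_poly_ring_iff by blast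
      then show ?thesis by (simp add: mult_single m add.commute)
    qed
    then show "f \<in> Idl\<^bsub>poly_ring\<^esub> ?G"
      using f by (subst poly_mapping_sum_single) (intro ideal_sum_closed[OF I], auto simp: supported_on_def)
  qed
qed

text \<open>The constant term is multiplicative because the exponent \<open>0\<close> is a sum of two exponents only as
\<open>0 + 0\<close>. This ring homomorphism to the field replaces tensoring a resolution with \<open>'k\<close>.\<close>

lemma lookup_mult_0:
  fixes f g :: "('v::finite, 'k::field) mpoly"
  shows "Poly_Mapping.lookup (f * g) 0 = Poly_Mapping.lookup f 0 * Poly_Mapping.lookup g 0"
proof -
  have eq: "0 = k + q \<longleftrightarrow> k = 0 \<and> q = 0" for k q :: "'v \<Rightarrow>\<^sub>0 nat"
    by (auto simp: poly_mapping_eq_iff lookup_add fun_eq_iff)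
  have "Poly_Mapping.lookup (f * g) 0 =
    (\<Sum>k. Poly_Mapping.lookup f k * (\<Sum>q. Poly_Mapping.lookup g q when 0 = k + q))"
    by (simp add: lookup_mult)
  also have "(\<lambda>k. Poly_Mapping.lookup f k * (\<Sum>q. Poly_Mapping.lookup g q when 0 = k + q)) =
     (\<lambda>k. Poly_Mapping.lookup f k * Poly_Mapping.lookup g 0 when k = 0)"
  proof
    fix k
    show "Poly_Mapping.lookup f k * (\<Sum>q. Poly_Mapping.lookup g q when 0 = k + q) =
      (Poly_Mapping.lookup f k * Poly_Mapping.lookup g 0 when k = 0)"
      by (cases "k = 0") (simp_all add: eq)
  qed
  finally show ?thesis by simp
qed

lemma irrelevant_ideal_eq:
  "(irrelevant_ideal :: ('v::finite, 'k::field) mpoly set) = {f. Poly_Mapping.lookup f 0 = 0}"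
proof -
  have r: "range (Var :: 'v \<Rightarrow> ('v, 'k) mpoly) =
      (\<lambda>m. Poly_Mapping.single m 1) ` range (\<lambda>v. Poly_Mapping.single v 1)"
    by (auto simp: Var_def)
  have "{a + b | a b. a \<in> range (\<lambda>v. Poly_Mapping.single v 1)} = {m :: 'v \<Rightarrow>\<^sub>0 nat. m \<noteq> 0}" (is "?A = ?B")
  proof
    show "?A \<subseteq> ?B" by (auto simp: poly_mapping_eq_iff lookup_add lookup_single fun_eq_iff when_def)
    show "?B \<subseteq> ?A"
    proof
      fix m :: "'v \<Rightarrow>\<^sub>0 nat" assume "m \<in> ?B"
      then obtain v where v: "Poly_Mapping.lookup m v \<noteq> 0"
        by (auto simp: poly_mapping_eq_iff fun_eq_iff)
      have "m = Poly_Mapping.single v 1 + (m - Poly_Mapping.single v 1)"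
        using v by (auto simp: poly_mapping_eq_iff lookup_add lookup_minus lookup_single fun_eq_iff when_def)
      then show "m \<in> ?A" by blast
    qed
  qed
  then show ?thesis
    by (simp only: irrelevant_ideal_def r genideal_monomials)
      (auto simp: supported_on_def in_keys_iff subset_iff)
qed

section \<open>The Hilbert series of a monomial quotient\<close>

lemma quotient_coset_eq_iff:
  fixes f g :: "('v::finite, 'k::field) mpoly"
  assumes "ideal J poly_ring"
  shows "J +>\<^bsub>poly_ring\<^esub> f = J +>\<^bsub>poly_ring\<^esub> g \<longleftrightarrow> f - g \<in> J"
proof -
  interpret cring "poly_ring :: ('v, 'k) mpoly ring" by (rule poly_ring_cring)
  show ?thesis
    using quotient_eq_iff_same_a_r_cos[OF assms, of f g]
    by (simp add: poly_ring_simps a_minus_def poly_ring_a_inv)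
qed

lemma quotient_zero: "\<zero>\<^bsub>poly_ring Quot J\<^esub> = J"
  by (simp add: FactRing_def)

lemma quotient_coset_0:
  fixes J :: "('v::finite, 'k::field) mpoly set"
  assumes "ideal J poly_ring" shows "J +>\<^bsub>poly_ring\<^esub> 0 = J"
  using ring_hom_zero[OF ideal.rcos_ring_hom[OF assms]] ideal.quotient_is_ring[OF assms]
    poly_ring_cring[where 'v = 'v and 'k = 'k]
  by (simp add: poly_ring_simps quotient_zero cring.axioms(1))

text \<open>The field structure survives in the quotient since the composite of \<open>Const\<close> with the projection
is a homomorphism from a field to a nonzero ring.\<close>

lemma coefficient_subfield:
  fixes J :: "('v::finite, 'k::field) mpoly set"
  assumes J: "ideal J poly_ring" and proper: "1 \<notin> J"
  shows "subfield ((\<lambda>f. J +>\<^bsub>poly_ring\<^esub> f) ` range Const) (poly_ring Quot J)"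
proof -
  define q where "q = (\<lambda>f. J +>\<^bsub>poly_ring\<^esub> f)"
  have "(Const :: 'k \<Rightarrow> ('v, 'k) mpoly) \<in> Ring.ring_hom ring_of_type_algebra poly_ring"
    by (rule ring_hom_memI)
      (simp_all add: ring_of_type_algebra_def Const_def mult_single single_add)
  then have "q \<circ> Const \<in> Ring.ring_hom ring_of_type_algebra (poly_ring Quot J)"
    using ring_hom_trans ideal.rcos_ring_hom[OF J] unfolding q_def by blast
  moreover have K: "field (ring_of_type_algebra :: 'k ring)"
    by (rule field_from_type_algebra)
  ultimately have hom: "ring_hom_ring (ring_of_type_algebra :: 'k ring) (poly_ring Quot J) (q \<circ> Const)"
    using ideal.quotient_is_ring[OF J]
    by (auto intro: ring_hom_ringI2 simp: field_def domain_def cring_def)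
  have ne: "\<one>\<^bsub>poly_ring Quot J\<^esub> \<noteq> \<zero>\<^bsub>poly_ring Quot J\<^esub>"
  proof -
    have "J +>\<^bsub>poly_ring\<^esub> 1 \<noteq> J +>\<^bsub>poly_ring\<^esub> 0"
      using quotient_coset_eq_iff[OF J, of 1 0] proper by simp
    then show ?thesis by (simp add: quotient_coset_0[OF J] FactRing_def poly_ring_simps)
  qed
  have "subfield ((q \<circ> Const) ` carrier (ring_of_type_algebra :: 'k ring)) (poly_ring Quot J)"
    by (rule ring_hom_ring.img_is_subfield(2)[OF hom field.carrier_is_subfield[OF K] ne])
  then show ?thesis by (simp add: q_def image_comp ring_of_type_algebra_def)
qed

text \<open>The monomials outside a monomial ideal stay linearly independent modulo the ideal: a combination
that lies in the ideal has all its monomials in \<open>S\<close>. They are added to the span one at a time.\<close>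

lemma dimension_of_standard_monomials:
  fixes S T :: "('v::finite \<Rightarrow>\<^sub>0 nat) set"
  defines "J \<equiv> (supported_on S :: ('v, 'k::field) mpoly set)"
  assumes J: "ideal J poly_ring" and T: "finite T" "T \<inter> S = {}"
  shows "ring.dimension (poly_ring Quot J) (card T)
    ((\<lambda>f. J +>\<^bsub>poly_ring\<^esub> f) ` range Const)
    ((\<lambda>f. J +>\<^bsub>poly_ring\<^esub> f) ` supported_on T)"
proof -
  define q where "q = (\<lambda>f. J +>\<^bsub>poly_ring\<^esub> f)"
  interpret Q: ring "poly_ring Quot J" by (rule ideal.quotient_is_ring[OF J])
  have hom: "q \<in> Ring.ring_hom poly_ring (poly_ring Quot J)"
    unfolding q_def by (rule ideal.rcos_ring_hom[OF J])
  have q_carrier: "q f \<in> carrier (poly_ring Quot J)" for f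
    using ring_hom_closed[OF hom] by (simp add: poly_ring_simps)
  have q_lin: "q f \<otimes>\<^bsub>poly_ring Quot J\<^esub> q g \<oplus>\<^bsub>poly_ring Quot J\<^esub> q h = q (f * g + h)" for f g h
    using ring_hom_mult[OF hom, of f g] ring_hom_add[OF hom, of "f * g" h]
    by (simp add: poly_ring_simps)
  show ?thesis
    using T unfolding q_def[symmetric]
  proof (induction T rule: finite_induct)
    case empty
    have "supported_on {} = {0 :: ('v, 'k) mpoly}" by (auto simp: supported_on_def)
    moreover have "q 0 = \<zero>\<^bsub>poly_ring Quot J\<^esub>"
      unfolding q_def by (simp add: quotient_coset_0[OF J] quotient_zero)
    ultimately show ?case by simp
  next
    case (insert m T)
    let ?X = "Poly_Mapping.single m (1 :: 'k)"
    have ext: "Q.line_extension (q ` range Const) (q ?X) (q ` supported_on T) =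
        q ` supported_on (insert m T)"
    proof
      show "Q.line_extension (q ` range Const) (q ?X) (q ` supported_on T) \<subseteq>
        q ` supported_on (insert m T)"
      proof
        fix u assume "u \<in> Q.line_extension (q ` range Const) (q ?X) (q ` supported_on T)"
        then obtain c f where f: "f \<in> supported_on T" and u: "u = q (Const c * ?X + f)"
          by (auto simp: Q.line_extension_mem_iff q_lin)
        have "Const c * ?X + f \<in> supported_on (insert m T)"
          using f by (intro supported_on_add) (auto simp: Const_def mult_single supported_on_def)
        then show "u \<in> q ` supported_on (insert m T)" using u by blast
      qed
      show "q ` supported_on (insert m T) \<subseteq>
        Q.line_extension (q ` range Const) (q ?X) (q ` supported_on T)"
      proof
        fix u assume "u \<in> q ` supported_on (insert m T)"
        then obtain f where f: "f \<in> supported_on (insert m T)" and u: "u = q f" by blast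
        define c where "c = Poly_Mapping.lookup f m"
        have "Poly_Mapping.lookup (f - Const c * ?X) m = 0"
          by (simp add: Const_def mult_single lookup_minus c_def)
        moreover have "f - Const c * ?X \<in> supported_on (insert m T)"
          using f by (intro supported_on_diff) (auto simp: Const_def mult_single)
        ultimately have "f - Const c * ?X \<in> supported_on T"
          unfolding supported_on_def in_keys_iff subset_iff mem_Collect_eq by (metis insertE)
        moreover have "u = q (Const c * ?X + (f - Const c * ?X))" using u by simp
        ultimately show "u \<in> Q.line_extension (q ` range Const) (q ?X) (q ` supported_on T)"
          unfolding Q.line_extension_mem_iff q_lin[symmetric] by blast
      qed
    qed
    have new: "q ?X \<notin> q ` supported_on T"
    proof
      assume "q ?X \<in> q ` supported_on T"
      then obtain f where f: "f \<in> supported_on T" "?X - f \<in> J"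
        unfolding q_def by (auto simp: quotient_coset_eq_iff[OF J])
      have "m \<notin> Poly_Mapping.keys f" using f(1) insert.hyps by (auto simp: supported_on_def)
      then have "m \<in> Poly_Mapping.keys (?X - f)" by (simp add: in_keys_iff lookup_minus)
      then have "m \<in> S" using f(2) by (auto simp: J_def supported_on_def)
      then show False using insert.prems by blast
    qed
    have "Q.dimension (Suc (card T)) (q ` range Const)
        (Q.line_extension (q ` range Const) (q ?X) (q ` supported_on T))"
      using insert by (intro Q.Suc_dim q_carrier new) auto
    then show ?case using ext insert.hyps by simp
  qed
qed

lemma keys_diff_nat: "Poly_Mapping.keys (m - n) \<subseteq> Poly_Mapping.keys (m :: 'a \<Rightarrow>\<^sub>0 nat)"
  by (auto simp: in_keys_iff lookup_minus)

lemma total_degree_0 [simp]: "total_degree 0 = 0"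
  by (simp add: total_degree_def)

lemma total_degree_add: "total_degree (a + b) = total_degree a + total_degree b"
  by (simp add: total_degree_def lookup_add sum.distrib)

lemma lookup_le_total_degree: "Poly_Mapping.lookup m v \<le> total_degree m"
  unfolding total_degree_def by (rule member_le_sum) auto

lemma finite_total_degree: "finite {m :: 'v::finite \<Rightarrow>\<^sub>0 nat. total_degree m = d}"
proof (rule finite_imageD)
  show "inj_on Poly_Mapping.lookup {m :: 'v \<Rightarrow>\<^sub>0 nat. total_degree m = d}"
    by (simp add: inj_on_def lookup_inject)
  have "Poly_Mapping.lookup ` {m :: 'v \<Rightarrow>\<^sub>0 nat. total_degree m = d} \<subseteq> (\<Pi>\<^sub>E v\<in>UNIV. {..d})"
    using lookup_le_total_degree by (auto simp: PiE_def extensional_def)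
  then show "finite (Poly_Mapping.lookup ` {m :: 'v \<Rightarrow>\<^sub>0 nat. total_degree m = d})"
    by (rule finite_subset) (simp add: finite_PiE)
qed

definition monomial_series :: "('v::finite \<Rightarrow>\<^sub>0 nat) set \<Rightarrow> int fps" where
  "monomial_series S = Abs_fps (\<lambda>d. int (card {m \<in> S. total_degree m = d}))"

text \<open>Modulo the ideal a homogeneous polynomial may be replaced by its part supported outside \<open>S\<close>, so the
monomials of degree \<open>d\<close> outside \<open>S\<close> form a basis of the component of degree \<open>d\<close>.\<close>

lemma hilbert_series_supported_on:
  fixes S :: "('v::finite \<Rightarrow>\<^sub>0 nat) set"
  defines "J \<equiv> (supported_on S :: ('v, 'k::field) mpoly set)"
  assumes J: "ideal J poly_ring" and proper: "0 \<notin> S"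
  shows "hilbert_series J = monomial_series (- S)"
proof -
  define q where "q = (\<lambda>f. J +>\<^bsub>poly_ring\<^esub> f)"
  have "1 \<notin> J" using proper by (simp add: J_def flip: single_one)
  then have K: "subfield (q ` range Const) (poly_ring Quot J)"
    unfolding q_def by (rule coefficient_subfield[OF J])
  interpret Q: ring "poly_ring Quot J" by (rule ideal.quotient_is_ring[OF J])
  have "ring.dim (poly_ring Quot J) (q ` range Const) (q ` graded_part (int d)) =
      card {m \<in> - S. total_degree m = d}" for d
  proof -
    let ?T = "{m \<in> - S. total_degree m = d}"
    have "q ` graded_part (int d) = q ` supported_on ?T"
    proof
      show "q ` supported_on ?T \<subseteq> q ` graded_part (int d)"
        by (rule image_mono) (auto simp: graded_part_def supported_on_def)
      show "q ` graded_part (int d) \<subseteq> q ` supported_on ?T"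
      proof
        fix u assume "u \<in> q ` graded_part (int d)"
        then obtain f where f: "f \<in> graded_part (int d)" "u = q f" by blast
        define g where "g = (\<Sum>m\<in>Poly_Mapping.keys f \<inter> S. Poly_Mapping.single m (Poly_Mapping.lookup f m))"
        have lookup_g: "Poly_Mapping.lookup g m = (if m \<in> S then Poly_Mapping.lookup f m else 0)" for m
          by (auto simp: g_def lookup_sum lookup_single when_def sum.delta in_keys_iff)
        have "g \<in> J" unfolding J_def supported_on_def by (auto simp: in_keys_iff lookup_g split: if_splits)
        then have "q f = q (f - g)"
          unfolding q_def by (simp add: quotient_coset_eq_iff[OF J])
        moreover have "f - g \<in> supported_on ?T"
          using f(1) by (auto simp: supported_on_def graded_part_def in_keys_iff lookup_minus lookup_g split: if_splits)
        ultimately show "u \<in> q ` supported_on ?T" using f(2) by blast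
      qed
    qed
    moreover have "Q.dimension (card ?T) (q ` range Const) (q ` supported_on ?T)"
      unfolding q_def J_def
      by (rule dimension_of_standard_monomials)
        (use J in \<open>auto simp: J_def intro: finite_subset[OF _ finite_total_degree[of d]]\<close>)
    ultimately show ?thesis using Q.dimI[OF K] by (simp add: over_def)
  qed
  then show ?thesis by (simp add: hilbert_series_def monomial_series_def q_def)
qed

lemma monomial_series_shift:
  "monomial_series ((+) a ` S) = fps_X ^ total_degree a * monomial_series S"
proof (rule fps_ext)
  fix d
  show "fps_nth (monomial_series ((+) a ` S)) d =
      fps_nth (fps_X ^ total_degree a * monomial_series S) d"
  proof (cases "total_degree a \<le> d")
    case True
    then have "{m \<in> (+) a ` S. total_degree m = d} =
        (+) a ` {m \<in> S. total_degree m = d - total_degree a}"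
      by (auto simp: total_degree_add)
    with True show ?thesis
      by (simp add: monomial_series_def fps_X_power_mult_nth card_image)
  next
    case False
    then have none: "{m \<in> (+) a ` S. total_degree m = d} = {}"
      by (auto simp: total_degree_add)
    from False show ?thesis
      unfolding monomial_series_def fps_nth_Abs_fps none by (simp add: fps_X_power_mult_nth)
  qed
qed

lemma monomial_series_disjoint_union:
  assumes "S \<inter> T = {}"
  shows "monomial_series (S \<union> T) = monomial_series S + monomial_series T"
proof (rule fps_ext)
  fix d
  have "{m \<in> S \<union> T. total_degree m = d} =
      {m \<in> S. total_degree m = d} \<union> {m \<in> T. total_degree m = d}" by blast
  moreover have "finite {m \<in> U. total_degree m = d}" for U :: "('a \<Rightarrow>\<^sub>0 nat) set"
    by (rule finite_subset[OF _ finite_total_degree[of d]]) auto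
  ultimately show "fps_nth (monomial_series (S \<union> T)) d = fps_nth (monomial_series S + monomial_series T) d"
    using assms by (simp add: monomial_series_def card_Un_disjoint disjoint_iff)
qed

text \<open>The series of all monomials in the variables outside \<open>B\<close>. A monomial in the variables \<open>insert v A\<close>
either avoids \<open>v\<close> or is \<open>v\<close> times another such monomial; hence allowing one more variable divides
the series by \<open>1 - t\<close>.\<close>

lemma monomial_series_avoiding:
  fixes B :: "'v::finite set"
  shows "monomial_series {m. Poly_Mapping.keys m \<inter> B = {}} * (1 - fps_X) ^ card (- B) = 1"
proof -
  have "monomial_series {m. Poly_Mapping.keys m \<inter> - A = {}} * (1 - fps_X) ^ card A = 1"
    for A :: "'v set"
  proof (induction A rule: finite_induct[OF finite])
    case 1
    have "{m. Poly_Mapping.keys m \<inter> - {} = {}} = {0 :: 'v \<Rightarrow>\<^sub>0 nat}"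
      by (auto simp: poly_mapping_eq_iff fun_eq_iff in_keys_iff)
    moreover have "monomial_series {0 :: 'v \<Rightarrow>\<^sub>0 nat} = 1"
      by (rule fps_ext) (auto simp: monomial_series_def Collect_conv_if)
    ultimately show ?case by simp
  next
    case (2 v A)
    let ?S = "{m :: 'v \<Rightarrow>\<^sub>0 nat. Poly_Mapping.keys m \<inter> - insert v A = {}}"
    let ?x = "Poly_Mapping.single v (1::nat)"
    have "m \<in> (+) ?x ` ?S" if "m \<in> ?S" "v \<in> Poly_Mapping.keys m" for m
    proof
      show "m = ?x + (m - ?x)"
        using that by (auto simp: poly_mapping_eq_iff lookup_add lookup_minus lookup_single
            fun_eq_iff when_def in_keys_iff)
      show "m - ?x \<in> ?S" using that keys_diff_nat[of m ?x] by blast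
    qed
    moreover have "v \<in> Poly_Mapping.keys (?x + m)" "?x + m \<in> ?S" if "m \<in> ?S" for m
      using that by (auto simp: in_keys_iff lookup_add lookup_single when_def)
    ultimately have "?S = {m. Poly_Mapping.keys m \<inter> - A = {}} \<union> (+) ?x ` ?S"
      and "{m. Poly_Mapping.keys m \<inter> - A = {}} \<inter> (+) ?x ` ?S = {}"
      using 2(2) by blast+
    then have "monomial_series ?S = monomial_series {m. Poly_Mapping.keys m \<inter> - A = {}}
        + monomial_series ((+) ?x ` ?S)"
      by (metis monomial_series_disjoint_union)
    also have "monomial_series ((+) ?x ` ?S) = fps_X * monomial_series ?S"
      by (simp add: monomial_series_shift total_degree_def lookup_single when_def)
    finally have "monomial_series ?S * (1 - fps_X) = monomial_series {m. Poly_Mapping.keys m \<inter> - A = {}}"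
      by (simp add: algebra_simps)
    then show ?case using 2 by (simp add: mult.assoc[symmetric])
  qed
  from this[of "- B"] show ?thesis by simp
qed

section \<open>Linear dependence and graded matrices\<close>

text \<open>More vectors than coordinates are linearly dependent. The vectors are indexed by \<open>A\<close>, the
coordinates by \<open>B\<close>; one elimination step removes a coordinate together with a pivot vector. The
lemma is used both to compare ranks of resolutions and to bound the length of chains of primes.\<close>

lemma linear_dependence:
  fixes t :: "'a \<Rightarrow> 'b \<Rightarrow> 'k::field"
  assumes "finite A" "finite B" "card B < card A"
  shows "\<exists>c. (\<exists>a\<in>A. c a \<noteq> 0) \<and> (\<forall>b\<in>B. (\<Sum>a\<in>A. c a * t a b) = 0)"
  using assms(2,1,3)
proof (induction B arbitrary: A t rule: finite_induct)
  case empty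
  then have "\<exists>a. a \<in> A" by (metis card.empty less_irrefl ex_in_conv)
  then show ?case by (intro exI[of _ "\<lambda>_. 1"]) auto
next
  case (insert b B)
  show ?case
  proof (cases "\<forall>a\<in>A. t a b = 0")
    case True
    have "\<exists>c. (\<exists>a\<in>A. c a \<noteq> 0) \<and> (\<forall>b\<in>B. (\<Sum>a\<in>A. c a * t a b) = 0)"
      using insert by simp
    then show ?thesis using True by auto
  next
    case False
    then obtain p where p: "p \<in> A" "t p b \<noteq> 0" by blast
    define s where "s = (\<lambda>a d. t a d - t a b / t p b * t p d)"
    have "card B < card (A - {p})" using insert p by simp
    then have "\<exists>c. (\<exists>a\<in>A - {p}. c a \<noteq> 0) \<and> (\<forall>d\<in>B. (\<Sum>a\<in>A - {p}. c a * s a d) = 0)"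
      using insert.IH[of "A - {p}" s] insert.prems by simp
    then obtain c where c: "\<exists>a\<in>A - {p}. c a \<noteq> 0" "\<And>d. d \<in> B \<Longrightarrow> (\<Sum>a\<in>A - {p}. c a * s a d) = 0"
      by blast
    \<comment> \<open>the pivot coefficient makes the eliminated coordinate \<open>b\<close> of the combination vanish\<close>
    define e where "e = c(p := - (\<Sum>a\<in>A - {p}. c a * t a b) / t p b)"
    have "(\<Sum>a\<in>A. e a * t a d) = (\<Sum>a\<in>A - {p}. c a * s a d)" for d
    proof -
      have "(\<Sum>a\<in>A. e a * t a d) = e p * t p d + (\<Sum>a\<in>A - {p}. c a * t a d)"
        using p insert.prems by (subst sum.remove[of _ p]) (auto simp: e_def)
      also have "e p * t p d = - (\<Sum>a\<in>A - {p}. c a * (t a b / t p b * t p d))"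
        by (simp add: e_def sum_divide_distrib sum_distrib_right mult.assoc)
      finally show ?thesis by (simp add: s_def right_diff_distrib sum_subtractf)
    qed
    moreover have "s a b = 0" for a using p by (simp add: s_def)
    ultimately have "\<forall>d\<in>insert b B. (\<Sum>a\<in>A. e a * t a d) = 0" using c(2) by auto
    moreover have "\<exists>a\<in>A. e a \<noteq> 0" using c(1) by (auto simp: e_def)
    ultimately show ?thesis by blast
  qed
qed

definition homogeneous_component :: "int \<Rightarrow> ('v::finite, 'k::field) mpoly \<Rightarrow> ('v, 'k) mpoly" where
  "homogeneous_component d f = Poly_Mapping.mapp (\<lambda>m c. c when int (total_degree m) = d) f"

lemma lookup_homogeneous_component:
  "Poly_Mapping.lookup (homogeneous_component d f) m =
     (Poly_Mapping.lookup f m when int (total_degree m) = d)"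
  by (simp add: homogeneous_component_def lookup_mapp when_def in_keys_iff)

lemma graded_part_eq: "graded_part d = supported_on {m. int (total_degree m) = d}"
  by (auto simp: graded_part_def supported_on_def)

lemma homogeneous_component_in: "homogeneous_component d f \<in> graded_part d"
  by (auto simp: graded_part_def in_keys_iff lookup_homogeneous_component when_def split: if_splits)

lemma homogeneous_component_graded:
  assumes "f \<in> graded_part d" shows "homogeneous_component d f = f"
proof (rule poly_mapping_eqI)
  fix m
  show "Poly_Mapping.lookup (homogeneous_component d f) m = Poly_Mapping.lookup f m"
    using assms by (auto simp: graded_part_def lookup_homogeneous_component when_def in_keys_iff)
qed

lemma homogeneous_component_add:
  "homogeneous_component d (f + g) = homogeneous_component d f + homogeneous_component d g"
  by (rule poly_mapping_eqI) (simp add: lookup_homogeneous_component lookup_add when_def)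

lemma homogeneous_component_diff:
  "homogeneous_component d (f - g) = homogeneous_component d f - homogeneous_component d g"
  by (rule poly_mapping_eqI) (simp add: lookup_homogeneous_component lookup_minus when_def)

lemma homogeneous_component_0 [simp]: "homogeneous_component d 0 = 0"
  by (rule poly_mapping_eqI) (simp add: lookup_homogeneous_component)

lemma homogeneous_component_sum:
  "homogeneous_component d (sum f A) = (\<Sum>x\<in>A. homogeneous_component d (f x))"
  by (induction A rule: infinite_finite_induct) (simp_all add: homogeneous_component_add)

lemma graded_part_mult: "f \<in> graded_part d \<Longrightarrow> g \<in> graded_part e \<Longrightarrow> f * g \<in> graded_part (d + e)"
  unfolding graded_part_eq by (erule (1) supported_on_mult) (auto simp: total_degree_add)

lemma homogeneous_component_mult:
  assumes "f \<in> graded_part d"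
  shows "homogeneous_component (d + e) (f * g) = f * homogeneous_component e g"
proof -
  define r where "r = g - homogeneous_component e g"
  have r: "r \<in> supported_on {m. int (total_degree m) \<noteq> e}"
    by (auto simp: r_def supported_on_def in_keys_iff lookup_minus lookup_homogeneous_component)
  have "f * r \<in> supported_on {m. int (total_degree m) \<noteq> d + e}"
    by (rule supported_on_mult[OF assms[unfolded graded_part_eq] r]) (auto simp: total_degree_add)
  then have "homogeneous_component (d + e) (f * r) = 0"
    by (intro poly_mapping_eqI)
      (auto simp: supported_on_def in_keys_iff lookup_homogeneous_component when_def)
  moreover have "f * g = f * homogeneous_component e g + f * r"
    by (simp add: r_def right_diff_distrib)
  ultimately show ?thesis
    using graded_part_mult[OF assms homogeneous_component_in[of e g]]
    by (simp add: homogeneous_component_add homogeneous_component_graded)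
qed

text \<open>A homogeneous map of degree 0 from the sum of the \<open>R(-j)\<close>, \<open>j\<close> in \<open>b\<close>, to the sum of the \<open>R(-j)\<close>,
\<open>j\<close> in \<open>a\<close>.\<close>

definition graded_matrix :: "int list \<Rightarrow> int list \<Rightarrow> ('v::finite, 'k::field) mpoly mat \<Rightarrow> bool" where
  "graded_matrix a b M \<longleftrightarrow> M \<in> carrier_mat (length a) (length b) \<and>
     (\<forall>l<length a. \<forall>k<length b. M $$ (l, k) \<in> graded_part (b ! k - a ! l))"

lemma graded_matrix_mult:
  assumes M: "graded_matrix a b M" and N: "graded_matrix b c N"
  shows "graded_matrix a c (M * N)"
  unfolding graded_matrix_def
proof (intro conjI allI impI)
  show "M * N \<in> carrier_mat (length a) (length c)"
    using M N by (auto simp: graded_matrix_def)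
  fix l k assume lk: "l < length a" "k < length c"
  have "M $$ (l, s) * N $$ (s, k) \<in> graded_part (c ! k - a ! l)" if "s < length b" for s
  proof -
    have "M $$ (l, s) * N $$ (s, k) \<in> graded_part ((b ! s - a ! l) + (c ! k - b ! s))"
      by (rule graded_part_mult) (use M N lk that in \<open>auto simp: graded_matrix_def\<close>)
    then show ?thesis by simp
  qed
  then have "(\<Sum>s\<in>{0..<length b}. M $$ (l, s) * N $$ (s, k)) \<in> graded_part (c ! k - a ! l)"
    unfolding graded_part_eq by (intro supported_on_sum) auto
  moreover have "(M * N) $$ (l, k) = (\<Sum>s\<in>{0..<length b}. M $$ (l, s) * N $$ (s, k))"
    using M N lk by (auto simp: graded_matrix_def scalar_prod_def)
  ultimately show "(M * N) $$ (l, k) \<in> graded_part (c ! k - a ! l)" by simp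
qed

text \<open>If a graded matrix factors through \<open>M\<close> at all, it factors by a graded matrix: take the homogeneous
component of the right degree in each entry, which commutes with multiplication by the homogeneous
entries of \<open>M\<close>.\<close>

lemma graded_factor:
  assumes M: "graded_matrix a b M" and U: "graded_matrix a c U"
    and Y: "Y \<in> carrier_mat (length b) (length c)" and MY: "M * Y = U"
  shows "\<exists>Z. graded_matrix b c Z \<and> M * Z = U"
proof -
  define Z where "Z = mat (length b) (length c)
    (\<lambda>(s, k). homogeneous_component (c ! k - b ! s) (Y $$ (s, k)))"
  have Z: "graded_matrix b c Z"
    by (auto simp: graded_matrix_def Z_def homogeneous_component_in)
  have "M * Z = U"
  proof (rule eq_matI)
    show "dim_row (M * Z) = dim_row U" "dim_col (M * Z) = dim_col U"
      using M U by (auto simp: graded_matrix_def Z_def)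
    fix l k assume "l < dim_row U" "k < dim_col U"
    then have lk: "l < length a" "k < length c" using U by (auto simp: graded_matrix_def)
    have "(M * Z) $$ (l, k) = (\<Sum>s\<in>{0..<length b}. M $$ (l, s) * Z $$ (s, k))"
      using M lk by (auto simp: graded_matrix_def scalar_prod_def Z_def)
    also have "\<dots> = (\<Sum>s\<in>{0..<length b}. homogeneous_component (c ! k - a ! l) (M $$ (l, s) * Y $$ (s, k)))"
    proof (rule sum.cong)
      fix s assume s: "s \<in> {0..<length b}"
      have "M $$ (l, s) \<in> graded_part (b ! s - a ! l)"
        using M s lk by (auto simp: graded_matrix_def)
      from homogeneous_component_mult[OF this, of "c ! k - b ! s" "Y $$ (s, k)"]
      show "M $$ (l, s) * Z $$ (s, k) =
          homogeneous_component (c ! k - a ! l) (M $$ (l, s) * Y $$ (s, k))"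
        using s lk by (simp add: Z_def)
    qed simp
    also have "\<dots> = homogeneous_component (c ! k - a ! l) ((M * Y) $$ (l, k))"
      using M Y lk by (auto simp: graded_matrix_def scalar_prod_def homogeneous_component_sum)
    also have "\<dots> = U $$ (l, k)"
      using U lk by (simp add: MY graded_matrix_def homogeneous_component_graded)
    finally show "(M * Z) $$ (l, k) = U $$ (l, k)" .
  qed
  with Z show ?thesis by blast
qed

text \<open>Solving for the columns one by one: this turns the exactness statements, which speak of vectors,
into statements about matrices.\<close>

lemma matrix_factor_columns:
  assumes M: "M \<in> carrier_mat n p" and U: "U \<in> carrier_mat n q"
    and cols: "\<And>k. k < q \<Longrightarrow> col U k \<in> (*\<^sub>v) M ` carrier_vec p"
  shows "\<exists>Y\<in>carrier_mat p q. M * Y = U"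
proof -
  have "\<forall>k. \<exists>y. k < q \<longrightarrow> y \<in> carrier_vec p \<and> col U k = M *\<^sub>v y" using cols by blast
  then obtain y where y: "\<And>k. k < q \<Longrightarrow> y k \<in> carrier_vec p \<and> col U k = M *\<^sub>v y k" by metis
  define Y where "Y = mat p q (\<lambda>(s, k). y k $ s)"
  have Y: "Y \<in> carrier_mat p q" by (simp add: Y_def)
  have colY: "col Y k = y k" if "k < q" for k
    using that y[OF that] by (intro eq_vecI) (auto simp: Y_def)
  have "M * Y = U"
  proof (rule mat_col_eqI)
    fix k assume "k < dim_col U"
    then have k: "k < q" using U by simp
    have "col (M * Y) k = M *\<^sub>v col Y k" by (rule col_mult2[OF M Y k])
    then show "col (M * Y) k = col U k" using y[OF k] colY[OF k] by simp
  qed (use M U Y in auto)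
  with Y show ?thesis by blast
qed

lemma mult_unit_vec:
  fixes M :: "'r::comm_ring_1 mat"
  assumes "M \<in> carrier_mat n p" "k < p" shows "M *\<^sub>v unit_vec p k = col M k"
  using assms by (intro eq_vecI) auto

lemma col_in_image:
  fixes M :: "'r::comm_ring_1 mat"
  assumes "M \<in> carrier_mat n p" "k < p" shows "col M k \<in> (*\<^sub>v) M ` carrier_vec p"
  using mult_unit_vec[OF assms, symmetric] by (rule image_eqI) simp

section \<open>Lifting maps through a resolution\<close>

context
  fixes J :: "('v::finite, 'k::field) mpoly set" and \<epsilon> \<phi> a
  assumes res: "graded_free_resolution J \<epsilon> \<phi> a"
begin

lemma resolution_graded: "graded_matrix (a i) (a (Suc i)) (\<phi> i)"
  using res by (auto simp: graded_free_resolution_def graded_matrix_def)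

lemma resolution_carrier: "\<phi> i \<in> carrier_mat (length (a i)) (length (a (Suc i)))"
  using resolution_graded by (auto simp: graded_matrix_def)

lemma resolution_augmentation_carrier: "\<epsilon> \<in> carrier_vec (length (a 0))"
  using res by (simp add: graded_free_resolution_def)

lemma resolution_compose_0:
  "\<phi> i * \<phi> (Suc i) = 0\<^sub>m (length (a i)) (length (a (Suc (Suc i))))"
proof (rule mat_col_eqI)
  fix k assume "k < dim_col (0\<^sub>m (length (a i)) (length (a (Suc (Suc i)))) :: ('v, 'k) mpoly mat)"
  then have k: "k < length (a (Suc (Suc i)))" by simp
  have "col (\<phi> (Suc i)) k \<in> {v \<in> carrier_vec (length (a (Suc i))). \<phi> i *\<^sub>v v = 0\<^sub>v (length (a i))}"
    using res col_in_image[OF resolution_carrier k] unfolding graded_free_resolution_def by blast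
  then show "col (\<phi> i * \<phi> (Suc i)) k = col (0\<^sub>m (length (a i)) (length (a (Suc (Suc i))))) k"
    using col_mult2[OF resolution_carrier resolution_carrier k] k by simp
qed (use resolution_carrier in auto)

lemma resolution_augmentation_col:
  assumes "k < length (a (Suc 0))" shows "\<epsilon> \<bullet> col (\<phi> 0) k \<in> J"
  using res col_in_image[OF resolution_carrier assms] unfolding graded_free_resolution_def by auto

lemma resolution_lift_0:
  assumes U: "U \<in> carrier_mat (length (a 0)) q" and "\<And>k. k < q \<Longrightarrow> \<epsilon> \<bullet> col U k \<in> J"
  shows "\<exists>Y\<in>carrier_mat (length (a (Suc 0))) q. \<phi> 0 * Y = U"
proof (rule matrix_factor_columns[OF resolution_carrier U])
  fix k assume "k < q"
  then have "col U k \<in> {v \<in> carrier_vec (length (a 0)). \<epsilon> \<bullet> v \<in> J}" using assms by simp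
  then show "col U k \<in> (*\<^sub>v) (\<phi> 0) ` carrier_vec (length (a (Suc 0)))"
    using res unfolding graded_free_resolution_def by auto
qed

lemma resolution_augmentation_surjective: "\<exists>v\<in>carrier_vec (length (a 0)). f - \<epsilon> \<bullet> v \<in> J"
  using res unfolding graded_free_resolution_def by (elim conjE) (erule spec)

lemma resolution_augmentation_graded: "k < length (a 0) \<Longrightarrow> \<epsilon> $ k \<in> graded_part (a 0 ! k)"
  using res by (simp add: graded_free_resolution_def)

lemma resolution_lift_Suc:
  assumes U: "U \<in> carrier_mat (length (a (Suc i))) q" and 0: "\<phi> i * U = 0\<^sub>m (length (a i)) q"
  shows "\<exists>Y\<in>carrier_mat (length (a (Suc (Suc i)))) q. \<phi> (Suc i) * Y = U"
proof (rule matrix_factor_columns[OF resolution_carrier U])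
  fix k assume k: "k < q"
  have "\<phi> i *\<^sub>v col U k = 0\<^sub>v (length (a i))"
    using col_mult2[OF resolution_carrier U k] k by (simp add: 0)
  then have "col U k \<in> {v \<in> carrier_vec (length (a (Suc i))). \<phi> i *\<^sub>v v = 0\<^sub>v (length (a i))}"
    using U k by simp
  then show "col U k \<in> (*\<^sub>v) (\<phi> (Suc i)) ` carrier_vec (length (a (Suc (Suc i))))"
    using res unfolding graded_free_resolution_def by blast
qed

end

text \<open>The degree-zero part of a comparison map between two resolutions of the same quotient: the
generators of the first resolution are expressed through those of the second modulo \<open>J\<close>. That \<open>J\<close>
is homogeneous allows the coefficients to be chosen homogeneous.\<close>

lemma augmentation_lift:
  assumes res: "graded_free_resolution J \<epsilon> \<phi> a" and res': "graded_free_resolution J \<epsilon>' \<phi>' a'"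
    and J: "ideal J poly_ring" "\<And>d f. f \<in> J \<Longrightarrow> homogeneous_component d f \<in> J"
  shows "\<exists>\<alpha>. graded_matrix (a' 0) (a 0) \<alpha> \<and>
    (\<forall>w\<in>carrier_vec (length (a 0)). \<epsilon> \<bullet> w - \<epsilon>' \<bullet> (\<alpha> *\<^sub>v w) \<in> J)"
proof -
  note e = resolution_augmentation_carrier[OF res] and e' = resolution_augmentation_carrier[OF res']
  have "\<forall>k. \<exists>v. v \<in> carrier_vec (length (a' 0)) \<and> \<epsilon> $ k - \<epsilon>' \<bullet> v \<in> J"
    using resolution_augmentation_surjective[OF res'] by blast
  then obtain v where v: "\<And>k. v k \<in> carrier_vec (length (a' 0))" "\<And>k. \<epsilon> $ k - \<epsilon>' \<bullet> v k \<in> J"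
    by metis
  define \<alpha> where "\<alpha> = mat (length (a' 0)) (length (a 0))
    (\<lambda>(s, k). homogeneous_component (a 0 ! k - a' 0 ! s) (v k $ s))"
  have \<alpha>: "\<alpha> \<in> carrier_mat (length (a' 0)) (length (a 0))" by (simp add: \<alpha>_def)
  have graded: "graded_matrix (a' 0) (a 0) \<alpha>"
    by (auto simp: graded_matrix_def \<alpha>_def homogeneous_component_in)
  have col: "\<epsilon> $ k - \<epsilon>' \<bullet> col \<alpha> k \<in> J" if k: "k < length (a 0)" for k
  proof -
    have "\<epsilon>' \<bullet> col \<alpha> k = (\<Sum>s\<in>{0..<length (a' 0)}. \<epsilon>' $ s * homogeneous_component (a 0 ! k - a' 0 ! s) (v k $ s))"
      using k by (simp add: scalar_prod_def \<alpha>_def)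
    also have "\<dots> = (\<Sum>s\<in>{0..<length (a' 0)}. homogeneous_component (a 0 ! k) (\<epsilon>' $ s * v k $ s))"
    proof (rule sum.cong)
      fix s assume "s \<in> {0..<length (a' 0)}"
      then have "\<epsilon>' $ s \<in> graded_part (a' 0 ! s)"
        using resolution_augmentation_graded[OF res'] by simp
      from homogeneous_component_mult[OF this, of "a 0 ! k - a' 0 ! s" "v k $ s"]
      show "\<epsilon>' $ s * homogeneous_component (a 0 ! k - a' 0 ! s) (v k $ s) =
          homogeneous_component (a 0 ! k) (\<epsilon>' $ s * v k $ s)" by simp
    qed simp
    also have "\<dots> = homogeneous_component (a 0 ! k) (\<epsilon>' \<bullet> v k)"
      using v(1)[of k] by (simp add: scalar_prod_def homogeneous_component_sum)
    moreover have "\<epsilon> $ k \<in> graded_part (a 0 ! k)"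
      using resolution_augmentation_graded[OF res k] .
    ultimately have "\<epsilon> $ k - \<epsilon>' \<bullet> col \<alpha> k = homogeneous_component (a 0 ! k) (\<epsilon> $ k - \<epsilon>' \<bullet> v k)"
      by (simp add: homogeneous_component_diff homogeneous_component_graded)
    then show ?thesis using J(2) v(2) by simp
  qed
  have "\<epsilon> \<bullet> w - \<epsilon>' \<bullet> (\<alpha> *\<^sub>v w) \<in> J" if w: "w \<in> carrier_vec (length (a 0))" for w
  proof -
    have "\<epsilon>' \<bullet> (\<alpha> *\<^sub>v w) = (\<alpha>\<^sup>T *\<^sub>v \<epsilon>') \<bullet> w"
      using transpose_vec_mult_scalar[OF \<alpha> w e'] by simp
    also have "\<dots> = (\<Sum>k\<in>{0..<length (a 0)}. (\<epsilon>' \<bullet> col \<alpha> k) * w $ k)"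
      using \<alpha> w e' comm_scalar_prod[OF _ e'] by (simp add: scalar_prod_def[of _ w])
    finally have "\<epsilon> \<bullet> w - \<epsilon>' \<bullet> (\<alpha> *\<^sub>v w) =
        (\<Sum>k\<in>{0..<length (a 0)}. w $ k * (\<epsilon> $ k - \<epsilon>' \<bullet> col \<alpha> k))"
      using w by (simp add: scalar_prod_def[of _ w] right_diff_distrib sum_subtractf mult.commute)
    also have "\<dots> \<in> J"
      using col J(1) by (intro ideal_sum_closed[OF J(1)]) (simp add: ideal_poly_ring_iff)
    finally show ?thesis .
  qed
  with graded show ?thesis by blast
qed

section \<open>Uniqueness of Betti numbers\<close>

text \<open>The state in homological degree \<open>i\<close> of the comparison of two resolutions. The maps \<open>\<alpha>\<close> and \<open>\<beta>\<close>
between the free modules lift the identity in both directions; \<open>U\<close> and \<open>V\<close> witness that they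
extend to degree \<open>i + 1\<close>. The composite \<open>\<beta> * \<alpha>\<close> is homotopic to the identity: \<open>h\<close> is the new
homotopy, and \<open>E\<close> is the differential out of the module followed by the previous homotopy, so it
kills \<open>\<phi> i\<close> and has no constant terms. The grading of \<open>\<alpha>\<close> is what later
separates the basis elements by degree.\<close>

definition comparison_at where
  "comparison_at \<phi> a \<phi>' a' i \<longleftrightarrow> (\<exists>\<alpha> \<beta> U V h E.
     graded_matrix (a' i) (a i) \<alpha> \<and> \<beta> \<in> carrier_mat (length (a i)) (length (a' i)) \<and>
     U \<in> carrier_mat (length (a' (Suc i))) (length (a (Suc i))) \<and> \<alpha> * \<phi> i = \<phi>' i * U \<and>
     V \<in> carrier_mat (length (a (Suc i))) (length (a' (Suc i))) \<and> \<beta> * \<phi>' i = \<phi> i * V \<and>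
     h \<in> carrier_mat (length (a (Suc i))) (length (a i)) \<and>
     E \<in> carrier_mat (length (a i)) (length (a i)) \<and>
     \<beta> * \<alpha> = 1\<^sub>m (length (a i)) + \<phi> i * h + E \<and>
     E * \<phi> i = 0\<^sub>m (length (a i)) (length (a (Suc i))) \<and>
     (\<forall>k<length (a i). \<forall>l<length (a i). Poly_Mapping.lookup (E $$ (k, l)) 0 = 0))"

lemma matrix_split_diff:
  fixes A B C :: "'r::comm_ring_1 mat"
  assumes "A \<in> carrier_mat n p" "B \<in> carrier_mat n p" "C \<in> carrier_mat n p"
  shows "A = B + (A - (B + C)) + C"
  using assms by (intro eq_matI) auto

lemma comparison_0:
  assumes res: "graded_free_resolution J \<epsilon> \<phi> a" and res': "graded_free_resolution J \<epsilon>' \<phi>' a'"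
    and J: "ideal J poly_ring" "\<And>d f. f \<in> J \<Longrightarrow> homogeneous_component d f \<in> J"
  shows "comparison_at \<phi> a \<phi>' a' 0"
proof -
  let ?n = "length (a 0)" and ?m = "length (a' 0)"
  note e = resolution_augmentation_carrier[OF res] and e' = resolution_augmentation_carrier[OF res']
  note \<phi> = resolution_carrier[OF res, of 0] and \<phi>' = resolution_carrier[OF res', of 0]
  have add: "f + g \<in> J" if "f \<in> J" "g \<in> J" for f g using J(1) that by (simp add: ideal_poly_ring_iff)
  obtain \<alpha> where \<alpha>: "graded_matrix (a' 0) (a 0) \<alpha>"
    and \<alpha>J: "\<And>w. w \<in> carrier_vec ?n \<Longrightarrow> \<epsilon> \<bullet> w - \<epsilon>' \<bullet> (\<alpha> *\<^sub>v w) \<in> J"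
    using augmentation_lift[OF res res' J] by blast
  obtain \<beta> where \<beta>: "graded_matrix (a 0) (a' 0) \<beta>"
    and \<beta>J: "\<And>w. w \<in> carrier_vec ?m \<Longrightarrow> \<epsilon>' \<bullet> w - \<epsilon> \<bullet> (\<beta> *\<^sub>v w) \<in> J"
    using augmentation_lift[OF res' res J] by blast
  have \<alpha>c: "\<alpha> \<in> carrier_mat ?m ?n" and \<beta>c: "\<beta> \<in> carrier_mat ?n ?m"
    using \<alpha> \<beta> by (auto simp: graded_matrix_def)
  have mem: "g \<in> J" if "f \<in> J" "f - g \<in> J" for f g
    using ideal_diff_closed[OF J(1) that] by simp
  have "\<epsilon>' \<bullet> col (\<alpha> * \<phi> 0) k \<in> J" if k: "k < length (a (Suc 0))" for k
  proof -
    have "\<epsilon> \<bullet> col (\<phi> 0) k \<in> J" by (rule resolution_augmentation_col[OF res k])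
    moreover have "\<epsilon> \<bullet> col (\<phi> 0) k - \<epsilon>' \<bullet> (\<alpha> *\<^sub>v col (\<phi> 0) k) \<in> J"
      using \<phi> k by (intro \<alpha>J) simp
    ultimately show ?thesis unfolding col_mult2[OF \<alpha>c \<phi> k] by (rule mem)
  qed
  then obtain U where U: "U \<in> carrier_mat (length (a' (Suc 0))) (length (a (Suc 0)))"
    "\<phi>' 0 * U = \<alpha> * \<phi> 0"
    using resolution_lift_0[OF res' mult_carrier_mat[OF \<alpha>c \<phi>]] by blast
  have "\<epsilon> \<bullet> col (\<beta> * \<phi>' 0) k \<in> J" if k: "k < length (a' (Suc 0))" for k
  proof -
    have "\<epsilon>' \<bullet> col (\<phi>' 0) k \<in> J" by (rule resolution_augmentation_col[OF res' k])
    moreover have "\<epsilon>' \<bullet> col (\<phi>' 0) k - \<epsilon> \<bullet> (\<beta> *\<^sub>v col (\<phi>' 0) k) \<in> J"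
      using \<phi>' k by (intro \<beta>J) simp
    ultimately show ?thesis unfolding col_mult2[OF \<beta>c \<phi>' k] by (rule mem)
  qed
  then obtain V where V: "V \<in> carrier_mat (length (a (Suc 0))) (length (a' (Suc 0)))"
    "\<phi> 0 * V = \<beta> * \<phi>' 0"
    using resolution_lift_0[OF res mult_carrier_mat[OF \<beta>c \<phi>']] by blast
  \<comment> \<open>columns of \<open>D\<close> augment into \<open>J\<close>, so \<open>D\<close> factors through the first differential\<close>
  define D where "D = \<beta> * \<alpha> - 1\<^sub>m ?n"
  have D: "D \<in> carrier_mat ?n ?n" unfolding D_def by (rule minus_carrier_mat) simp
  have "\<epsilon> \<bullet> col D k \<in> J" if k: "k < ?n" for k
  proof -
    let ?u = "unit_vec ?n k :: ('a, 'b) mpoly vec"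
    have "col D k = \<beta> *\<^sub>v (\<alpha> *\<^sub>v ?u) - ?u"
    proof (rule eq_vecI)
      fix i assume i: "i < dim_vec (\<beta> *\<^sub>v (\<alpha> *\<^sub>v ?u) - ?u)"
      have "\<beta> *\<^sub>v (\<alpha> *\<^sub>v ?u) = (\<beta> * \<alpha>) *\<^sub>v ?u"
        using \<alpha>c \<beta>c by (simp add: assoc_mult_mat_vec)
      then show "col D k $ i = (\<beta> *\<^sub>v (\<alpha> *\<^sub>v ?u) - ?u) $ i"
        using i k \<alpha>c \<beta>c by (simp add: D_def mult_unit_vec)
    qed (use \<alpha>c \<beta>c in \<open>simp add: D_def\<close>)
    then have "\<epsilon> \<bullet> col D k = \<epsilon> \<bullet> (\<beta> *\<^sub>v (\<alpha> *\<^sub>v ?u)) - \<epsilon> \<bullet> ?u"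
      using e \<alpha>c \<beta>c by (simp add: scalar_prod_minus_distrib[of _ ?n])
    also have "\<dots> = 0 - ((\<epsilon> \<bullet> ?u - \<epsilon>' \<bullet> (\<alpha> *\<^sub>v ?u)) + (\<epsilon>' \<bullet> (\<alpha> *\<^sub>v ?u) - \<epsilon> \<bullet> (\<beta> *\<^sub>v (\<alpha> *\<^sub>v ?u))))"
      by simp
    also have "\<dots> \<in> J"
      using \<alpha>c J(1) by (intro ideal_diff_closed[OF J(1)] add \<alpha>J \<beta>J) (auto simp: ideal_poly_ring_iff)
    finally show ?thesis .
  qed
  then obtain h where h: "h \<in> carrier_mat (length (a (Suc 0))) ?n" "\<phi> 0 * h = D"
    using resolution_lift_0[OF res D] by blast
  have "\<beta> * \<alpha> = 1\<^sub>m ?n + \<phi> 0 * h + 0\<^sub>m ?n ?n"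
    unfolding h(2) using \<alpha>c \<beta>c by (intro eq_matI) (auto simp: D_def)
  note eq = this
  show ?thesis
    unfolding comparison_at_def
  proof (intro exI conjI allI impI)
    show "\<alpha> * \<phi> 0 = \<phi>' 0 * U" "\<beta> * \<phi>' 0 = \<phi> 0 * V" using U(2) V(2) by simp_all
    show "0\<^sub>m ?n ?n * \<phi> 0 = 0\<^sub>m ?n (length (a (Suc 0)))" by (rule left_mult_zero_mat[OF \<phi>])
    fix k l assume "k < ?n" "l < ?n"
    then show "Poly_Mapping.lookup ((0\<^sub>m ?n ?n :: ('a, 'b) mpoly mat) $$ (k, l)) 0 = 0" by simp
  qed (fact \<alpha> \<beta>c U(1) V(1) h(1) zero_carrier_mat eq)+
qed

lemma constant_term_sum:
  "Poly_Mapping.lookup (\<Sum>s\<in>A. f s * g s) 0 =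
    (\<Sum>s\<in>A. Poly_Mapping.lookup (f s :: ('v::finite, 'k::field) mpoly) 0 * Poly_Mapping.lookup (g s) 0)"
  by (simp add: lookup_sum lookup_mult_0)

lemma constant_term_matrix_mult:
  fixes M N :: "('v::finite, 'k::field) mpoly mat"
  assumes "M \<in> carrier_mat n p" "N \<in> carrier_mat p q" "i < n" "j < q"
  shows "Poly_Mapping.lookup ((M * N) $$ (i, j)) 0 =
    (\<Sum>s<p. Poly_Mapping.lookup (M $$ (i, s)) 0 * Poly_Mapping.lookup (N $$ (s, j)) 0)"
  using assms by (simp add: scalar_prod_def constant_term_sum lessThan_atLeast0)

lemma minimal_constant_term:
  assumes "minimal_graded_free_resolution J \<epsilon> \<phi> a" "k < length (a i)" "l < length (a (Suc i))"
  shows "Poly_Mapping.lookup (\<phi> i $$ (k, l)) 0 = 0"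
proof -
  have "\<phi> i \<in> carrier_mat (length (a i)) (length (a (Suc i)))"
    using assms resolution_carrier by (auto simp: minimal_graded_free_resolution_def)
  then have "\<phi> i $$ (k, l) \<in> elements_mat (\<phi> i)" using assms by auto
  then show ?thesis
    using assms by (auto simp: minimal_graded_free_resolution_def irrelevant_ideal_eq)
qed

text \<open>The standard construction: \<open>U\<close> (made graded) and \<open>V\<close> are the next comparison maps, and exactness
yields the next homotopy. Minimality of the first resolution is needed for the new \<open>E = h * \<phi> i\<close> to
have no constant terms.\<close>

lemma comparison_Suc:
  assumes min: "minimal_graded_free_resolution J \<epsilon> \<phi> a"
    and res': "graded_free_resolution J \<epsilon>' \<phi>' a'"
    and cmp: "comparison_at \<phi> a \<phi>' a' i"
  shows "comparison_at \<phi> a \<phi>' a' (Suc i)"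
proof -
  have res: "graded_free_resolution J \<epsilon> \<phi> a"
    using min by (simp add: minimal_graded_free_resolution_def)
  define n0 n1 n2 where n: "n0 = length (a i)" "n1 = length (a (Suc i))" "n2 = length (a (Suc (Suc i)))"
  define m0 m1 m2 where m: "m0 = length (a' i)" "m1 = length (a' (Suc i))" "m2 = length (a' (Suc (Suc i)))"
  define P Q P' Q' where P: "P = \<phi> i" "Q = \<phi> (Suc i)" "P' = \<phi>' i" "Q' = \<phi>' (Suc i)"
  have Pc [simp]: "P \<in> carrier_mat n0 n1" "Q \<in> carrier_mat n1 n2"
      "P' \<in> carrier_mat m0 m1" "Q' \<in> carrier_mat m1 m2"
    unfolding P n m using resolution_carrier[OF res] resolution_carrier[OF res'] by auto
  have PQ: "P * Q = 0\<^sub>m n0 n2" "P' * Q' = 0\<^sub>m m0 m2"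
    unfolding P n m by (rule resolution_compose_0[OF res], rule resolution_compose_0[OF res'])
  obtain \<alpha> \<beta> U V h E where \<alpha>: "graded_matrix (a' i) (a i) \<alpha>"
    and carrier [simp]: "\<beta> \<in> carrier_mat n0 m0" "U \<in> carrier_mat m1 n1" "V \<in> carrier_mat n1 m1"
      "h \<in> carrier_mat n1 n0" "E \<in> carrier_mat n0 n0"
    and U: "\<alpha> * P = P' * U" and V: "\<beta> * P' = P * V"
    and hE: "\<beta> * \<alpha> = 1\<^sub>m n0 + P * h + E" and E0: "E * P = 0\<^sub>m n0 n1"
    using cmp unfolding comparison_at_def P[symmetric] n[symmetric] m[symmetric] by blast
  have \<alpha>c [simp]: "\<alpha> \<in> carrier_mat m0 n0" using \<alpha> by (simp add: graded_matrix_def n m)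
  have "graded_matrix (a' i) (a (Suc i)) (\<alpha> * P)"
    unfolding P by (rule graded_matrix_mult[OF \<alpha> resolution_graded[OF res]])
  from graded_factor[OF resolution_graded[OF res'] this, of U] obtain Z
    where Z: "graded_matrix (a' (Suc i)) (a (Suc i)) Z" and PZ: "P' * Z = \<alpha> * P"
    using U carrier(2) unfolding P n m by auto
  have Zc [simp]: "Z \<in> carrier_mat m1 n1" using Z by (simp add: graded_matrix_def n m)
  have "P' * (Z * Q) = \<alpha> * (P * Q)"
    
    using assoc_mult_mat[OF Pc(3) Zc Pc(2)] assoc_mult_mat[OF \<alpha>c Pc(1,2)] PZ by metis
  also have "\<dots> = 0\<^sub>m m0 n2" by (simp add: PQ right_mult_zero_mat[OF \<alpha>c])
  finally have "\<exists>Y\<in>carrier_mat m2 n2. Q' * Y = Z * Q"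
    using resolution_lift_Suc[OF res', of "Z * Q" i n2] mult_carrier_mat[OF Zc Pc(2)]
    unfolding P n m by blast
  then obtain U' where U': "U' \<in> carrier_mat m2 n2" "Q' * U' = Z * Q" by blast
  have "P * (V * Q') = \<beta> * (P' * Q')"
    
    using assoc_mult_mat[OF Pc(1) carrier(3) Pc(4)] assoc_mult_mat[OF carrier(1) Pc(3,4)] V by metis
  also have "\<dots> = 0\<^sub>m n0 m2" by (simp add: PQ right_mult_zero_mat[OF carrier(1)])
  finally have "\<exists>Y\<in>carrier_mat n2 m2. Q * Y = V * Q'"
    using resolution_lift_Suc[OF res, of "V * Q'" i m2] mult_carrier_mat[OF carrier(3) Pc(4)]
    unfolding P n m by blast
  then obtain V' where V': "V' \<in> carrier_mat n2 m2" "Q * V' = V * Q'" by blast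
  \<comment> \<open>\<open>P * D = 0\<close> because \<open>E * P = 0\<close>; factoring \<open>D\<close> gives the next homotopy \<open>h'\<close>\<close>
  define D where "D = V * Z - (1\<^sub>m n1 + h * P)"
  have hP [simp]: "h * P \<in> carrier_mat n1 n1" and VZ [simp]: "V * Z \<in> carrier_mat n1 n1"
    using mult_carrier_mat[OF carrier(4) Pc(1)] mult_carrier_mat[OF carrier(3) Zc] by auto
  have Ph: "P * h \<in> carrier_mat n0 n0" by (rule mult_carrier_mat[OF Pc(1) carrier(4)])
  have Dc: "D \<in> carrier_mat n1 n1" by (simp add: D_def minus_carrier_mat[OF add_carrier_mat[OF hP]])
  have "P * (V * Z) = (\<beta> * \<alpha>) * P"
    
    using assoc_mult_mat[OF Pc(1) carrier(3) Zc] assoc_mult_mat[OF carrier(1) Pc(3) Zc]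
      assoc_mult_mat[OF carrier(1) \<alpha>c Pc(1)] V PZ by metis
  also have "\<dots> = (1\<^sub>m n0 + P * h) * P + E * P"
    unfolding hE
    by (rule add_mult_distrib_mat[OF add_carrier_mat[OF Ph] carrier(5) Pc(1)])
  also have "(1\<^sub>m n0 + P * h) * P = P + P * (h * P)"
    by (subst add_mult_distrib_mat[OF one_carrier_mat Ph Pc(1)])
      (simp add: left_mult_one_mat[OF Pc(1)] assoc_mult_mat[OF Pc(1) carrier(4) Pc(1)])
  finally have PVZ: "P * (V * Z) = P + P * (h * P)"
    unfolding E0 by (simp only: right_add_zero_mat[OF add_carrier_mat[OF mult_carrier_mat[OF Pc(1) hP]]])
  have "P * D = P * (V * Z) - P * (1\<^sub>m n1 + h * P)"
    unfolding D_def by (rule mult_minus_distrib_mat[OF Pc(1) VZ add_carrier_mat[OF hP]])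
  also have "P * (1\<^sub>m n1 + h * P) = P + P * (h * P)"
    by (subst mult_add_distrib_mat[OF Pc(1) one_carrier_mat hP])
      (simp add: right_mult_one_mat[OF Pc(1)])
  finally have "P * D = 0\<^sub>m n0 n1"
    unfolding PVZ
    by (simp only: minus_r_inv_mat[OF add_carrier_mat[OF mult_carrier_mat[OF Pc(1) hP]]])
  then have "\<exists>Y\<in>carrier_mat n2 n1. Q * Y = D"
    using resolution_lift_Suc[OF res, of D i n1] Dc unfolding P n m by blast
  then obtain h' where h': "h' \<in> carrier_mat n2 n1" "Q * h' = D" by blast
  have eq: "V * Z = 1\<^sub>m n1 + Q * h' + h * P"
    unfolding h'(2) D_def by (rule matrix_split_diff[OF VZ one_carrier_mat hP])
  have "h * P * Q = h * (P * Q)" by (rule assoc_mult_mat[OF carrier(4) Pc(1,2)])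
  then have hPQ: "h * P * Q = 0\<^sub>m n1 n2" by (simp add: PQ right_mult_zero_mat[OF carrier(4)])
  have const: "Poly_Mapping.lookup ((h * P) $$ (k, l)) 0 = 0" if "k < n1" "l < n1" for k l
    using that minimal_constant_term[OF min] unfolding P n
    by (subst constant_term_matrix_mult[OF carrier(4) Pc(1), unfolded P n]) auto
  show ?thesis
    unfolding comparison_at_def P[symmetric] n[symmetric] m[symmetric]
  proof (intro exI conjI allI impI)
    show "Z * Q = Q' * U'" "V * Q' = Q * V'" using U'(2) V'(2) by simp_all
  qed (fact Z carrier(3) U'(1) V'(1) h'(1) hP eq hPQ const)+
qed

text \<open>Modulo the irrelevant ideal, that is on constant terms, \<open>\<beta> * \<alpha>\<close> becomes the identity, so the constant
part of \<open>\<alpha>\<close> is injective. As \<open>\<alpha>\<close> is graded, its constant part maps basis elements of degree \<open>j\<close> to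
combinations of basis elements of degree \<open>j\<close>; there are thus at least as many of them in the target.\<close>

lemma minimal_resolution_degrees_le:
  assumes min: "minimal_graded_free_resolution J \<epsilon> \<phi> a"
    and res': "graded_free_resolution J \<epsilon>' \<phi>' a'"
    and J: "ideal J poly_ring" "\<And>d f. f \<in> J \<Longrightarrow> homogeneous_component d f \<in> J"
  shows "count_list (a i) j \<le> count_list (a' i) j"
proof (rule ccontr)
  define n m where n: "n = length (a i)" and m: "m = length (a' i)"
  define A where "A = {k. k < n \<and> a i ! k = j}"
  define B where "B = {l. l < m \<and> a' i ! l = j}"
  assume "\<not> ?thesis"
  then have card: "card B < card A"
    by (simp add: A_def B_def n m count_list_eq_length_filter length_filter_conv_card eq_commute[of j])
  have res: "graded_free_resolution J \<epsilon> \<phi> a"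
    using min by (simp add: minimal_graded_free_resolution_def)
  have "comparison_at \<phi> a \<phi>' a' i"
  proof (induction i)
    case 0
    show ?case by (rule comparison_0[OF res res' J])
  next
    case (Suc i)
    show ?case by (rule comparison_Suc[OF min res' Suc])
  qed
  then obtain \<alpha> \<beta> h E where \<alpha>: "graded_matrix (a' i) (a i) \<alpha>"
    and \<beta>: "\<beta> \<in> carrier_mat n m" and h: "h \<in> carrier_mat (length (a (Suc i))) n"
    and E: "E \<in> carrier_mat n n" and eq: "\<beta> * \<alpha> = 1\<^sub>m n + \<phi> i * h + E"
    and E0: "\<And>k l. k < n \<Longrightarrow> l < n \<Longrightarrow> Poly_Mapping.lookup (E $$ (k, l)) 0 = 0"
    unfolding comparison_at_def n[symmetric] m[symmetric] by blast
  have \<alpha>c: "\<alpha> \<in> carrier_mat m n" using \<alpha> by (simp add: graded_matrix_def n m)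
  have \<phi>: "\<phi> i \<in> carrier_mat n (length (a (Suc i)))" unfolding n by (rule resolution_carrier[OF res])
  define s where "s = (\<lambda>k l. Poly_Mapping.lookup (\<alpha> $$ (l, k)) 0)"
  define t where "t = (\<lambda>k l. Poly_Mapping.lookup (\<beta> $$ (k, l)) 0)"
  have inverse: "(\<Sum>l<m. t k l * s k' l) = (if k = k' then 1 else 0)" if k: "k < n" "k' < n" for k k'
  proof -
    have "(\<Sum>l<m. t k l * s k' l) = Poly_Mapping.lookup ((\<beta> * \<alpha>) $$ (k, k')) 0"
      unfolding s_def t_def by (rule constant_term_matrix_mult[OF \<beta> \<alpha>c k, symmetric])
    also have "(\<beta> * \<alpha>) $$ (k, k') = (1\<^sub>m n) $$ (k, k') + (\<phi> i * h) $$ (k, k') + E $$ (k, k')"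
      unfolding eq using k \<phi> h E by simp
    also have "Poly_Mapping.lookup \<dots> 0 = Poly_Mapping.lookup ((1\<^sub>m n) $$ (k, k')) 0 +
        Poly_Mapping.lookup ((\<phi> i * h) $$ (k, k')) 0"
      using E0 k by (simp add: lookup_add)
    also have "Poly_Mapping.lookup ((\<phi> i * h) $$ (k, k')) 0 = 0"
      using minimal_constant_term[OF min] k n by (simp add: constant_term_matrix_mult[OF \<phi> h k])
    finally show ?thesis using k by (cases "k = k'") simp_all
  qed
  have s0: "s k l = 0" if "k \<in> A" "l < m" "l \<notin> B" for k l
  proof -
    have gr: "\<alpha> $$ (l, k) \<in> graded_part (a i ! k - a' i ! l)" and ne: "a i ! k - a' i ! l \<noteq> 0"
      using that \<alpha> by (auto simp: graded_matrix_def A_def B_def n m)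
    have "0 \<notin> Poly_Mapping.keys (\<alpha> $$ (l, k))"
    proof
      assume "0 \<in> Poly_Mapping.keys (\<alpha> $$ (l, k))"
      then have "int (total_degree (0 :: 'a \<Rightarrow>\<^sub>0 nat)) = a i ! k - a' i ! l"
        using gr unfolding graded_part_def by blast
      then show False using ne by simp
    qed
    then show ?thesis by (simp add: s_def in_keys_iff)
  qed
  have finA: "finite A" by (simp add: A_def)
  obtain c where c: "\<exists>k\<in>A. c k \<noteq> 0" "\<And>l. l \<in> B \<Longrightarrow> (\<Sum>k\<in>A. c k * s k l) = 0"
    using linear_dependence[OF _ _ card, of s] by (auto simp: A_def B_def)
  have zero: "(\<Sum>k\<in>A. c k * s k l) = 0" if "l < m" for l
    using c(2)[of l] s0 that by (cases "l \<in> B") auto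
  have "c p = 0" if p: "p \<in> A" for p
  proof -
    have "c p = (\<Sum>k\<in>A. c k * (if p = k then 1 else 0))"
      using p finA by (simp add: if_distrib[of "(*) _"] sum.delta' cong: if_cong)
    also have "\<dots> = (\<Sum>k\<in>A. c k * (\<Sum>l<m. t p l * s k l))"
      using p by (intro sum.cong) (auto simp: inverse A_def)
    also have "\<dots> = (\<Sum>l<m. t p l * (\<Sum>k\<in>A. c k * s k l))"
      unfolding sum_distrib_left by (subst sum.swap) (simp add: mult.left_commute)
    finally show ?thesis using zero by simp
  qed
  then show False using c(1) by blast
qed

theorem graded_betti_eq:
  assumes min: "minimal_graded_free_resolution J \<epsilon> \<phi> a"
    and J: "ideal J poly_ring" "\<And>d f. f \<in> J \<Longrightarrow> homogeneous_component d f \<in> J"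
  shows "graded_betti J i j = count_list (a i) j"
  unfolding graded_betti_def
proof (rule the_equality)
  show "\<exists>\<epsilon> \<phi> a'. minimal_graded_free_resolution J \<epsilon> \<phi> a' \<and> count_list (a i) j = count_list (a' i) j"
    using min by blast
  fix n assume "\<exists>\<epsilon> \<phi> a'. minimal_graded_free_resolution J \<epsilon> \<phi> a' \<and> n = count_list (a' i) j"
  then obtain \<epsilon>' \<phi>' a' where min': "minimal_graded_free_resolution J \<epsilon>' \<phi>' a'"
    and n: "n = count_list (a' i) j" by blast
  have "graded_free_resolution J \<epsilon> \<phi> a" "graded_free_resolution J \<epsilon>' \<phi>' a'"
    using min min' by (auto simp: minimal_graded_free_resolution_def)
  then show "n = count_list (a i) j"
    using minimal_resolution_degrees_le[OF min _ J] minimal_resolution_degrees_le[OF min' _ J]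
    unfolding n by (metis le_antisym)
qed

section \<open>Krull dimension\<close>

lemma keys_add_nat: "Poly_Mapping.keys (m + n) = Poly_Mapping.keys m \<union> Poly_Mapping.keys (n :: 'a \<Rightarrow>\<^sub>0 nat)"
  by (auto simp: in_keys_iff lookup_add)

lemma lookup_mult_keys:
  fixes f g :: "('v::finite, 'k::field) mpoly"
  shows "Poly_Mapping.lookup (f * g) m = (\<Sum>(k, q)\<in>Poly_Mapping.keys f \<times> Poly_Mapping.keys g.
    if k + q = m then Poly_Mapping.lookup f k * Poly_Mapping.lookup g q else 0)"
proof -
  have "f * g = (\<Sum>k\<in>Poly_Mapping.keys f. Poly_Mapping.single k (Poly_Mapping.lookup f k)) *
      (\<Sum>q\<in>Poly_Mapping.keys g. Poly_Mapping.single q (Poly_Mapping.lookup g q))"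
    by (simp flip: poly_mapping_sum_single)
  also have "\<dots> = (\<Sum>(k, q)\<in>Poly_Mapping.keys f \<times> Poly_Mapping.keys g.
      Poly_Mapping.single (k + q) (Poly_Mapping.lookup f k * Poly_Mapping.lookup g q))"
    by (simp add: sum_product sum.cartesian_product mult_single)
  finally show ?thesis
    by (simp add: lookup_sum lookup_single when_def case_prod_unfold)
qed

text \<open>Numbering the variables carries the lexicographic order of \<open>nat \<Rightarrow>\<^sub>0 nat\<close> over to the monomials; the
type \<open>'v\<close> itself has no order.\<close>

lemma monomial_order_embedding:
  "\<exists>\<iota> :: ('v::finite \<Rightarrow>\<^sub>0 nat) \<Rightarrow> (nat \<Rightarrow>\<^sub>0 nat). inj \<iota> \<and> (\<forall>a b. \<iota> (a + b) = \<iota> a + \<iota> b)"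
proof -
  obtain e :: "'v \<Rightarrow> nat" where e: "inj e"
    using finite_imp_inj_to_nat_seg[of "UNIV :: 'v set"] by auto
  define \<iota> where "\<iota> = (\<lambda>m :: 'v \<Rightarrow>\<^sub>0 nat. \<Sum>v\<in>UNIV. Poly_Mapping.single (e v) (Poly_Mapping.lookup m v))"
  have lookup: "Poly_Mapping.lookup (\<iota> m) (e v) = Poly_Mapping.lookup m v" for m v
    using e by (simp add: \<iota>_def lookup_sum lookup_single when_def inj_eq)
  have "inj \<iota>"
    by (rule injI, rule poly_mapping_eqI) (metis lookup)
  moreover have "\<iota> (a + b) = \<iota> a + \<iota> b" for a b
    by (simp add: \<iota>_def lookup_add single_add sum.distrib)
  ultimately show ?thesis by blast
qed

text \<open>The monomial prime generated by the variables in \<open>A\<close>, see \<open>variable_ideal_prime\<close> and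
\<open>variable_ideal_subset\<close>.\<close>

definition variable_ideal :: "'v set \<Rightarrow> ('v::finite, 'k::field) mpoly set" where
  "variable_ideal A = supported_on {m. Poly_Mapping.keys m \<inter> A \<noteq> {}}"

lemma variable_ideal_ideal: "ideal (variable_ideal A) poly_ring"
  unfolding variable_ideal_def by (rule supported_on_ideal) (auto simp: keys_add_nat)

lemma variable_ideal_mono: "A \<subseteq> B \<Longrightarrow> variable_ideal A \<subseteq> variable_ideal B"
  unfolding variable_ideal_def supported_on_def by blast

text \<open>If neither factor lies in the ideal, each has terms that avoid \<open>A\<close>. The product of the leading ones
among these terms, for a monomial order, cannot cancel and avoids \<open>A\<close> as well.\<close>

lemma variable_ideal_prime: "primeideal (variable_ideal A :: ('v::finite, 'k::field) mpoly set) poly_ring"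
  unfolding primeideal_poly_ring_iff
proof (intro conjI allI impI variable_ideal_ideal)
  show "1 \<notin> (variable_ideal A :: ('v, 'k) mpoly set)"
    by (simp add: variable_ideal_def flip: single_one)
  fix f g :: "('v, 'k) mpoly"
  assume fg: "f * g \<in> variable_ideal A"
  obtain \<iota> :: "('v \<Rightarrow>\<^sub>0 nat) \<Rightarrow> (nat \<Rightarrow>\<^sub>0 nat)"
    where \<iota>: "inj \<iota>" "\<And>a b. \<iota> (a + b) = \<iota> a + \<iota> b"
    using monomial_order_embedding by blast
  define N where "N = (\<lambda>h :: ('v, 'k) mpoly. {m \<in> Poly_Mapping.keys h. Poly_Mapping.keys m \<inter> A = {}})"
  have leading: "\<exists>m\<in>N h. \<forall>k\<in>N h. \<iota> k \<le> \<iota> m" if "h \<notin> variable_ideal A" for h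
  proof -
    have ne: "finite (\<iota> ` N h)" "\<iota> ` N h \<noteq> {}"
      using that by (auto simp: N_def variable_ideal_def supported_on_def)
    have "Max (\<iota> ` N h) \<in> \<iota> ` N h" by (rule Max_in[OF ne])
    then obtain m where m: "m \<in> N h" "\<iota> m = Max (\<iota> ` N h)" by (metis imageE)
    have "\<iota> k \<le> \<iota> m" if "k \<in> N h" for k
      unfolding m(2) by (rule Max_ge[OF ne(1)]) (use that in blast)
    then show ?thesis using m(1) by blast
  qed
  show "f \<in> variable_ideal A \<or> g \<in> variable_ideal A"
  proof (rule ccontr)
    assume "\<not> ?thesis"
    then have f: "f \<notin> variable_ideal A" and g: "g \<notin> variable_ideal A" by auto
    obtain a where a: "a \<in> N f" "\<And>k. k \<in> N f \<Longrightarrow> \<iota> k \<le> \<iota> a" using leading[OF f] by blast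
    obtain b where b: "b \<in> N g" "\<And>k. k \<in> N g \<Longrightarrow> \<iota> k \<le> \<iota> b" using leading[OF g] by blast
    have unique: "k = a \<and> q = b"
      if k: "k \<in> Poly_Mapping.keys f" "q \<in> Poly_Mapping.keys g" and eq: "k + q = a + b" for k q
    proof -
      have "Poly_Mapping.keys (k + q) \<inter> A = {}" using a(1) b(1) unfolding eq by (auto simp: N_def keys_add_nat)
      then have "k \<in> N f" "q \<in> N g" using k by (auto simp: N_def keys_add_nat)
      then have le: "\<iota> k \<le> \<iota> a" "\<iota> q \<le> \<iota> b" using a b by auto
      have sum: "\<iota> k + \<iota> q = \<iota> a + \<iota> b" using eq \<iota>(2) by metis
      have "\<iota> k = \<iota> a"
      proof (rule ccontr)
        assume "\<iota> k \<noteq> \<iota> a"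
        then have "\<iota> k < \<iota> a" using le(1) by simp
        then have "\<iota> k + \<iota> q < \<iota> a + \<iota> b" using le(2) by (rule add_less_le_mono)
        then show False using sum by simp
      qed
      then have "k = a" using \<iota>(1) by (simp add: inj_eq)
      then show ?thesis using eq by simp
    qed
    have "Poly_Mapping.lookup (f * g) (a + b) = (\<Sum>(k, q)\<in>Poly_Mapping.keys f \<times> Poly_Mapping.keys g.
        if (k, q) = (a, b) then Poly_Mapping.lookup f a * Poly_Mapping.lookup g b else 0)"
      unfolding lookup_mult_keys by (rule sum.cong) (use unique in auto)
    also have "\<dots> = (\<Sum>p\<in>Poly_Mapping.keys f \<times> Poly_Mapping.keys g.
        if p = (a, b) then Poly_Mapping.lookup f a * Poly_Mapping.lookup g b else 0)"
      by (rule sum.cong) (auto split: if_split_asm)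
    also have "\<dots> = Poly_Mapping.lookup f a * Poly_Mapping.lookup g b"
      using a(1) b(1) by (simp add: N_def sum.delta')
    also have "\<dots> \<noteq> 0" using a(1) b(1) by (simp add: N_def in_keys_iff)
    finally have "a + b \<in> Poly_Mapping.keys (f * g)" by (simp add: in_keys_iff)
    moreover have "Poly_Mapping.keys (a + b) \<inter> A = {}" using a(1) b(1) by (auto simp: N_def keys_add_nat)
    ultimately show False using fg by (auto simp: variable_ideal_def supported_on_def)
  qed
qed

lemma Var_in_variable_ideal_iff: "(Var v :: ('v::finite, 'k::field) mpoly) \<in> variable_ideal A \<longleftrightarrow> v \<in> A"
  by (simp add: variable_ideal_def Var_def)

lemma variable_ideal_subset:
  assumes I: "ideal I poly_ring" and A: "\<And>v. v \<in> A \<Longrightarrow> (Var v :: ('v::finite, 'k::field) mpoly) \<in> I"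
  shows "variable_ideal A \<subseteq> I"
proof
  fix f :: "('v, 'k) mpoly" assume f: "f \<in> variable_ideal A"
  have "Poly_Mapping.single m c \<in> I" if meets: "Poly_Mapping.keys m \<inter> A \<noteq> {}" for m and c :: 'k
  proof -
    obtain v where v: "v \<in> A" "v \<in> Poly_Mapping.keys m" using meets by blast
    then have m: "m = Poly_Mapping.single v 1 + (m - Poly_Mapping.single v 1)"
      by (intro poly_mapping_eqI) (auto simp: lookup_add lookup_minus lookup_single when_def in_keys_iff)
    have "Poly_Mapping.single (m - Poly_Mapping.single v 1) c * Var v \<in> I"
      using A[OF v(1)] I by (simp add: ideal_poly_ring_iff)
    then show ?thesis by (subst m) (simp add: Var_def mult_single add.commute)
  qed
  then have "Poly_Mapping.single m (Poly_Mapping.lookup f m) \<in> I" if "m \<in> Poly_Mapping.keys f" for m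
    using f that unfolding variable_ideal_def supported_on_def by blast
  then show "f \<in> I"
    by (subst poly_mapping_sum_single) (rule ideal_sum_closed[OF I])
qed

lemma prime_power:
  assumes "primeideal P (poly_ring :: ('v::finite, 'k::field) mpoly ring)" "y \<notin> P"
  shows "y ^ n \<notin> P"
  using assms by (induction n) (auto simp: primeideal_poly_ring_iff)

text \<open>The monomial in \<open>y 0, y 1, \<dots>\<close> with the given list of exponents. The recursion on the list splits off
the first element, as the induction along a chain of primes does.\<close>

fun list_monomial :: "(nat \<Rightarrow> 'a::comm_semiring_1) \<Rightarrow> nat list \<Rightarrow> 'a" where
  "list_monomial y [] = 1"
| "list_monomial y (m # ms) = y 0 ^ m * list_monomial (\<lambda>i. y (Suc i)) ms"

text \<open>Elements \<open>y i\<close> that witness the strict inclusions of a chain of \<open>r\<close> steps are algebraically independent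
over the field modulo the bottom prime. Let \<open>m\<close> be the smallest exponent of \<open>y 0\<close> in a relation that
lies in \<open>P 0\<close>. Then \<open>y 0 ^ m\<close> can be cancelled because \<open>P 0\<close> is prime; modulo \<open>P 1\<close>, which contains
\<open>y 0\<close>, only the terms with exponent \<open>m\<close> survive, and they form a relation for the rest of the chain.\<close>

lemma chain_monomials_independent:
  fixes y :: "nat \<Rightarrow> ('v::finite, 'k::field) mpoly"
  assumes "\<And>i. i \<le> r \<Longrightarrow> primeideal (P i) poly_ring"
    and "\<And>i. i < r \<Longrightarrow> P i \<subseteq> P (Suc i) \<and> y i \<in> P (Suc i) \<and> y i \<notin> P i"
    and "finite T" "T \<noteq> {}" "\<And>ms. ms \<in> T \<Longrightarrow> length ms = r \<and> c ms \<noteq> (0 :: 'k)"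
  shows "(\<Sum>ms\<in>T. Const (c ms) * list_monomial y ms) \<notin> P 0"
  using assms
proof (induction r arbitrary: P y T c)
  case 0
  have T: "T = {[]}" using 0(4,5) by auto
  show ?case
  proof
    assume "(\<Sum>ms\<in>T. Const (c ms) * list_monomial y ms) \<in> P 0"
    then have "Const (c []) \<in> P 0" by (simp add: T)
    moreover have "ideal (P 0) poly_ring" "1 \<notin> P 0" using 0(1)[of 0] by (auto simp: primeideal_poly_ring_iff)
    ultimately have "Const (1 / c []) * Const (c []) \<in> P 0" by (simp add: ideal_poly_ring_iff)
    moreover have "c [] \<noteq> 0" using 0(5) T by simp
    ultimately show False using \<open>1 \<notin> P 0\<close> by (simp add: Const_def mult_single)
  qed
next
  case (Suc r)
  define z where "z = (\<lambda>i. y (Suc i))"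
  define m where "m = Min (hd ` T)"
  define T0 where "T0 = {ms \<in> T. hd ms = m}"
  have m: "m \<in> hd ` T" "\<And>ms. ms \<in> T \<Longrightarrow> m \<le> hd ms"
    using Suc.prems(3,4) by (auto simp: m_def)
  have shape: "ms = hd ms # tl ms" if "ms \<in> T" for ms using Suc.prems(5)[OF that] by (cases ms) auto
  define rest where "rest = (\<Sum>ms\<in>T - T0. Const (c ms) * (y 0 ^ (hd ms - Suc m) * list_monomial z (tl ms)))"
  define low where "low = (\<Sum>ms\<in>T0. Const (c ms) * list_monomial z (tl ms))"
  have P0: "ideal (P 0) poly_ring" and P1: "ideal (P (Suc 0)) poly_ring"
    using Suc.prems(1)[of 0] Suc.prems(1)[of 1] by (auto simp: primeideal_poly_ring_iff)
  have "(\<Sum>ms\<in>T. Const (c ms) * list_monomial y ms) = y 0 ^ m * (low + y 0 * rest)"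
  proof -
    have 0: "list_monomial y ms = y 0 ^ hd ms * list_monomial z (tl ms)" if "ms \<in> T" for ms
      unfolding z_def by (subst shape[OF that]) simp
    have "(\<Sum>ms\<in>T0. Const (c ms) * list_monomial y ms) = y 0 ^ m * low"
      unfolding low_def sum_distrib_left by (rule sum.cong) (auto simp: T0_def 0)
    moreover have "(\<Sum>ms\<in>T - T0. Const (c ms) * list_monomial y ms) = y 0 ^ m * (y 0 * rest)"
      unfolding rest_def sum_distrib_left
    proof (rule sum.cong)
      fix ms assume ms: "ms \<in> T - T0"
      then have "m < hd ms" using m(2)[of ms] by (auto simp: T0_def)
      then have "y 0 ^ hd ms = y 0 ^ m * (y 0 * y 0 ^ (hd ms - Suc m))"
        by (simp flip: power_add power_Suc)
      then show "Const (c ms) * list_monomial y ms =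
          y 0 ^ m * (y 0 * (Const (c ms) * (y 0 ^ (hd ms - Suc m) * list_monomial z (tl ms))))"
        using 0 ms by (simp add: algebra_simps)
    qed simp
    moreover have "(\<Sum>ms\<in>T. Const (c ms) * list_monomial y ms) =
        (\<Sum>ms\<in>T - T0. Const (c ms) * list_monomial y ms) + (\<Sum>ms\<in>T0. Const (c ms) * list_monomial y ms)"
      by (rule sum.subset_diff) (auto simp: T0_def Suc.prems(3))
    ultimately show ?thesis by (simp add: algebra_simps)
  qed
  moreover have "y 0 ^ m * (low + y 0 * rest) \<notin> P 0"
  proof
    assume "y 0 ^ m * (low + y 0 * rest) \<in> P 0"
    moreover have "y 0 ^ m \<notin> P 0" using prime_power[of "P 0" "y 0" m] Suc.prems(1)[of 0] Suc.prems(2)[of 0] by simp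
    ultimately have "low + y 0 * rest \<in> P 0"
      using Suc.prems(1)[of 0] unfolding primeideal_poly_ring_iff by blast
    then have "low + y 0 * rest \<in> P (Suc 0)" using Suc.prems(2)[of 0] by blast
    moreover have "rest * y 0 \<in> P (Suc 0)" using P1 Suc.prems(2)[of 0] by (simp add: ideal_poly_ring_iff)
    ultimately have "low + y 0 * rest - rest * y 0 \<in> P (Suc 0)" using ideal_diff_closed[OF P1] by blast
    then have low: "low \<in> P (Suc 0)" by (simp add: mult.commute)
    have inj: "inj_on tl T0"
    proof (rule inj_onI)
      fix ms ns assume "ms \<in> T0" "ns \<in> T0" "tl ms = tl ns"
      then show "ms = ns" using shape[of ms] shape[of ns] by (simp add: T0_def)
    qed
    have "low = (\<Sum>ns\<in>tl ` T0. Const (c (m # ns)) * list_monomial z ns)"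
      unfolding low_def sum.reindex[OF inj] comp_def
      by (rule sum.cong) (use shape in \<open>auto simp: T0_def\<close>)
    also have "\<dots> \<notin> P (Suc 0)"
    proof (rule Suc.IH)
      show "primeideal (P (Suc i)) poly_ring" if "i \<le> r" for i using Suc.prems(1) that by simp
      show "P (Suc i) \<subseteq> P (Suc (Suc i)) \<and> z i \<in> P (Suc (Suc i)) \<and> z i \<notin> P (Suc i)" if "i < r" for i
        using Suc.prems(2)[of "Suc i"] that by (simp add: z_def)
      show "finite (tl ` T0)" "tl ` T0 \<noteq> {}" using Suc.prems(3) m(1) by (auto simp: T0_def)
      fix ns assume "ns \<in> tl ` T0"
      then obtain ms where ms: "ms \<in> T" "hd ms = m" "ns = tl ms" by (auto simp: T0_def)
      then have "ms = m # ns" using shape by metis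
      then show "length ns = r \<and> c (m # ns) \<noteq> 0" using Suc.prems(5)[OF ms(1)] by auto
    qed
    finally show False using low by blast
  qed
  ultimately show ?case by simp
qed

text \<open>Bounding every exponent separately, rather than the total degree, makes the number of monomials in \<open>d\<close>
variables a plain power.\<close>

definition exponents_bounded :: "nat \<Rightarrow> ('v \<Rightarrow>\<^sub>0 nat) set" where
  "exponents_bounded K = {m. \<forall>v. Poly_Mapping.lookup m v \<le> K}"

lemma exponents_bounded_mult:
  assumes "f \<in> supported_on (exponents_bounded K)" "g \<in> supported_on (exponents_bounded L)"
  shows "f * g \<in> supported_on (exponents_bounded (K + L))"
  using assms by (rule supported_on_mult) (auto simp: exponents_bounded_def lookup_add intro: add_mono)

lemma exponents_bounded_mono: "K \<le> L \<Longrightarrow> exponents_bounded K \<subseteq> exponents_bounded L"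
  by (auto simp: exponents_bounded_def intro: order_trans)

lemma one_exponents_bounded: "(1 :: ('v, 'k::field) mpoly) \<in> supported_on (exponents_bounded K)"
  by (simp add: exponents_bounded_def flip: single_one)

lemma exponents_bounded_power:
  assumes "f \<in> supported_on (exponents_bounded K)"
  shows "f ^ n \<in> supported_on (exponents_bounded (n * K))"
proof (induction n)
  case 0
  show ?case by (simp add: one_exponents_bounded)
next
  case (Suc n)
  show ?case using exponents_bounded_mult[OF assms Suc] by simp
qed

lemma exponents_bounded_list_monomial:
  fixes y :: "nat \<Rightarrow> ('v::finite, 'k::field) mpoly"
  assumes "\<And>i. i < length ms \<Longrightarrow> y i \<in> supported_on (exponents_bounded D)"
    and "\<And>m. m \<in> set ms \<Longrightarrow> m \<le> N"
  shows "list_monomial y ms \<in> supported_on (exponents_bounded (length ms * (N * D)))"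
  using assms
proof (induction ms arbitrary: y)
  case Nil
  then show ?case by (simp add: one_exponents_bounded)
next
  case (Cons m ms)
  have "y 0 ^ m \<in> supported_on (exponents_bounded (m * D))"
    using Cons.prems(1)[of 0] by (intro exponents_bounded_power) simp
  then have "y 0 ^ m \<in> supported_on (exponents_bounded (N * D))"
    using exponents_bounded_mono[of "m * D" "N * D"] Cons.prems(2)[of m]
    by (auto simp: supported_on_def)
  moreover have "list_monomial (\<lambda>i. y (Suc i)) ms \<in> supported_on (exponents_bounded (length ms * (N * D)))"
    using Cons.prems by (intro Cons.IH) auto
  ultimately show ?case using exponents_bounded_mult by fastforce
qed

lemma card_exponents_bounded_avoiding:
  fixes A :: "'v::finite set"
  shows "finite {m \<in> exponents_bounded K. Poly_Mapping.keys m \<inter> A = {}}"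
    and "card {m \<in> exponents_bounded K. Poly_Mapping.keys m \<inter> A = {}} \<le> Suc K ^ card (- A)"
proof -
  let ?B = "{m \<in> exponents_bounded K. Poly_Mapping.keys m \<inter> A = {}}"
  let ?r = "\<lambda>m. restrict (Poly_Mapping.lookup m) (- A)"
  have inj: "inj_on ?r ?B"
  proof (rule inj_onI, rule poly_mapping_eqI)
    fix m n v assume mn: "m \<in> ?B" "n \<in> ?B" "?r m = ?r n"
    show "Poly_Mapping.lookup m v = Poly_Mapping.lookup n v"
    proof (cases "v \<in> A")
      case True
      then have "v \<notin> Poly_Mapping.keys m" "v \<notin> Poly_Mapping.keys n" using mn by auto
      then show ?thesis by (simp add: in_keys_iff)
    next
      case False
      then show ?thesis using fun_cong[OF mn(3), of v] by simp
    qed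
  qed
  have sub: "?r ` ?B \<subseteq> (\<Pi>\<^sub>E v\<in>- A. {..K})" by (auto simp: exponents_bounded_def)
  have fin: "finite (\<Pi>\<^sub>E v\<in>- A. {..K})" by (simp add: finite_PiE)
  show "finite ?B" using inj_on_finite[OF inj sub fin] .
  have "card ?B \<le> card (\<Pi>\<^sub>E v\<in>- A. {..K})" by (rule card_inj_on_le[OF inj sub fin])
  then show "card ?B \<le> Suc K ^ card (- A)" by (simp add: card_PiE)
qed

text \<open>A counting form of the inequality between dimension and transcendence degree. If a chain has more
than \<open>d\<close> steps, where \<open>d\<close> is the number of variables outside \<open>P 0\<close>, then for large \<open>N\<close> the monomials in
the witnesses \<open>y i\<close> with exponents at most \<open>N\<close> outnumber the monomials in \<open>d\<close> variables that can
occur in them. Hence some nontrivial combination has only terms divisible by variables in \<open>P 0\<close>,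
contrary to \<open>chain_monomials_independent\<close>.\<close>

lemma prime_chain_length:
  fixes P :: "nat \<Rightarrow> ('v::finite, 'k::field) mpoly set"
  assumes prime: "\<And>i. i \<le> r \<Longrightarrow> primeideal (P i) poly_ring" and chain: "\<And>i. i < r \<Longrightarrow> P i \<subset> P (Suc i)"
  shows "r \<le> card {v. Var v \<notin> P 0}"
proof (rule ccontr)
  define A where "A = {v. (Var v :: ('v, 'k) mpoly) \<in> P 0}"
  define d where "d = card (- A)"
  assume "\<not> ?thesis"
  then have r: "Suc d \<le> r" by (simp add: A_def d_def Compl_eq)
  have "\<forall>i. \<exists>f. i < r \<longrightarrow> f \<in> P (Suc i) \<and> f \<notin> P i" using chain by blast
  then obtain y where y: "\<And>i. i < r \<Longrightarrow> y i \<in> P (Suc i) \<and> y i \<notin> P i" by metis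
  define D where "D = Max (insert 0 (\<Union>i<r. (\<lambda>m. total_degree m) ` Poly_Mapping.keys (y i)))"
  have yD: "y i \<in> supported_on (exponents_bounded D)" if "i < r" for i
  proof -
    have "Poly_Mapping.lookup m v \<le> D" if "m \<in> Poly_Mapping.keys (y i)" for m v
    proof -
      have "total_degree m \<le> D" unfolding D_def using \<open>i < r\<close> that by (intro Max_ge) auto
      then show ?thesis using lookup_le_total_degree[of m v] by simp
    qed
    then show ?thesis by (auto simp: supported_on_def exponents_bounded_def)
  qed
  \<comment> \<open>with this \<open>N\<close> one has \<open>(r * N * D + 1) ^ d < (N + 1) ^ (d + 1)\<close>\<close>
  define N where "N = Suc (r * D) ^ d"
  define K where "K = r * (N * D)"
  define T where "T = {ms. set ms \<subseteq> {..N} \<and> length ms = r}"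
  define B where "B = {m \<in> exponents_bounded K. Poly_Mapping.keys m \<inter> A = {}}"
  have T: "finite T" "card T = Suc N ^ r"
    unfolding T_def by (simp_all add: finite_lists_length_eq card_lists_length_eq)
  have "Suc K \<le> Suc (r * D) * Suc N" by (simp add: K_def algebra_simps)
  then have "Suc K ^ d \<le> (Suc (r * D) * Suc N) ^ d" by (rule power_mono) simp
  also have "\<dots> = N * Suc N ^ d" unfolding power_mult_distrib N_def ..
  also have "\<dots> < Suc N ^ Suc d" by simp
  also have "\<dots> \<le> Suc N ^ r" using r by (intro power_increasing) auto
  finally have "card B < card T"
    using card_exponents_bounded_avoiding(2)[of K A] unfolding T B_def d_def by linarith
  from linear_dependence[OF T(1) _ this, of "\<lambda>ms m. Poly_Mapping.lookup (list_monomial y ms) m"]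
  obtain c where c: "\<exists>ms\<in>T. c ms \<noteq> 0"
    "\<And>m. m \<in> B \<Longrightarrow> (\<Sum>ms\<in>T. c ms * Poly_Mapping.lookup (list_monomial y ms) m) = 0"
    using card_exponents_bounded_avoiding(1)[of K A] unfolding B_def by blast
  define f where "f = (\<Sum>ms\<in>T. Const (c ms) * list_monomial y ms)"
  have lookup_Const: "Poly_Mapping.lookup (Const k * g) m = k * Poly_Mapping.lookup g m"
    for k and g :: "('v, 'k) mpoly" and m
    unfolding Const_def mult_map_scale_conv_mult[symmetric]
    by (simp add: Poly_Mapping.map.rep_eq when_def)
  have "f \<in> supported_on (exponents_bounded K)"
    unfolding f_def
  proof (rule supported_on_sum)
    fix ms assume ms: "ms \<in> T"
    have "list_monomial y ms \<in> supported_on (exponents_bounded K)"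
      using exponents_bounded_list_monomial[of ms y D N] yD ms by (auto simp: T_def K_def)
    then show "Const (c ms) * list_monomial y ms \<in> supported_on (exponents_bounded K)"
      by (auto simp: supported_on_def in_keys_iff lookup_Const)
  qed
  moreover have "Poly_Mapping.lookup f m = 0" if "m \<in> B" for m
    using c(2)[OF that] by (simp add: f_def lookup_sum lookup_Const)
  ultimately have "f \<in> variable_ideal A"
    by (auto simp: variable_ideal_def supported_on_def B_def in_keys_iff)
  moreover have "variable_ideal A \<subseteq> P 0"
    using prime[of 0] by (intro variable_ideal_subset) (auto simp: A_def primeideal_poly_ring_iff)
  moreover have "f \<notin> P 0"
  proof -
    define S where "S = {ms \<in> T. c ms \<noteq> 0}"
    have "f = (\<Sum>ms\<in>S. Const (c ms) * list_monomial y ms)"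
      unfolding f_def S_def using T(1) by (intro sum.mono_neutral_right) (auto simp: Const_def)
    also have "\<dots> \<notin> P 0"
    proof (rule chain_monomials_independent[of r])
      show "finite S" "S \<noteq> {}" using T(1) c(1) by (auto simp: S_def)
    qed (use prime chain y in \<open>auto simp: S_def T_def\<close>)
    finally show ?thesis .
  qed
  ultimately show False by blast
qed

text \<open>The upper bound is \<open>prime_chain_length\<close> applied to preimages in the polynomial ring; the lower bound is
the chain of monomial primes that starts at \<open>variable_ideal A\<close> and adds one variable at a time.\<close>

lemma krull_dim_quotient_eq:
  fixes J :: "('v::finite, 'k::field) mpoly set"
  assumes J: "ideal J poly_ring" and JA: "J \<subseteq> variable_ideal A"
    and primes: "\<And>P. primeideal P poly_ring \<Longrightarrow> J \<subseteq> P \<Longrightarrow> card A \<le> card {v. Var v \<in> P}"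
  shows "krull_dim (poly_ring Quot J) = enat (card (- A))"
proof (rule antisym)
  interpret R: cring "poly_ring :: ('v, 'k) mpoly ring" by (rule poly_ring_cring)
  define q where "q = (\<lambda>f. J +>\<^bsub>poly_ring\<^esub> f)"
  have hom: "ring_hom_ring poly_ring (poly_ring Quot J) q"
    unfolding q_def by (rule ideal.rcos_ring_hom_ring[OF J])
  have carrier: "carrier (poly_ring Quot J) = range q"
    by (auto simp: FactRing_def A_RCOSETS_def' q_def poly_ring_simps)
  have card_Compl: "card (- S) = card (UNIV :: 'v set) - card S" for S :: "'v set"
    by (simp add: Compl_eq_Diff_UNIV card_Diff_subset)
  have q_mult: "q f \<otimes>\<^bsub>poly_ring Quot J\<^esub> q g = q (f * g)" for f g
    using ring_hom_mult[OF ideal.rcos_ring_hom[OF J], of f g] by (simp add: q_def poly_ring_simps)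
  show "krull_dim (poly_ring Quot J) \<le> enat (card (- A))"
    unfolding krull_dim_def
  proof (rule Sup_least)
    fix x assume "x \<in> {enat n | n. \<exists>P. (\<forall>i\<le>n. primeideal (P i) (poly_ring Quot J)) \<and> (\<forall>i<n. P i \<subset> P (Suc i))}"
    then obtain n P where x: "x = enat n" and P: "\<And>i. i \<le> n \<Longrightarrow> primeideal (P i) (poly_ring Quot J)"
      "\<And>i. i < n \<Longrightarrow> P i \<subset> P (Suc i)" by blast
    define Q where "Q = (\<lambda>i. {f. q f \<in> P i})"
    have Q: "primeideal (Q i) poly_ring" if "i \<le> n" for i
      using ring_hom_ring.primeideal_vimage[OF hom R.cring_axioms P(1)[OF that]]
      by (simp add: Q_def poly_ring_simps)
    have "Q i \<subset> Q (Suc i)" if i: "i < n" for i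
    proof -
      obtain u where u: "u \<in> P (Suc i)" "u \<notin> P i" using P(2)[OF i] by blast
      moreover have "P (Suc i) \<subseteq> carrier (poly_ring Quot J)"
        using P(1)[of "Suc i"] i ideal.Icarr[OF primeideal.axioms(1)] by fastforce
      ultimately obtain f where "u = q f" using carrier by blast
      then show ?thesis using u P(2)[OF i] by (auto simp: Q_def)
    qed
    then have "n \<le> card {v. Var v \<notin> Q 0}" using prime_chain_length[of n Q] Q by simp
    also have "{v. Var v \<notin> Q 0} = - {v. Var v \<in> Q 0}" by blast
    also have "card \<dots> = card (UNIV :: 'v set) - card {v. Var v \<in> Q 0}" by (simp add: card_Compl)
    also have "\<dots> \<le> card (UNIV :: 'v set) - card A"
    proof -
      have "f \<in> Q 0" if "f \<in> J" for f
      proof -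
        have "q f = q 0" using quotient_coset_eq_iff[OF J, of f 0] that by (simp add: q_def)
        then have "q f = \<zero>\<^bsub>poly_ring Quot J\<^esub>" by (simp add: q_def quotient_coset_0[OF J] quotient_zero)
        then show ?thesis
          using additive_subgroup.zero_closed[OF ideal.axioms(1)[OF primeideal.axioms(1)[OF P(1)]], of 0]
          by (simp add: Q_def)
      qed
      then have "card A \<le> card {v. Var v \<in> Q 0}" by (intro primes Q) auto
      then show ?thesis by simp
    qed
    finally show "x \<le> enat (card (- A))" by (simp add: x card_Compl)
  qed
  show "enat (card (- A)) \<le> krull_dim (poly_ring Quot J)"
    unfolding krull_dim_def
  proof (rule Sup_upper)
    define n where "n = card (- A)"
    obtain e where e: "bij_betw e {..<n} (- A)"
      using ex_bij_betw_nat_finite[of "- A"] by (auto simp: n_def atLeast0LessThan)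
    define V where "V = (\<lambda>i. variable_ideal (A \<union> e ` {..<i}) :: ('v, 'k) mpoly set)"
    have JV: "J \<subseteq> V i" for i
      using JA by (rule subset_trans) (auto simp: V_def variable_ideal_def supported_on_def)
    have mem: "q f \<in> q ` V i \<longleftrightarrow> f \<in> V i" for f i
    proof
      assume "q f \<in> q ` V i"
      then obtain g where g: "g \<in> V i" "f - g \<in> J"
        by (auto simp: q_def quotient_coset_eq_iff[OF J])
      then have "(f - g) + g \<in> V i"
        using JV variable_ideal_ideal[of "A \<union> e ` {..<i}"] unfolding V_def ideal_poly_ring_iff by blast
      then show "f \<in> V i" by simp
    qed simp
    have prime: "primeideal (V i) poly_ring" for i unfolding V_def by (rule variable_ideal_prime)
    have "primeideal (q ` V i) (poly_ring Quot J)" for i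
    proof (rule primeidealI)
      show "ideal (q ` V i) (poly_ring Quot J)"
        unfolding q_def by (rule R.ring_ideal_imp_quot_ideal[OF J primeideal.axioms(1)[OF prime]])
      show "cring (poly_ring Quot J)" by (rule ideal.quotient_is_cring[OF J R.cring_axioms])
      have "1 \<notin> V i" using prime by (simp add: primeideal_poly_ring_iff)
      then have "q 1 \<notin> q ` V i" by (simp only: mem not_False_eq_True)
      moreover have "q 1 \<in> carrier (poly_ring Quot J)" unfolding carrier by (rule rangeI)
      ultimately show "carrier (poly_ring Quot J) \<noteq> q ` V i" by metis
      fix a b assume "a \<in> carrier (poly_ring Quot J)" "b \<in> carrier (poly_ring Quot J)"
        and ab: "a \<otimes>\<^bsub>poly_ring Quot J\<^esub> b \<in> q ` V i"
      then obtain f g where "a = q f" "b = q g" unfolding carrier by auto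
      then show "a \<in> q ` V i \<or> b \<in> q ` V i"
        using ab prime[of i] by (simp add: q_mult mem primeideal_poly_ring_iff)
    qed
    moreover have "q ` V i \<subset> q ` V (Suc i)" if "i < n" for i
    proof
      show "q ` V i \<subseteq> q ` V (Suc i)"
        unfolding V_def by (intro image_mono variable_ideal_mono) (auto simp: less_Suc_eq)
      have "e i \<notin> A \<union> e ` {..<i}" 
      proof -
        have "e i \<in> - A" using bij_betw_apply[OF e, of i] that by simp
        moreover have "e i \<noteq> e j" if "j < i" for j
          using inj_onD[OF bij_betw_imp_inj_on[OF e], of i j] that \<open>i < n\<close> by auto
        ultimately show ?thesis by auto
      qed
      then have "Var (e i) \<in> V (Suc i)" "Var (e i) \<notin> V i"
        unfolding V_def Var_in_variable_ideal_iff by auto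
      then have "q (Var (e i)) \<in> q ` V (Suc i)" "q (Var (e i)) \<notin> q ` V i"
        by (simp_all only: mem not_False_eq_True)
      then show "q ` V i \<noteq> q ` V (Suc i)" by metis
    qed
    ultimately show "enat (card (- A)) \<in> {enat n | n. \<exists>P.
        (\<forall>i\<le>n. primeideal (P i) (poly_ring Quot J)) \<and> (\<forall>i<n. P i \<subset> P (Suc i))}"
      unfolding n_def[symmetric]
      by (intro CollectI exI[of _ n] exI[of _ "\<lambda>i. q ` V i"] conjI allI impI refl)
  qed
qed

section \<open>Squarefree monomials\<close>

definition set_exponent :: "'v set \<Rightarrow> ('v \<Rightarrow>\<^sub>0 nat)" where
  "set_exponent W = (\<Sum>v\<in>W. Poly_Mapping.single v 1)"

lemma lookup_set_exponent: "Poly_Mapping.lookup (set_exponent W) v = (if v \<in> W then 1 else 0)"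
  for W :: "'v::finite set"
  by (simp add: set_exponent_def lookup_sum lookup_single when_def)

lemma keys_set_exponent [simp]: "Poly_Mapping.keys (set_exponent W) = (W :: 'v::finite set)"
  by (auto simp: in_keys_iff lookup_set_exponent split: if_split_asm)

lemma total_degree_set_exponent [simp]: "total_degree (set_exponent W) = card (W :: 'v::finite set)"
  by (simp add: total_degree_def lookup_set_exponent sum.If_cases)

lemma set_exponent_divides_iff:
  "(\<exists>b. m = set_exponent W + b) \<longleftrightarrow> W \<subseteq> Poly_Mapping.keys (m :: 'v::finite \<Rightarrow>\<^sub>0 nat)"
proof
  assume W: "W \<subseteq> Poly_Mapping.keys m"
  have "m = set_exponent W + (m - set_exponent W)"
    using W by (intro poly_mapping_eqI) (auto simp: lookup_add lookup_minus lookup_set_exponent in_keys_iff)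
  then show "\<exists>b. m = set_exponent W + b" ..
qed (auto simp: keys_add_nat)

text \<open>Translates the generators in the definition of the cover ideal into single monomials.\<close>

lemma prod_Var: "(\<Prod>v\<in>W. Var v :: ('v::finite, 'k::field) mpoly) = Poly_Mapping.single (set_exponent W) 1"
proof -
  have "finite W" by simp
  then show ?thesis
    by (induction W rule: finite_induct) (simp_all add: set_exponent_def Var_def mult_single)
qed

lemma genideal_squarefree:
  "Idl\<^bsub>poly_ring\<^esub> ((\<lambda>W. Poly_Mapping.single (set_exponent W) 1) ` F) =
     (supported_on {m. \<exists>W\<in>F. W \<subseteq> Poly_Mapping.keys m} :: ('v::finite, 'k::field) mpoly set)"
proof -
  have "Idl\<^bsub>poly_ring\<^esub> ((\<lambda>m. Poly_Mapping.single m 1) ` (set_exponent ` F)) =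
     (supported_on {a + b | a b. a \<in> set_exponent ` F} :: ('v, 'k) mpoly set)"
    by (rule genideal_monomials)
  moreover have "{a + b | a b. a \<in> set_exponent ` F} = {m. \<exists>W\<in>F. W \<subseteq> Poly_Mapping.keys m}"
    by (auto simp flip: set_exponent_divides_iff)
  ultimately show ?thesis by (simp add: image_image)
qed

lemma prime_contains_squarefree:
  assumes P: "primeideal P (poly_ring :: ('v::finite, 'k::field) mpoly ring)"
    and W: "Poly_Mapping.single (set_exponent W) 1 \<in> P"
  shows "\<exists>v\<in>W. Var v \<in> P"
proof -
  have "finite W" by simp
  moreover have "(\<Prod>v\<in>W. Var v) \<in> P" using W by (simp add: prod_Var)
  ultimately show ?thesis
    using P by (induction W rule: finite_induct) (auto simp: primeideal_poly_ring_iff)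
qed

lemma lookup_single_mult:
  fixes f :: "('v::finite, 'k::field) mpoly"
  shows "Poly_Mapping.lookup (Poly_Mapping.single m 1 * f) (m + k) = Poly_Mapping.lookup f k"
proof -
  have "Poly_Mapping.lookup (Poly_Mapping.single m 1 * f) (m + k) =
      (\<Sum>p\<in>{m} \<times> Poly_Mapping.keys f. if p = (m, k) then Poly_Mapping.lookup f k else 0)"
    unfolding lookup_mult_keys by (rule sum.cong) (auto split: if_split_asm)
  also have "\<dots> = Poly_Mapping.lookup f k" by (simp add: sum.delta' in_keys_iff)
  finally show ?thesis .
qed

lemma single_mult_eq_0_iff:
  fixes f :: "('v::finite, 'k::field) mpoly"
  shows "Poly_Mapping.single m 1 * f = 0 \<longleftrightarrow> f = 0"
proof
  assume 0: "Poly_Mapping.single m 1 * f = 0"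
  show "f = 0"
    by (rule poly_mapping_eqI) (metis 0 lookup_single_mult lookup_zero)
qed simp

lemma variable_ideal_cancel_monomial:
  fixes f :: "('v::finite, 'k::field) mpoly"
  assumes "Poly_Mapping.single m 1 * f \<in> variable_ideal {v}" "v \<notin> Poly_Mapping.keys m"
  shows "f \<in> variable_ideal {v}"
proof -
  have "v \<in> Poly_Mapping.keys k" if "k \<in> Poly_Mapping.keys f" for k
  proof -
    have "m + k \<in> Poly_Mapping.keys (Poly_Mapping.single m 1 * f)"
      using that by (simp add: in_keys_iff lookup_single_mult)
    then have "v \<in> Poly_Mapping.keys (m + k)"
      using assms(1) by (auto simp: variable_ideal_def supported_on_def)
    then show ?thesis using assms(2) by (simp add: keys_add_nat)
  qed
  then show ?thesis by (auto simp: variable_ideal_def supported_on_def)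
qed

text \<open>Together with \<open>variable_ideal_cancel_monomial\<close> this is the divisibility theory needed for the
syzygies: a variable dividing a product with a monomial coprime to it divides the other factor.\<close>

lemma Var_divides:
  fixes f :: "('v::finite, 'k::field) mpoly"
  assumes "f \<in> variable_ideal {v}" shows "\<exists>h. f = Var v * h"
proof -
  define h where "h = (\<Sum>m\<in>Poly_Mapping.keys f.
    Poly_Mapping.single (m - Poly_Mapping.single v 1) (Poly_Mapping.lookup f m))"
  have "Var v * h = (\<Sum>m\<in>Poly_Mapping.keys f. Poly_Mapping.single m (Poly_Mapping.lookup f m))"
    unfolding h_def sum_distrib_left
  proof (rule sum.cong)
    fix m assume "m \<in> Poly_Mapping.keys f"
    then have "v \<in> Poly_Mapping.keys m" using assms by (auto simp: variable_ideal_def supported_on_def)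
    then have "Poly_Mapping.single v 1 + (m - Poly_Mapping.single v 1) = m"
      by (intro poly_mapping_eqI) (auto simp: lookup_add lookup_minus lookup_single when_def in_keys_iff)
    then show "Var v * Poly_Mapping.single (m - Poly_Mapping.single v 1) (Poly_Mapping.lookup f m) =
        Poly_Mapping.single m (Poly_Mapping.lookup f m)"
      by (simp add: Var_def mult_single)
  qed simp
  then show ?thesis by (metis poly_mapping_sum_single)
qed

section \<open>The monomial ideal of a clique with attached neighbour sets\<close>

text \<open>The combinatorial core of a split graph: \<open>cs\<close> lists the vertices of the clique, and \<open>N c\<close> is the set of
neighbours of \<open>c\<close> in the independent part. The minimal vertex covers are then the clique and the sets
\<open>cover c\<close> below; see \<open>split_minimal_vertex_covers\<close>. Requiring each \<open>N c\<close> to be nonempty makes the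
clique itself a minimal cover.\<close>

locale split_cover =
  fixes cs :: "'v::finite list" and N :: "'v \<Rightarrow> 'v set"
  assumes distinct: "distinct cs" and nonempty: "cs \<noteq> []"
    and N_disjoint: "c \<in> set cs \<Longrightarrow> N c \<inter> set cs = {}"
    and N_nonempty: "c \<in> set cs \<Longrightarrow> N c \<noteq> {}"
begin

definition cover :: "'v \<Rightarrow> 'v set" where "cover c = (set cs - {c}) \<union> N c"

definition covers :: "'v set set" where "covers = insert (set cs) (cover ` set cs)"

definition cover_monomials :: "('v \<Rightarrow>\<^sub>0 nat) set" where
  "cover_monomials = {m. \<exists>W\<in>covers. W \<subseteq> Poly_Mapping.keys m}"

definition J :: "('v, 'k::field) mpoly set" where "J = supported_on cover_monomials"

lemma J_ideal: "ideal (J :: ('v, 'k::field) mpoly set) poly_ring"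
  unfolding J_def cover_monomials_def by (rule supported_on_ideal) (auto simp: keys_add_nat)

lemma J_homogeneous: "f \<in> J \<Longrightarrow> homogeneous_component d f \<in> J"
  by (auto simp: J_def supported_on_def in_keys_iff lookup_homogeneous_component when_def split: if_splits)

lemma card_cover: "c \<in> set cs \<Longrightarrow> card (cover c) = length cs - 1 + card (N c)"
  using N_disjoint[of c] distinct unfolding cover_def
  by (subst card_Un_disjoint) (auto simp: distinct_card)

lemma notin_cover: "c \<in> set cs \<Longrightarrow> c \<notin> cover c"
  using N_disjoint[of c] by (auto simp: cover_def)

lemma cover_nonempty: "W \<in> covers \<Longrightarrow> W \<noteq> {}"
  using nonempty N_nonempty by (auto simp: covers_def cover_def)

text \<open>The ideal has height 2. For an edge between \<open>c\<close> and \<open>u \<in> N c\<close> it lies in the prime generated by these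
two variables. Conversely a prime above it contains a variable \<open>v\<close> of the clique, and then also one
from \<open>cover v\<close>, which does not contain \<open>v\<close>.\<close>

lemma krull_dim_J:
  "krull_dim (poly_ring Quot (J :: ('v, 'k::field) mpoly set)) = enat (card (UNIV :: 'v set) - 2)"
  and card_UNIV_ge_2: "card (UNIV :: 'v set) \<ge> 2"
proof -
  obtain c where c: "c \<in> set cs" using nonempty by (cases cs) auto
  obtain u where u: "u \<in> N c" using N_nonempty[OF c] by blast
  have "u \<noteq> c" using u c N_disjoint[OF c] by blast
  then have cu: "card {c, u} = 2" by simp
  have "W \<inter> {c, u} \<noteq> {}" if "W \<in> covers" for W
  proof (cases "W = cover c")
    case True
    then show ?thesis using u by (auto simp: cover_def)
  next
    case False
    then have "c \<in> W" using that c by (auto simp: covers_def cover_def)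
    then show ?thesis by blast
  qed
  then have J: "(J :: ('v, 'k) mpoly set) \<subseteq> variable_ideal {c, u}"
    unfolding J_def variable_ideal_def supported_on_def cover_monomials_def by blast
  have "2 \<le> card {v. Var v \<in> P}"
    if P: "primeideal P poly_ring" and JP: "J \<subseteq> P" for P :: "('v, 'k) mpoly set"
  proof -
    have meet: "\<exists>v\<in>W. Var v \<in> P" if "W \<in> covers" for W
    proof (rule prime_contains_squarefree[OF P])
      have "Poly_Mapping.single (set_exponent W) 1 \<in> (J :: ('v, 'k) mpoly set)"
        using that by (auto simp: J_def cover_monomials_def)
      then show "Poly_Mapping.single (set_exponent W) 1 \<in> P" using JP by blast
    qed
    obtain v where v: "v \<in> set cs" "Var v \<in> P" using meet[of "set cs"] by (auto simp: covers_def)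
    obtain w where w: "w \<in> cover v" "Var w \<in> P" using meet[of "cover v"] v by (auto simp: covers_def)
    have "v \<noteq> w" using w v notin_cover by blast
    then have "card {v, w} = 2" by simp
    moreover have "card {v, w} \<le> card {v. Var v \<in> P}" using v w by (intro card_mono) auto
    ultimately show ?thesis by simp
  qed
  then have "krull_dim (poly_ring Quot (J :: ('v, 'k) mpoly set)) = enat (card (- {c, u}))"
    by (intro krull_dim_quotient_eq[OF J_ideal J]) (simp add: cu)
  also have "card (- {c, u}) = card (UNIV :: 'v set) - 2"
    unfolding Compl_eq_Diff_UNIV by (subst card_Diff_subset) (simp_all add: cu)
  finally show "krull_dim (poly_ring Quot (J :: ('v, 'k) mpoly set)) = enat (card (UNIV :: 'v set) - 2)" .
  show "card (UNIV :: 'v set) \<ge> 2" using card_mono[of UNIV "{c, u}"] cu by simp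
qed

text \<open>The monomials of the ideal are sorted by their intersection with the clique: either they involve the
whole clique, or exactly one clique vertex \<open>c\<close> is missing and they are multiples of the monomial of
\<open>cover c\<close> in the variables other than \<open>c\<close>.\<close>

lemma hilbert_series_J:
  "hilbert_series (J :: ('v, 'k::field) mpoly set) * (1 - fps_X) ^ card (UNIV :: 'v set) =
     1 - fps_X ^ length cs - (1 - fps_X) * (\<Sum>c\<in>set cs. fps_X ^ (length cs - 1 + card (N c)))"
proof -
  let ?n = "card (UNIV :: 'v set)"
  define U where "U = (\<lambda>c. {m :: 'v \<Rightarrow>\<^sub>0 nat. cover c \<subseteq> Poly_Mapping.keys m \<and> c \<notin> Poly_Mapping.keys m})"
  define T where "T = {m :: 'v \<Rightarrow>\<^sub>0 nat. set cs \<subseteq> Poly_Mapping.keys m}"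
  have all: "monomial_series (UNIV :: ('v \<Rightarrow>\<^sub>0 nat) set) * (1 - fps_X) ^ ?n = 1"
    using monomial_series_avoiding[of "{} :: 'v set"] by simp
  have "T = (+) (set_exponent (set cs)) ` UNIV"
    unfolding T_def set_exponent_divides_iff[symmetric] by auto
  then have T: "monomial_series T * (1 - fps_X) ^ ?n = fps_X ^ length cs"
    using all distinct by (simp add: monomial_series_shift mult.assoc distinct_card)
  have U: "monomial_series (U c) * (1 - fps_X) ^ ?n = fps_X ^ (length cs - 1 + card (N c)) * (1 - fps_X)"
    if c: "c \<in> set cs" for c
  proof -
    have "U c = (+) (set_exponent (cover c)) ` {m. Poly_Mapping.keys m \<inter> {c} = {}}"
    proof
      show "U c \<subseteq> (+) (set_exponent (cover c)) ` {m. Poly_Mapping.keys m \<inter> {c} = {}}"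
      proof
        fix m assume m: "m \<in> U c"
        then obtain b where b: "m = set_exponent (cover c) + b"
          unfolding U_def set_exponent_divides_iff[symmetric] by blast
        then have "c \<notin> Poly_Mapping.keys b" using m by (simp add: U_def keys_add_nat)
        then show "m \<in> (+) (set_exponent (cover c)) ` {m. Poly_Mapping.keys m \<inter> {c} = {}}"
          using b by blast
      qed
    qed (use notin_cover[OF c] in \<open>auto simp: U_def keys_add_nat\<close>)
    then have series: "monomial_series (U c) = fps_X ^ (length cs - 1 + card (N c)) *
        monomial_series {m :: 'v \<Rightarrow>\<^sub>0 nat. Poly_Mapping.keys m \<inter> {c} = {}}"
      by (simp only: monomial_series_shift total_degree_set_exponent card_cover[OF c])
    have n: "?n = Suc (card (- {c}))"
      by (simp add: Compl_eq_Diff_UNIV card_Diff_subset card_gt_0_iff Suc_diff_Suc flip: Suc_pred)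
    have "monomial_series (U c) * (1 - fps_X) ^ ?n = fps_X ^ (length cs - 1 + card (N c)) *
        (monomial_series {m :: 'v \<Rightarrow>\<^sub>0 nat. Poly_Mapping.keys m \<inter> {c} = {}} * (1 - fps_X) ^ card (- {c})) *
        (1 - fps_X)"
      by (simp only: series n power_Suc2 mult.assoc)
    then show ?thesis by (simp only: monomial_series_avoiding mult_1_right)
  qed
  have disj: "U c \<inter> U d = {}" if "c \<in> set cs" "d \<in> set cs" "c \<noteq> d" for c d
    using that by (auto simp: U_def cover_def)
  have sum: "monomial_series (\<Union>c\<in>F. U c) = (\<Sum>c\<in>F. monomial_series (U c))"
    if "F \<subseteq> set cs" for F
  proof -
    have "finite F" using that finite_subset by blast
    then show ?thesis using that
    proof (induction F rule: finite_induct)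
      case empty
      show ?case by (simp add: monomial_series_def fps_ext)
    next
      case (insert c F)
      have "U c \<inter> (\<Union>c\<in>F. U c) = {}" using disj insert.prems insert.hyps by blast
      then show ?case using insert by (simp add: monomial_series_disjoint_union)
    qed
  qed
  have "cover_monomials = T \<union> (\<Union>c\<in>set cs. U c)"
  proof
    show "cover_monomials \<subseteq> T \<union> (\<Union>c\<in>set cs. U c)"
    proof
      fix m assume "m \<in> cover_monomials"
      then consider "set cs \<subseteq> Poly_Mapping.keys m"
        | c where "c \<in> set cs" "cover c \<subseteq> Poly_Mapping.keys m"
        by (auto simp: cover_monomials_def covers_def)
      then show "m \<in> T \<union> (\<Union>c\<in>set cs. U c)"
      proof cases
        case 2
        then show ?thesis
          by (cases "c \<in> Poly_Mapping.keys m") (auto simp: T_def U_def cover_def)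
      qed (simp add: T_def)
    qed
    show "T \<union> (\<Union>c\<in>set cs. U c) \<subseteq> cover_monomials"
      by (auto simp: T_def U_def cover_monomials_def covers_def)
  qed
  moreover have "T \<inter> (\<Union>c\<in>set cs. U c) = {}" by (auto simp: T_def U_def)
  ultimately have "monomial_series cover_monomials = monomial_series T + (\<Sum>c\<in>set cs. monomial_series (U c))"
    using sum[of "set cs"] by (simp add: monomial_series_disjoint_union)
  then have "monomial_series cover_monomials * (1 - fps_X) ^ ?n =
      fps_X ^ length cs + (\<Sum>c\<in>set cs. fps_X ^ (length cs - 1 + card (N c)) * (1 - fps_X))"
    by (simp add: distrib_right T sum_distrib_right U)
  moreover have "monomial_series (UNIV :: ('v \<Rightarrow>\<^sub>0 nat) set) =
      monomial_series (- cover_monomials) + monomial_series cover_monomials"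
    using monomial_series_disjoint_union[of "- cover_monomials" cover_monomials] by simp
  then have "monomial_series (- cover_monomials) * (1 - fps_X) ^ ?n =
      1 - monomial_series cover_monomials * (1 - fps_X) ^ ?n"
    using all by (simp add: algebra_simps)
  moreover have "hilbert_series (J :: ('v, 'k) mpoly set) = monomial_series (- cover_monomials)"
    unfolding J_def
  proof (rule hilbert_series_supported_on)
    show "ideal (supported_on cover_monomials :: ('v, 'k) mpoly set) poly_ring"
      using J_ideal unfolding J_def .
    show "0 \<notin> cover_monomials" using cover_nonempty by (auto simp: cover_monomials_def)
  qed
  ultimately show ?thesis by (simp add: sum_distrib_left mult.commute)
qed

definition max_N :: nat where "max_N = Max ((\<lambda>c. card (N c)) ` set cs)"

lemma max_N: "c \<in> set cs \<Longrightarrow> card (N c) \<le> max_N" "\<exists>c\<in>set cs. card (N c) = max_N" "1 \<le> max_N"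
proof -
  have fin: "finite ((\<lambda>c. card (N c)) ` set cs)" "(\<lambda>c. card (N c)) ` set cs \<noteq> {}"
    using nonempty by auto
  show le: "card (N c) \<le> max_N" if "c \<in> set cs" for c
    unfolding max_N_def by (rule Max_ge[OF fin(1)]) (use that in blast)
  have "max_N \<in> (\<lambda>c. card (N c)) ` set cs" unfolding max_N_def by (rule Max_in[OF fin])
  then show ex: "\<exists>c\<in>set cs. card (N c) = max_N" by force
  then obtain c where c: "c \<in> set cs" "card (N c) = max_N" by blast
  have "card (N c) > 0" using N_nonempty[OF c(1)] by (simp add: card_gt_0_iff)
  then show "1 \<le> max_N" using c by simp
qed

text \<open>Write \<open>r\<close> for the number of clique vertices. The numerator
\<open>1 - x^r - (1 - x) * (\<Sum>c. x^(r - 1 + card (N c)))\<close> over \<open>(1 - x)^n\<close> is divisible by \<open>(1 - x)^2\<close>, and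
the quotient is the \<open>h\<close>-polynomial since the dimension is \<open>n - 2\<close>. The top coefficient of the numerator,
in degree \<open>r + max_N\<close>, counts the vertices with a largest neighbour set, so it does not vanish.\<close>

lemma degree_h_polynomial_J:
  "Polynomial.degree (h_polynomial (J :: ('v, 'k::field) mpoly set)) = length cs + max_N - 2"
proof -
  let ?n = "card (UNIV :: 'v set)" and ?r = "length cs"
  define x where "x = (Polynomial.monom 1 1 :: int poly)"
  define num where "num = 1 - x ^ ?r - (1 - x) * (\<Sum>c\<in>set cs. x ^ (?r - 1 + card (N c)))"
  have x_pow: "x ^ k = Polynomial.monom 1 k" for k by (simp add: x_def monom_power)
  have x_fps: "fps_of_poly x = fps_X" by (simp add: x_def fps_of_poly_monom')
  define geo where "geo = (\<lambda>k. \<Sum>i<k. x ^ i)"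
  have geo: "1 - x ^ k = (1 - x) * geo k" for k
    unfolding geo_def by (rule one_diff_power_eq)
  \<comment> \<open>pairs the term \<open>x ^ i\<close> of \<open>1 + x + \<dots> + x ^ (r - 1)\<close> with the summand of the vertex \<open>cs ! i\<close>\<close>
  define h where "h = (\<Sum>i<?r. x ^ i * geo (?r - 1 + card (N (cs ! i)) - i))"
  have num: "num = h * (1 - x) ^ 2"
  proof -
    have "(\<Sum>c\<in>set cs. x ^ (?r - 1 + card (N c))) = (\<Sum>i<?r. x ^ (?r - 1 + card (N (cs ! i))))"
      using sum.reindex_bij_betw[OF bij_betw_nth[OF distinct refl refl], of "\<lambda>c. x ^ (?r - 1 + card (N c))"]
      by simp
    then have "num = (1 - x) * (\<Sum>i<?r. x ^ i - x ^ (?r - 1 + card (N (cs ! i))))"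
      by (simp add: num_def geo geo_def right_diff_distrib sum_subtractf)
    also have "(\<Sum>i<?r. x ^ i - x ^ (?r - 1 + card (N (cs ! i)))) = (1 - x) * h"
      unfolding h_def sum_distrib_left
    proof (rule sum.cong)
      fix i assume "i \<in> {..<?r}"
      then have "x ^ (?r - 1 + card (N (cs ! i))) = x ^ i * x ^ (?r - 1 + card (N (cs ! i)) - i)"
        by (simp flip: power_add)
      then have "x ^ i - x ^ (?r - 1 + card (N (cs ! i))) = x ^ i * (1 - x ^ (?r - 1 + card (N (cs ! i)) - i))"
        by (simp add: right_diff_distrib)
      then show "x ^ i - x ^ (?r - 1 + card (N (cs ! i))) =
          (1 - x) * (x ^ i * geo (?r - 1 + card (N (cs ! i)) - i))"
        by (simp add: geo algebra_simps)
    qed simp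
    finally show ?thesis by (simp add: power2_eq_square algebra_simps)
  qed
  have fps: "hilbert_series (J :: ('v, 'k) mpoly set) * (1 - fps_X) ^ (?n - 2) = fps_of_poly h"
  proof -
    have "hilbert_series (J :: ('v, 'k) mpoly set) * (1 - fps_X) ^ ?n = fps_of_poly num"
      unfolding hilbert_series_J num_def
      by (simp add: fps_of_poly_diff fps_of_poly_mult fps_of_poly_sum fps_of_poly_power x_fps)
    also have "\<dots> = fps_of_poly h * (1 - fps_X) ^ 2"
      unfolding num by (simp add: fps_of_poly_mult fps_of_poly_power fps_of_poly_diff x_fps)
    also have "(1 - fps_X :: int fps) ^ ?n = (1 - fps_X) ^ (?n - 2) * (1 - fps_X) ^ 2"
      by (metis card_UNIV_ge_2 le_add_diff_inverse2 power_add)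
    finally have "(hilbert_series (J :: ('v, 'k) mpoly set) * (1 - fps_X) ^ (?n - 2)) * (1 - fps_X) ^ 2
        = fps_of_poly h * (1 - fps_X) ^ 2" by (simp add: mult.assoc)
    moreover have "(1 - fps_X :: int fps) ^ 2 \<noteq> 0"
    proof -
      have "fps_nth (1 - fps_X :: int fps) 0 \<noteq> 0" by simp
      then have "(1 - fps_X :: int fps) \<noteq> 0" by (metis fps_zero_nth)
      then show ?thesis by simp
    qed
    ultimately show ?thesis by simp
  qed
  have h: "h_polynomial (J :: ('v, 'k) mpoly set) = h"
    unfolding h_polynomial_def krull_dim_J the_enat.simps
    by (rule the_equality) (simp_all add: fps fps_of_poly_eq_iff)
  have deg: "Polynomial.degree num = ?r + max_N"
  proof (rule antisym)
    obtain c where c: "c \<in> set cs" "card (N c) = max_N" using max_N(2) by blast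
    have num_eq: "num = Polynomial.monom 1 0 - Polynomial.monom 1 ?r - (\<Sum>c\<in>set cs. Polynomial.monom 1 (?r - 1 + card (N c)))
        + (\<Sum>c\<in>set cs. Polynomial.monom 1 (?r + card (N c)))"
    proof -
      have "x * x ^ (?r - 1 + k) = x ^ (?r + k)" for k
      proof -
        have "Suc (?r - 1 + k) = ?r + k" using nonempty by (cases cs) auto
        then show ?thesis by (simp only: power_Suc[symmetric])
      qed
      then show ?thesis
        by (simp add: num_def left_diff_distrib sum_distrib_left sum_subtractf flip: x_pow)
    qed
    have r: "0 < ?r" using nonempty by simp
    have coeff: "coeff num k = (if 0 = k then 1 else 0) - (if ?r = k then 1 else 0)
        - (\<Sum>c\<in>set cs. if ?r - 1 + card (N c) = k then 1 else 0)
        + (\<Sum>c\<in>set cs. if ?r + card (N c) = k then 1 else 0)" for k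
      unfolding num_eq by (simp only: coeff_add coeff_diff coeff_sum coeff_monom)
    show "Polynomial.degree num \<le> ?r + max_N"
    proof (rule degree_le, intro allI impI)
      fix k assume k: "?r + max_N < k"
      have "?r - 1 + card (N c) \<noteq> k" "?r + card (N c) \<noteq> k" if "c \<in> set cs" for c
        using max_N(1)[OF that] k by auto
      then show "coeff num k = 0" using k unfolding coeff by simp
    qed
    show "?r + max_N \<le> Polynomial.degree num"
    proof (rule le_degree)
      have "?r - 1 + card (N c) \<noteq> ?r + max_N" if "c \<in> set cs" for c
        using max_N(1)[OF that] r by linarith
      then have mid: "(\<Sum>c\<in>set cs. if ?r - 1 + card (N c) = ?r + max_N then 1 else 0 :: int) = 0"
        by (intro sum.neutral) simp
      have "coeff num (?r + max_N) = (\<Sum>c\<in>set cs. if ?r + card (N c) = ?r + max_N then 1 else 0)"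
        unfolding coeff mid using r max_N(3) by simp
      also have "\<dots> \<ge> (if ?r + card (N c) = ?r + max_N then 1 else 0 :: int)"
        by (rule member_le_sum) (use c in auto)
      finally show "coeff num (?r + max_N) \<noteq> 0" using c by simp
    qed
  qed
  have "num \<noteq> 0" using deg max_N(3) by auto
  then have "h \<noteq> 0" and x1: "(1 - x) \<noteq> 0" using num by auto
  moreover have "Polynomial.degree (1 - x) = 1"
  proof -
    have "1 - x = [:1, - 1:]" by (simp add: x_def monom_Suc one_pCons)
    then show ?thesis by simp
  qed
  ultimately have "Polynomial.degree num = Polynomial.degree h + 2"
    unfolding num by (simp add: degree_mult_eq degree_power_eq)
  then show ?thesis using deg unfolding h by simp
qed

section \<open>The Hilbert-Burch resolution\<close>

text \<open>The generator with index \<open>0\<close> is the monomial of the clique, the one with index \<open>Suc l\<close> belongs to the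
cover that omits the clique vertex \<open>cs ! l\<close>.\<close>

definition gen :: "nat \<Rightarrow> ('v, 'k::field) mpoly" where
  "gen k = Poly_Mapping.single (set_exponent (case k of 0 \<Rightarrow> set cs | Suc l \<Rightarrow> cover (cs ! l))) 1"

definition degrees :: "nat \<Rightarrow> int list" where
  "degrees i = (if i = 0 then [0]
     else if i = 1 then map (\<lambda>k. int (case k of 0 \<Rightarrow> length cs | Suc l \<Rightarrow> card (cover (cs ! l)))) [0..<Suc (length cs)]
     else if i = 2 then map (\<lambda>c. int (length cs + card (N c))) cs
     else [])"

text \<open>The syzygies say that the generator of \<open>cover c\<close> times the variable \<open>c\<close> equals the generator of the
clique times the monomial of \<open>N c\<close>. Column \<open>k\<close> of the second matrix is this relation for
\<open>c = cs ! k\<close>; beyond that the modules are zero.\<close>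

definition differential :: "nat \<Rightarrow> ('v, 'k::field) mpoly mat" where
  "differential i = (if i = 0 then mat 1 (Suc (length cs)) (\<lambda>(_, k). gen k)
     else if i = 1 then mat (Suc (length cs)) (length cs) (\<lambda>(l, k).
       if l = 0 then Poly_Mapping.single (set_exponent (N (cs ! k))) 1
       else if l = Suc k then - Var (cs ! k) else 0)
     else mat (length (degrees i)) (length (degrees (Suc i))) (\<lambda>_. 0))"

lemma length_degrees:
  "length (degrees 0) = 1" "length (degrees (Suc 0)) = Suc (length cs)"
  "length (degrees (Suc (Suc 0))) = length cs" "length (degrees (Suc (Suc (Suc i)))) = 0"
  by (simp_all add: degrees_def)

lemma differential_carrier: "differential i \<in> carrier_mat (length (degrees i)) (length (degrees (Suc i)))"
proof -
  consider "i = 0" | "i = 1" | "i > 1" by linarith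
  then show ?thesis by cases (auto simp: differential_def length_degrees)
qed

lemma single_graded: "int (total_degree m) = d \<Longrightarrow> Poly_Mapping.single m c \<in> graded_part d"
  by (auto simp: graded_part_eq)

lemma differential_graded:
  assumes lk: "l < length (degrees i)" "k < length (degrees (Suc i))"
  shows "(differential i :: ('v, 'k::field) mpoly mat) $$ (l, k) \<in> graded_part (degrees (Suc i) ! k - degrees i ! l)"
proof -
  consider "i = 0" | "i = 1" | "i > 1" by linarith
  then show ?thesis
  proof cases
    case 1
    with lk have "l = 0" "k < Suc (length cs)" by (auto simp: length_degrees)
    with 1 show ?thesis
      by (cases k) (auto simp: differential_def gen_def degrees_def distinct distinct_card
          intro!: single_graded simp del: upt_Suc)
  next
    case 2
    with lk have lk: "l < Suc (length cs)" "k < length cs" by (auto simp: length_degrees)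
    then have ck: "cs ! k \<in> set cs" by simp
    have "length cs - 1 + card (N (cs ! k)) + 1 = length cs + card (N (cs ! k))"
      using nonempty by (cases cs) auto
    then have d: "int (length cs + card (N (cs ! k))) = int (card (cover (cs ! k))) + 1"
      using card_cover[OF ck] by simp
    show ?thesis
    proof (cases l)
      case 0
      then show ?thesis
        using 2 lk by (auto simp: differential_def degrees_def intro!: single_graded simp del: upt_Suc)
    next
      case (Suc j)
      have "- Var (cs ! k) = (Poly_Mapping.single (Poly_Mapping.single (cs ! k) 1) (- 1) :: ('v, 'k) mpoly)"
        by (simp add: Var_def single_uminus)
      moreover have "total_degree (Poly_Mapping.single (cs ! k) 1) = 1"
        by (simp add: total_degree_def lookup_single when_def)
      ultimately show ?thesis
        using 2 lk Suc d by (auto simp: differential_def degrees_def graded_part_eq intro!: single_graded simp del: upt_Suc)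
    qed
  next
    case 3
    with lk show ?thesis by (auto simp: differential_def graded_part_eq)
  qed
qed

lemma gen_range: "gen ` {..<Suc (length cs)} = (\<lambda>W. Poly_Mapping.single (set_exponent W) (1 :: 'k::field)) ` covers"
proof -
  have "covers = insert (set cs) ((\<lambda>l. cover (cs ! l)) ` {..<length cs})"
    by (auto simp: covers_def set_conv_nth image_iff)
  then show ?thesis
    unfolding lessThan_Suc_eq_insert_0 image_insert image_image by (simp add: gen_def image_image)
qed

lemma in_J_iff: "f \<in> J \<longleftrightarrow> (\<exists>w. f = (\<Sum>k<Suc (length cs). gen k * w k))" for f :: "('v, 'k::field) mpoly"
proof
  let ?r = "Suc (length cs)"
  define L where "L = {f :: ('v, 'k) mpoly. \<exists>w. f = (\<Sum>k<?r. gen k * w k)}"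
  interpret R: cring "poly_ring :: ('v, 'k) mpoly ring" by (rule poly_ring_cring)
  have J: "J = Idl\<^bsub>poly_ring\<^esub> (gen ` {..<?r} :: ('v, 'k) mpoly set)"
    unfolding gen_range genideal_squarefree by (simp add: J_def cover_monomials_def)
  have "ideal L poly_ring"
    unfolding ideal_poly_ring_iff
  proof (intro conjI ballI allI)
    show "0 \<in> L" by (auto simp: L_def intro: exI[of _ "\<lambda>_. 0"])
    fix f assume "f \<in> L"
    then obtain u where u: "f = (\<Sum>k<?r. gen k * u k)" by (auto simp: L_def)
    show "f + g \<in> L" if "g \<in> L" for g
    proof -
      obtain v where "g = (\<Sum>k<?r. gen k * v k)" using \<open>g \<in> L\<close> by (auto simp: L_def)
      then have "f + g = (\<Sum>k<?r. gen k * (u k + v k))"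
        unfolding u by (simp only: distrib_left sum.distrib)
      then show ?thesis unfolding L_def by (intro CollectI exI[of _ "\<lambda>k. u k + v k"])
    qed
    show "g * f \<in> L" for g
    proof -
      have "g * f = (\<Sum>k<?r. gen k * (g * u k))"
        unfolding u sum_distrib_left by (rule sum.cong) (simp_all add: mult.left_commute)
      then show ?thesis unfolding L_def by (intro CollectI exI[of _ "\<lambda>k. g * u k"])
    qed
  qed
  moreover have "gen ` {..<?r} \<subseteq> L"
  proof
    fix f :: "('v, 'k) mpoly" assume "f \<in> gen ` {..<?r}"
    then obtain k where k: "k < ?r" "f = gen k" by blast
    have "(\<Sum>l<?r. gen l * (if l = k then 1 else 0)) = (\<Sum>l<?r. if l = k then gen l else 0)"
      by (rule sum.cong) auto
    also have "\<dots> = f" using k by (simp add: sum.delta del: sum.lessThan_Suc)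
    finally show "f \<in> L"
      unfolding L_def by (intro CollectI exI[of _ "\<lambda>l. if l = k then 1 else 0"]) (rule sym)
  qed
  ultimately have "J \<subseteq> L" unfolding J by (rule R.genideal_minimal)
  then show "f \<in> J \<Longrightarrow> \<exists>w. f = (\<Sum>k<?r. gen k * w k)" by (auto simp: L_def)
  assume "\<exists>w. f = (\<Sum>k<?r. gen k * w k)"
  then obtain w where w: "f = (\<Sum>k<?r. gen k * w k)" by blast
  have "gen k * w k \<in> J" if "k < ?r" for k
  proof -
    have "(gen k :: ('v, 'k) mpoly) \<in> J" unfolding J using R.genideal_self[of "gen ` {..<?r}"] that by (auto simp: poly_ring_simps)
    then have "w k * gen k \<in> J" using J_ideal[where 'k = 'k] by (simp add: ideal_poly_ring_iff)
    then show ?thesis by (simp add: mult.commute)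
  qed
  then show "f \<in> J" unfolding w by (intro ideal_sum_closed[OF J_ideal]) auto
qed

lemma syzygy: "k < length cs \<Longrightarrow>
    gen (Suc k) * Var (cs ! k) = gen 0 * (Poly_Mapping.single (set_exponent (N (cs ! k))) 1 :: ('v, 'k::field) mpoly)"
proof -
  assume "k < length cs"
  then have c: "cs ! k \<in> set cs" by simp
  have "set_exponent (cover (cs ! k)) + Poly_Mapping.single (cs ! k) 1 = set_exponent (set cs) + set_exponent (N (cs ! k))"
    using c N_disjoint[OF c]
    by (intro poly_mapping_eqI) (auto simp: lookup_add lookup_set_exponent lookup_single when_def cover_def)
  then show ?thesis by (simp add: gen_def Var_def mult_single)
qed

text \<open>All generators except the one of \<open>cover c\<close> are divisible by the variable \<open>c\<close>, while that one is coprime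
to it. In a relation the coefficient of \<open>cover c\<close> is therefore divisible by \<open>c\<close>. Subtracting
multiples of the basic syzygies leaves a relation that involves the clique generator alone, which
is trivial.\<close>

lemma syzygy_module:
  fixes w :: "nat \<Rightarrow> ('v, 'k::field) mpoly"
  assumes 0: "(\<Sum>k<Suc (length cs). gen k * w k) = 0"
  shows "\<exists>h. w 0 = (\<Sum>k<length cs. Poly_Mapping.single (set_exponent (N (cs ! k))) 1 * h k) \<and>
    (\<forall>k<length cs. w (Suc k) = - Var (cs ! k) * h k)"
proof -
  have "\<exists>h. w (Suc k) = - Var (cs ! k) * h" if k: "k < length cs" for k
  proof -
    let ?c = "cs ! k"
    have I: "ideal (variable_ideal {?c} :: ('v, 'k) mpoly set) poly_ring" by (rule variable_ideal_ideal)
    have div: "gen l * w l \<in> variable_ideal {?c}" if l: "l < Suc (length cs)" "l \<noteq> Suc k" for l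
    proof -
      have "?c \<in> (case l of 0 \<Rightarrow> set cs | Suc j \<Rightarrow> cover (cs ! j))"
        using l k distinct by (cases l) (auto simp: cover_def nth_eq_iff_index_eq)
      then have "gen l \<in> (variable_ideal {?c} :: ('v, 'k) mpoly set)"
        by (simp add: gen_def variable_ideal_def)
      then have "w l * gen l \<in> variable_ideal {?c}" using I by (simp add: ideal_poly_ring_iff)
      then show ?thesis by (simp add: mult.commute)
    qed
    have "(\<Sum>l<Suc (length cs). gen l * w l) =
        gen (Suc k) * w (Suc k) + (\<Sum>l\<in>{..<Suc (length cs)} - {Suc k}. gen l * w l)"
      using k by (intro sum.remove) auto
    then have "gen (Suc k) * w (Suc k) = 0 - (\<Sum>l\<in>{..<Suc (length cs)} - {Suc k}. gen l * w l)"
      using 0 by (simp add: eq_neg_iff_add_eq_0)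
    also have "\<dots> \<in> variable_ideal {?c}"
      using div I by (intro ideal_diff_closed[OF I] ideal_sum_closed[OF I]) (auto simp: ideal_poly_ring_iff)
    finally have "gen (Suc k) * w (Suc k) \<in> variable_ideal {?c}" .
    then have "w (Suc k) \<in> variable_ideal {?c}"
      unfolding gen_def by (rule variable_ideal_cancel_monomial) (use notin_cover k in simp)
    then obtain h where "w (Suc k) = Var ?c * h" using Var_divides by blast
    then have "w (Suc k) = - Var ?c * (- h)" by simp
    then show ?thesis by blast
  qed
  then obtain h where h: "\<And>k. k < length cs \<Longrightarrow> w (Suc k) = - Var (cs ! k) * h k" by metis
  have "(\<Sum>k<length cs. gen (Suc k) * w (Suc k)) =
      (\<Sum>k<length cs. - (gen 0 * (Poly_Mapping.single (set_exponent (N (cs ! k))) 1 * h k)))"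
  proof (rule sum.cong)
    fix k assume "k \<in> {..<length cs}"
    then have k: "k < length cs" by simp
    have "gen (Suc k) * w (Suc k) = - (gen (Suc k) * Var (cs ! k) * h k)"
      by (simp add: h[OF k] mult.assoc)
    then show "gen (Suc k) * w (Suc k) = - (gen 0 * (Poly_Mapping.single (set_exponent (N (cs ! k))) 1 * h k))"
      by (simp only: syzygy[OF k] mult.assoc)
  qed simp
  then have "gen 0 * (w 0 - (\<Sum>k<length cs. Poly_Mapping.single (set_exponent (N (cs ! k))) 1 * h k)) = 0"
    using 0 by (simp add: sum.lessThan_Suc_shift right_diff_distrib sum_distrib_left sum_negf del: sum.lessThan_Suc)
  then have "w 0 - (\<Sum>k<length cs. Poly_Mapping.single (set_exponent (N (cs ! k))) 1 * h k) = 0"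
    unfolding gen_def single_mult_eq_0_iff .
  then show ?thesis using h by auto
qed

text \<open>The combination of the basic syzygies with coefficients \<open>h\<close>.\<close>

definition syzygy_vector :: "(nat \<Rightarrow> ('v, 'k::field) mpoly) \<Rightarrow> nat \<Rightarrow> ('v, 'k) mpoly" where
  "syzygy_vector h l = (case l of
     0 \<Rightarrow> (\<Sum>k<length cs. Poly_Mapping.single (set_exponent (N (cs ! k))) 1 * h k)
   | Suc k \<Rightarrow> - Var (cs ! k) * h k)"

lemma mult_differential_0:
  assumes "v \<in> carrier_vec (Suc (length cs))"
  shows "differential 0 *\<^sub>v v = vec 1 (\<lambda>_. \<Sum>k<Suc (length cs). gen k * v $ k)"
  using assms by (intro eq_vecI) (auto simp: differential_def scalar_prod_def lessThan_atLeast0 simp del: sum.op_ivl_Suc)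

lemma mult_differential_1:
  fixes v :: "('v, 'k::field) mpoly vec"
  assumes "v \<in> carrier_vec (length cs)"
  shows "differential 1 *\<^sub>v v = vec (Suc (length cs)) (syzygy_vector (\<lambda>k. v $ k))"
proof (rule eq_vecI)
  fix l assume "l < dim_vec (vec (Suc (length cs)) (syzygy_vector (\<lambda>k. v $ k)))"
  then have l: "l < Suc (length cs)" by simp
  have sum: "(differential 1 *\<^sub>v v) $ l = (\<Sum>k<length cs. differential 1 $$ (l, k) * v $ k)"
    using assms l by (simp add: differential_def scalar_prod_def lessThan_atLeast0)
  show "(differential 1 *\<^sub>v v) $ l = vec (Suc (length cs)) (syzygy_vector (\<lambda>k. v $ k)) $ l"
  proof (cases l)
    case 0
    then show ?thesis unfolding sum by (simp add: differential_def syzygy_vector_def)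
  next
    case (Suc j)
    have "(\<Sum>k<length cs. differential 1 $$ (l, k) * v $ k) =
        (\<Sum>k<length cs. if k = j then - Var (cs ! k) * v $ k else 0)"
      using l Suc by (intro sum.cong) (auto simp: differential_def)
    then show ?thesis unfolding sum using l Suc by (simp add: sum.delta syzygy_vector_def)
  qed
qed (simp add: differential_def)

lemma carrier_vec_0: "carrier_vec 0 = {0\<^sub>v 0 :: 'r::zero vec}"
  by (auto intro: eq_vecI)

text \<open>Exactness in homological degree 1 is \<open>syzygy_module\<close>; the second matrix is injective because each of its columns
has an entry \<open>- Var c\<close> in a row of its own.\<close>

lemma hilbert_burch_resolution:
  "graded_free_resolution (J :: ('v, 'k::field) mpoly set) (vec 1 (\<lambda>_. 1)) differential degrees"
  unfolding graded_free_resolution_def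
proof (intro conjI allI impI)
  let ?\<epsilon> = "vec 1 (\<lambda>_. 1) :: ('v, 'k) mpoly vec"
  have eps: "vec (Suc 0) (\<lambda>_. 1) \<bullet> v = v $ 0" if "v \<in> carrier_vec (Suc 0)" for v :: "('v, 'k) mpoly vec"
    using that by (simp add: scalar_prod_def)
  show "?\<epsilon> \<in> carrier_vec (length (degrees 0))" by (simp add: length_degrees)
  show "?\<epsilon> $ k \<in> graded_part (degrees 0 ! k)" if "k < length (degrees 0)" for k
    using that by (auto simp: degrees_def single_graded simp flip: single_one)
  show "differential i \<in> carrier_mat (length (degrees i)) (length (degrees (Suc i)))" for i
    by (rule differential_carrier)
  show "differential i $$ (l, k) \<in> graded_part (degrees (Suc i) ! k - degrees i ! l)"
    if "l < length (degrees i)" "k < length (degrees (Suc i))" for i l k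
    using that by (rule differential_graded)
  show "\<exists>v\<in>carrier_vec (length (degrees 0)). f - ?\<epsilon> \<bullet> v \<in> J" for f
    using J_ideal[where 'k = 'k] by (intro bexI[of _ "vec 1 (\<lambda>_. f)"]) (auto simp: length_degrees eps ideal_poly_ring_iff)
  show "{v \<in> carrier_vec (length (degrees 0)). ?\<epsilon> \<bullet> v \<in> J} =
      (*\<^sub>v) (differential 0) ` carrier_vec (length (degrees 1))"
  proof (intro equalityI subsetI)
    fix v assume "v \<in> {v \<in> carrier_vec (length (degrees 0)). ?\<epsilon> \<bullet> v \<in> J}"
    then have v: "v \<in> carrier_vec 1" "v $ 0 \<in> J" by (auto simp: length_degrees eps)
    then obtain w where w: "v $ 0 = (\<Sum>k<Suc (length cs). gen k * w k)" unfolding in_J_iff by blast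
    have "v = differential 0 *\<^sub>v vec (Suc (length cs)) w"
      using v(1) w by (subst mult_differential_0) (auto intro!: eq_vecI)
    then show "v \<in> (*\<^sub>v) (differential 0) ` carrier_vec (length (degrees 1))"
      by (auto simp: length_degrees)
  next
    fix v :: "('v, 'k) mpoly vec" assume "v \<in> (*\<^sub>v) (differential 0) ` carrier_vec (length (degrees 1))"
    then obtain w where w: "w \<in> carrier_vec (Suc (length cs))" "v = differential 0 *\<^sub>v w"
      by (auto simp: length_degrees)
    then have "v $ 0 \<in> J" unfolding in_J_iff by (auto simp: mult_differential_0)
    then show "v \<in> {v \<in> carrier_vec (length (degrees 0)). ?\<epsilon> \<bullet> v \<in> J}"
      using w by (auto simp: length_degrees eps mult_differential_0)
  qed
  fix i :: nat
  consider "i = 0" | "i = 1" | "i > 1" by linarith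
  then show "{v \<in> carrier_vec (length (degrees (Suc i))). differential i *\<^sub>v v = (0\<^sub>v (length (degrees i)) :: ('v, 'k) mpoly vec)} =
      (*\<^sub>v) (differential (Suc i)) ` carrier_vec (length (degrees (Suc (Suc i))))"
  proof cases
    case 1
    have "{v \<in> carrier_vec (Suc (length cs)). differential 0 *\<^sub>v v = (0\<^sub>v 1 :: ('v, 'k) mpoly vec)} =
        (*\<^sub>v) (differential 1) ` carrier_vec (length cs)"
    proof (intro equalityI subsetI)
      fix v assume "v \<in> {v \<in> carrier_vec (Suc (length cs)). differential 0 *\<^sub>v v = (0\<^sub>v 1 :: ('v, 'k) mpoly vec)}"
      then have v: "v \<in> carrier_vec (Suc (length cs))" "differential 0 *\<^sub>v v = 0\<^sub>v 1" by auto
      have "(\<Sum>k<Suc (length cs). gen k * v $ k) = (differential 0 *\<^sub>v v) $ 0"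
        using v(1) by (simp only: mult_differential_0 index_vec)
      also have "\<dots> = 0" by (simp add: v(2))
      finally obtain h where h: "v $ 0 = (\<Sum>k<length cs. Poly_Mapping.single (set_exponent (N (cs ! k))) 1 * h k)"
        "\<And>k. k < length cs \<Longrightarrow> v $ Suc k = - Var (cs ! k) * h k"
        using syzygy_module[of "\<lambda>k. v $ k"] by blast
      have "v = differential 1 *\<^sub>v vec (length cs) h"
        using v(1) h by (subst mult_differential_1) (auto intro!: eq_vecI simp: syzygy_vector_def split: nat.split)
      then show "v \<in> (*\<^sub>v) (differential 1) ` carrier_vec (length cs)" by auto
    next
      fix v :: "('v, 'k) mpoly vec" assume "v \<in> (*\<^sub>v) (differential 1) ` carrier_vec (length cs)"
      then obtain h where h: "h \<in> carrier_vec (length cs)" "v = differential 1 *\<^sub>v h" by blast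
      have hv: "v = vec (Suc (length cs)) (syzygy_vector (\<lambda>k. h $ k))"
        unfolding h(2) by (rule mult_differential_1[OF h(1)])
      have v: "v \<in> carrier_vec (Suc (length cs))" by (simp add: hv)
      have "(\<Sum>k<Suc (length cs). gen k * v $ k) = gen 0 * v $ 0 + (\<Sum>k<length cs. gen (Suc k) * v $ Suc k)"
        by (rule sum.lessThan_Suc_shift)
      also have "(\<Sum>k<length cs. gen (Suc k) * v $ Suc k) =
          (\<Sum>k<length cs. - (gen 0 * (Poly_Mapping.single (set_exponent (N (cs ! k))) 1 * h $ k)))"
      proof (rule sum.cong)
        fix k assume "k \<in> {..<length cs}"
        then have k: "k < length cs" by simp
        have "gen (Suc k) * v $ Suc k = - (gen (Suc k) * Var (cs ! k) * h $ k)"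
          using k by (simp add: hv syzygy_vector_def mult.assoc)
        then show "gen (Suc k) * v $ Suc k =
            - (gen 0 * (Poly_Mapping.single (set_exponent (N (cs ! k))) 1 * h $ k))"
          by (simp only: syzygy[OF k] mult.assoc)
      qed simp
      also have "gen 0 * v $ 0 + \<dots> = 0"
        by (simp add: hv syzygy_vector_def sum_distrib_left sum_negf)
      finally have "differential 0 *\<^sub>v v = 0\<^sub>v 1"
        unfolding mult_differential_0[OF v] by (intro eq_vecI) (simp_all del: sum.lessThan_Suc)
      then show "v \<in> {v \<in> carrier_vec (Suc (length cs)). differential 0 *\<^sub>v v = 0\<^sub>v 1}" using v by blast
    qed
    then show ?thesis using 1 by (simp add: length_degrees)
  next
    case 2
    have "v = 0\<^sub>v (length cs)"
      if v: "v \<in> carrier_vec (length cs)" and 0: "differential 1 *\<^sub>v v = 0\<^sub>v (Suc (length cs))"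
      for v :: "('v, 'k) mpoly vec"
    proof (rule eq_vecI)
      fix k assume "k < dim_vec (0\<^sub>v (length cs) :: ('v, 'k) mpoly vec)"
      then have k: "k < length cs" by simp
      have "- Var (cs ! k) * v $ k = (differential 1 *\<^sub>v v) $ Suc k"
        unfolding mult_differential_1[OF v] using k by (simp add: syzygy_vector_def)
      also have "\<dots> = 0" unfolding 0 using k by simp
      finally have "Var (cs ! k) * v $ k = 0" by simp
      then show "v $ k = 0\<^sub>v (length cs) $ k" using k unfolding Var_def single_mult_eq_0_iff by simp
    qed (use v in simp)
    moreover have "differential 1 *\<^sub>v 0\<^sub>v (length cs) = (0\<^sub>v (Suc (length cs)) :: ('v, 'k) mpoly vec)"
      by (subst mult_differential_1) (auto intro!: eq_vecI simp: syzygy_vector_def split: nat.split)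
    moreover have "differential 2 *\<^sub>v 0\<^sub>v 0 = (0\<^sub>v (length cs) :: ('v, 'k) mpoly vec)"
      by (intro eq_vecI) (auto simp: differential_def degrees_def scalar_prod_def)
    ultimately show ?thesis
      using 2 by (auto simp: length_degrees carrier_vec_0 numeral_2_eq_2)
  next
    case 3
    then have "i = Suc (Suc (i - 2))" by simp
    then obtain j where j: "i = Suc (Suc j)" by blast
    have "differential (Suc i) *\<^sub>v 0\<^sub>v 0 = (0\<^sub>v 0 :: ('v, 'k) mpoly vec)"
      by (intro eq_vecI) (auto simp: differential_def degrees_def j)
    moreover have "differential i *\<^sub>v 0\<^sub>v 0 = (0\<^sub>v (length (degrees i)) :: ('v, 'k) mpoly vec)"
      using j by (intro eq_vecI) (auto simp: differential_def scalar_prod_def)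
    ultimately show ?thesis by (auto simp: j length_degrees carrier_vec_0)
  qed
qed

text \<open>Minimality is where \<open>N c \<noteq> {}\<close> enters: an empty \<open>N c\<close> would put the entry 1 into the second matrix.\<close>

lemma hilbert_burch_minimal:
  "minimal_graded_free_resolution (J :: ('v, 'k::field) mpoly set) (vec 1 (\<lambda>_. 1)) differential degrees"
  unfolding minimal_graded_free_resolution_def
proof (intro conjI allI subsetI hilbert_burch_resolution)
  fix i and f :: "('v, 'k) mpoly" assume "f \<in> elements_mat (differential i)"
  then obtain l k where lk: "l < length (degrees i)" "k < length (degrees (Suc i))" "f = differential i $$ (l, k)"
    using elements_matD[of f "differential i"] carrier_matD[OF differential_carrier[of i]] by metis
  have single: "Poly_Mapping.lookup (Poly_Mapping.single (set_exponent W) (1 :: 'k)) 0 = 0" if "W \<noteq> {}" for W :: "'v set"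
  proof -
    have "set_exponent W \<noteq> 0" using that keys_set_exponent[of W] by (metis keys_zero)
    then show ?thesis by (simp add: lookup_single when_def)
  qed
  have var: "Poly_Mapping.lookup (Var v :: ('v, 'k) mpoly) 0 = 0" for v
    using single[of "{v}"] by (simp add: Var_def set_exponent_def)
  have "Poly_Mapping.lookup f 0 = 0"
  proof -
    consider "i = 0" | "i = 1" | "i > 1" by linarith
    then show ?thesis
    proof cases
      case 1
      then have "l = 0" "k < Suc (length cs)" using lk by (auto simp: length_degrees)
      moreover have "(case k of 0 \<Rightarrow> set cs | Suc l \<Rightarrow> cover (cs ! l)) \<in> covers"
        using \<open>k < Suc (length cs)\<close> by (cases k) (auto simp: covers_def)
      ultimately show ?thesis
        using 1 lk cover_nonempty by (simp add: differential_def gen_def single)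
    next
      case 2
      then have "l < Suc (length cs)" "k < length cs" using lk by (auto simp: length_degrees)
      then show ?thesis using 2 lk by (simp add: differential_def single N_nonempty var)
    next
      case 3
      then show ?thesis using lk by (simp add: differential_def)
    qed
  qed
  then show "f \<in> irrelevant_ideal" by (simp add: irrelevant_ideal_eq)
qed

text \<open>With \<open>r\<close> clique vertices the shifted degrees are \<open>0\<close>, \<open>r - 1\<close> and, from both the generators of
the sets \<open>cover c\<close> and the syzygies, \<open>r + card (N c) - 2\<close>. For a largest
\<open>N c\<close> the last one is the maximum, since \<open>card (N c) \<ge> 1\<close>.\<close>

lemma regularity_J: "regularity (J :: ('v, 'k::field) mpoly set) = int (length cs + max_N) - 2"
proof -
  let ?r = "length cs"
  have betti: "graded_betti (J :: ('v, 'k) mpoly set) i j = count_list (degrees i) j" for i j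
    by (rule graded_betti_eq[OF hilbert_burch_minimal J_ideal J_homogeneous])
  have r: "0 < ?r" using nonempty by simp
  have set1: "set (degrees 1) = insert (int ?r) ((\<lambda>c. int (card (cover c))) ` set cs)"
  proof -
    have "set (degrees 1) = (\<lambda>k. int (case k of 0 \<Rightarrow> ?r | Suc l \<Rightarrow> card (cover (cs ! l)))) ` {..<Suc ?r}"
      by (simp add: degrees_def atLeast0LessThan del: upt_Suc)
    moreover have "(\<lambda>c. int (card (cover c))) ` set cs = (\<lambda>l. int (card (cover (cs ! l)))) ` {..<?r}"
      by (auto simp: set_conv_nth image_iff)
    ultimately show ?thesis by (simp add: lessThan_Suc_eq_insert_0 image_image)
  qed
  have set2: "set (degrees 2) = (\<lambda>c. int (?r + card (N c))) ` set cs" by (simp add: degrees_def)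
  have "{j - int i | i j. graded_betti (J :: ('v, 'k) mpoly set) i j \<noteq> 0} = {j - int i | i j. j \<in> set (degrees i)}"
    by (simp add: betti count_list_0_iff)
  also have "\<dots> = {0} \<union> (\<lambda>j. j - 1) ` set (degrees 1) \<union> (\<lambda>j. j - 2) ` set (degrees 2)" (is "?A = ?B")
  proof (intro equalityI subsetI)
    fix x assume "x \<in> ?A"
    then obtain i j where ij: "x = j - int i" "j \<in> set (degrees i)" by blast
    consider "i = 0" | "i = 1" | "i = 2" | "i > 2" by linarith
    then show "x \<in> ?B"
      by cases (use ij in \<open>auto simp: degrees_def simp del: upt_Suc\<close>)
  next
    fix x assume "x \<in> ?B"
    then consider "x = 0" | j where "j \<in> set (degrees 1)" "x = j - 1" | j where "j \<in> set (degrees 2)" "x = j - 2"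
      by blast
    then show "x \<in> ?A"
    proof cases
      case 1
      then show ?thesis by (intro CollectI exI[of _ 0] conjI) (simp_all add: degrees_def)
    next
      case (2 j)
      then show ?thesis by (intro CollectI exI[of _ 1] exI[of _ j] conjI) simp_all
    next
      case (3 j)
      then show ?thesis by (intro CollectI exI[of _ 2] exI[of _ j] conjI) simp_all
    qed
  qed
  also have "\<dots> = insert 0 (insert (int ?r - 1) ((\<lambda>c. int (?r + card (N c)) - 2) ` set cs))"
  proof -
    have "int (card (cover c)) - 1 = int (?r + card (N c)) - 2" if "c \<in> set cs" for c
    proof -
      have "card (cover c) + 1 = ?r + card (N c)" using card_cover[OF that] r by arith
      then show ?thesis by simp
    qed
    then show ?thesis unfolding set1 set2 by (auto simp: image_iff)
  qed
  finally have S: "{j - int i | i j. graded_betti (J :: ('v, 'k) mpoly set) i j \<noteq> 0} =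
      insert 0 (insert (int ?r - 1) ((\<lambda>c. int (?r + card (N c)) - 2) ` set cs))" .
  show ?thesis
    unfolding regularity_def S
  proof (rule Max_eqI)
    fix y assume "y \<in> insert 0 (insert (int ?r - 1) ((\<lambda>c. int (?r + card (N c)) - 2) ` set cs))"
    then have "y = 0 \<or> y = int ?r - 1 \<or> (\<exists>c\<in>set cs. y = int (?r + card (N c)) - 2)" by blast
    then show "y \<le> int (?r + max_N) - 2"
    proof (elim disjE bexE)
      fix c assume "c \<in> set cs" "y = int (?r + card (N c)) - 2"
      then show ?thesis using max_N(1)[of c] by linarith
    qed (use max_N(3) r in linarith)+
  next
    obtain c where "c \<in> set cs" "card (N c) = max_N" using max_N(2) by blast
    then show "int (?r + max_N) - 2 \<in> insert 0 (insert (int ?r - 1) ((\<lambda>c. int (?r + card (N c)) - 2) ` set cs))"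
      by force
  qed simp
qed

end

section \<open>Cover ideals of split graphs\<close>

text \<open>A cover that misses a clique vertex \<open>c\<close> must contain all neighbours of \<open>c\<close>, and the set of these
is already a cover. The clique is a minimal cover because each of its vertices has an edge into \<open>I\<close>.\<close>

lemma split_minimal_vertex_covers:
  assumes graph: "pair_graph G" and verts: "pverts G = (UNIV :: 'v::finite set)"
    and split: "split_partition G C I" and I: "\<And>c. c \<in> C \<Longrightarrow> neighbors G c \<inter> I \<noteq> {}"
  shows "{W. minimal_vertex_cover G W} = insert C ((\<lambda>c. (C - {c}) \<union> (neighbors G c \<inter> I)) ` C)"
proof -
  interpret pair_graph G by (rule graph)
  define K where "K = (\<lambda>c. (C - {c}) \<union> (neighbors G c \<inter> I))"
  have CI: "C \<union> I = UNIV" "C \<inter> I = {}" using split verts by (auto simp: split_partition_def)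
  have clique: "(u, v) \<in> parcs G" if "u \<in> C" "v \<in> C" "u \<noteq> v" for u v
    using split that by (simp add: split_partition_def clique_def)
  have indep: "(u, v) \<notin> parcs G" if "u \<in> I" "v \<in> I" for u v
    using split that by (simp add: split_partition_def independent_set_def)
  have irrefl: "(u, u) \<notin> parcs G" for u using pair_no_loops[of "(u, u)"] by auto
  have nb: "neighbors G c = K c" if "c \<in> C" for c
    using that clique CI irrefl unfolding neighbors_def K_def by auto
  have cover_iff: "vertex_cover G W \<longleftrightarrow> (\<forall>(u, v)\<in>parcs G. u \<in> W \<or> v \<in> W)" for W
    by (simp add: vertex_cover_def verts)
  have C: "vertex_cover G C" using indep CI unfolding cover_iff by blast
  have K: "vertex_cover G (K c)" if c: "c \<in> C" for c
    unfolding cover_iff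
  proof (intro ballI, clarify)
    fix u v assume uv: "(u, v) \<in> parcs G" and v: "v \<notin> K c"
    have vu: "(v, u) \<in> parcs G" using uv by (rule arcs_symmetric)
    show "u \<in> K c"
    proof (cases "u = c \<or> v = c")
      case True
      then show ?thesis using uv vu v nb[OF c] irrefl by (auto simp: neighbors_def)
    next
      case False
      then have "v \<in> I" using v CI by (auto simp: K_def)
      then have "u \<in> C" using indep uv CI by blast
      then show ?thesis using False by (simp add: K_def)
    qed
  qed
  have contains: "K c \<subseteq> W" if "vertex_cover G W" "c \<in> C" "c \<notin> W" for c W
    using that unfolding cover_iff nb[OF that(2), symmetric] by (auto simp: neighbors_def)
  have minimal_C: "\<not> vertex_cover G W" if sub: "W \<subset> C" for W
  proof
    assume W: "vertex_cover G W"
    obtain c where c: "c \<in> C" "c \<notin> W" using sub by blast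
    then have "neighbors G c \<inter> I \<subseteq> W" using contains[OF W c] by (auto simp: K_def)
    then show False using I[OF c(1)] sub CI by blast
  qed
  have minimal_K: "\<not> vertex_cover G W" if "W \<subset> K c" "c \<in> C" for W c
  proof
    assume W: "vertex_cover G W"
    have "c \<notin> W" using that CI by (auto simp: K_def)
    then show False using contains[OF W that(2)] that(1) by blast
  qed
  have "minimal_vertex_cover G W \<longleftrightarrow> W \<in> insert C (K ` C)" for W
  proof
    assume W: "minimal_vertex_cover G W"
    then have cov: "vertex_cover G W" by (simp add: minimal_vertex_cover_def)
    show "W \<in> insert C (K ` C)"
    proof (cases "C \<subseteq> W")
      case True
      then show ?thesis using W C by (auto simp: minimal_vertex_cover_def psubset_eq)
    next
      case False
      then obtain c where c: "c \<in> C" "c \<notin> W" by blast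
      then have "K c = W" using W K[OF c(1)] contains[OF cov c]
        unfolding minimal_vertex_cover_def psubset_eq by blast
      then show ?thesis using c by blast
    qed
  next
    assume "W \<in> insert C (K ` C)"
    then show "minimal_vertex_cover G W"
      using C K minimal_C minimal_K by (auto simp: minimal_vertex_cover_def)
  qed
  then show ?thesis unfolding K_def by blast
qed

lemma split_graph_invariants:
  fixes G :: "'v::finite pair_pre_digraph"
  assumes graph: "pair_graph G" and verts: "pverts G = UNIV" and split: "split_partition G C I"
    and C_nonempty: "C \<noteq> {}" and nbrs: "\<And>c. c \<in> C \<Longrightarrow> neighbors G c \<inter> I \<noteq> {}"
  defines "\<Delta> \<equiv> Max ((\<lambda>c. card (neighbors G c \<inter> I)) ` C)"
  shows "regularity (cover_ideal G :: ('v, 'k::field) mpoly set) = int \<Delta> + int (card C) - 2"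
    and "int (Polynomial.degree (h_polynomial (cover_ideal G :: ('v, 'k) mpoly set))) = int \<Delta> + int (card C) - 2"
proof -
  have "C \<inter> I = {}" using split by (simp add: split_partition_def)
  obtain cs where cs: "set cs = C" "distinct cs" using finite_distinct_list[of C] by auto
  have "split_cover cs (\<lambda>c. neighbors G c \<inter> I)"
    using cs C_nonempty nbrs \<open>C \<inter> I = {}\<close> by unfold_locales auto
  then interpret split_cover cs "\<lambda>c. neighbors G c \<inter> I" .
  have "cover_ideal G = (Idl\<^bsub>poly_ring\<^esub> ((\<lambda>W. Poly_Mapping.single (set_exponent W) 1) ` {W. minimal_vertex_cover G W}) :: ('v, 'k) mpoly set)"
    unfolding cover_ideal_def prod_Var image_Collect by (simp add: Setcompr_eq_image)
  also have "{W. minimal_vertex_cover G W} = insert C ((\<lambda>c. (C - {c}) \<union> (neighbors G c \<inter> I)) ` C)"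
    using graph verts split nbrs by (rule split_minimal_vertex_covers)
  also have "\<dots> = covers" by (simp add: covers_def cover_def cs(1))
  also have "(Idl\<^bsub>poly_ring\<^esub> ((\<lambda>W. Poly_Mapping.single (set_exponent W) 1) ` covers) :: ('v, 'k) mpoly set) = J"
    unfolding genideal_squarefree by (simp add: J_def cover_monomials_def)
  finally have J: "cover_ideal G = (J :: ('v, 'k) mpoly set)" .
  have len: "length cs = card C" using cs by (metis distinct_card)
  have max: "max_N = \<Delta>" by (simp add: max_N_def \<Delta>_def cs(1))
  have "1 \<le> card C" using C_nonempty by (simp add: Suc_le_eq card_gt_0_iff)
  moreover have "1 \<le> \<Delta>" using max_N(3) max by simp
  ultimately show "int (Polynomial.degree (h_polynomial (cover_ideal G :: ('v, 'k) mpoly set))) = int \<Delta> + int (card C) - 2"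
    unfolding J degree_h_polynomial_J len max by linarith
  show "regularity (cover_ideal G :: ('v, 'k) mpoly set) = int \<Delta> + int (card C) - 2"
    unfolding J regularity_J len max by simp
qed

text \<open>A clique vertex without neighbours in \<open>I\<close> can be moved to the independent side. Afterwards it is a
neighbour on that side of every remaining clique vertex, so the hypothesis of
\<open>split_graph_invariants\<close> holds.\<close>

lemma split_move_vertex:
  assumes graph: "pair_graph G" and edge: "parcs G \<noteq> {}" and split: "split_partition G C I"
    and c0: "c0 \<in> C" "neighbors G c0 \<inter> I = {}"
  shows "split_partition G (C - {c0}) (insert c0 I)" and "C - {c0} \<noteq> {}"
    and "\<And>c. c \<in> C - {c0} \<Longrightarrow> neighbors G c \<inter> insert c0 I = insert c0 (neighbors G c \<inter> I)"
proof -
  interpret pair_graph G by (rule graph)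
  have irrefl: "(u, u) \<notin> parcs G" for u using pair_no_loops[of "(u, u)"] by auto
  have CI: "C \<union> I = pverts G" "C \<inter> I = {}" using split by (auto simp: split_partition_def)
  have clique: "(u, v) \<in> parcs G" if "u \<in> C" "v \<in> C" "u \<noteq> v" for u v
    using split that by (simp add: split_partition_def clique_def)
  have indep: "(u, v) \<notin> parcs G" if "u \<in> I" "v \<in> I" for u v
    using split that by (simp add: split_partition_def independent_set_def)
  have no: "(c0, v) \<notin> parcs G" "(v, c0) \<notin> parcs G" if "v \<in> I" for v
    using c0(2) that arcs_symmetric[of v c0] by (auto simp: neighbors_def)
  show "split_partition G (C - {c0}) (insert c0 I)"
    using split c0(1) no irrefl
    by (auto simp: split_partition_def clique_def independent_set_def)
  show "C - {c0} \<noteq> {}"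
  proof
    assume "C - {c0} = {}"
    then have C: "C = {c0}" using c0 by blast
    obtain u v where uv: "(u, v) \<in> parcs G" using edge by auto
    then have "u \<in> pverts G" "v \<in> pverts G" using arc_fst_in_verts arc_snd_in_verts by fastforce+
    then have "u \<in> insert c0 I" "v \<in> insert c0 I" using CI C by auto
    then show False using uv indep no irrefl by auto
  qed
  show "neighbors G c \<inter> insert c0 I = insert c0 (neighbors G c \<inter> I)" if "c \<in> C - {c0}" for c
    using clique[of c c0] c0(1) that by (auto simp: neighbors_def)
qed

theorem corollary8p9:
  fixes G :: "'v::finite pair_pre_digraph" and C I :: "'v set"
    and J :: "('v, 'k::field) mpoly set"
  assumes "pair_graph G" and "pverts G = UNIV"
    and "connected (with_proj G)" and "parcs G \<noteq> {}"
    and "split_partition G C I"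
    and "J = cover_ideal G"
  shows "int (Polynomial.degree (h_polynomial J)) = regularity J \<and>
    regularity J = int (Max {card (neighbors G c \<inter> I) | c. c \<in> C}) + int (card C) - 2"
proof -
  note graph = assms(1) and verts = assms(2) and edge = assms(4) and split = assms(5)
  have set: "{card (neighbors G c \<inter> I) | c. c \<in> C} = (\<lambda>c. card (neighbors G c \<inter> I)) ` C" by blast
  show ?thesis
  proof (cases "\<forall>c\<in>C. neighbors G c \<inter> I \<noteq> {}")
    case True
    have "C \<noteq> {}"
      using split edge verts by (auto simp: split_partition_def independent_set_def)
    then show ?thesis
      unfolding assms(6) set using split_graph_invariants[OF graph verts split] True by auto
  next
    case False
    then obtain c0 where c0: "c0 \<in> C" "neighbors G c0 \<inter> I = {}" by blast
    \<comment> \<open>moving \<open>c0\<close> lowers \<open>card C\<close> by one and raises every remaining neighbour count by one\<close>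
    let ?C = "C - {c0}" and ?I = "insert c0 I"
    note move = split_move_vertex[OF graph edge split c0]
    have "c0 \<notin> I" using split c0(1) by (auto simp: split_partition_def)
    then have card: "card (neighbors G c \<inter> ?I) = Suc (card (neighbors G c \<inter> I))" if "c \<in> ?C" for c
      unfolding move(3)[OF that] by (subst card_insert_disjoint) auto
    have "Max ((\<lambda>c. card (neighbors G c \<inter> ?I)) ` ?C) = Max (Suc ` (\<lambda>c. card (neighbors G c \<inter> I)) ` ?C)"
      unfolding image_image using card by (intro arg_cong[of _ _ Max] image_cong) auto
    also have "\<dots> = Suc (Max ((\<lambda>c. card (neighbors G c \<inter> I)) ` ?C))"
      using move(2) by (intro mono_Max_commute[symmetric] monoI) auto
    \<comment> \<open>\<open>c0\<close> contributes only a \<open>0\<close> to the maximum\<close>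
    also have "Max ((\<lambda>c. card (neighbors G c \<inter> I)) ` ?C) = Max ((\<lambda>c. card (neighbors G c \<inter> I)) ` C)"
    proof -
      have "(\<lambda>c. card (neighbors G c \<inter> I)) ` C = insert 0 ((\<lambda>c. card (neighbors G c \<inter> I)) ` ?C)"
        using c0 by (auto simp: image_iff)
      then show ?thesis using move(2) by (simp add: Max_insert)
    qed
    finally have Max: "Max ((\<lambda>c. card (neighbors G c \<inter> ?I)) ` ?C) = Suc (Max ((\<lambda>c. card (neighbors G c \<inter> I)) ` C))" .
    have "card C = Suc (card ?C)" using c0(1) by (metis card_Suc_Diff1 finite)
    moreover have "neighbors G c \<inter> ?I \<noteq> {}" if "c \<in> ?C" for c using move(3)[OF that] by blast
    ultimately show ?thesis
      unfolding assms(6) set using split_graph_invariants[OF graph verts move(1,2)] unfolding Max by auto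
  qed
qed

end
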